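(* Let $p$ be a prime, let $\epsilon > 1$ be an integer, and let $K$ be a (possibly infinite) field of characteristic $p$ with $|K| > 1 + 2p^{\epsilon+1}$. Let $E$ be the natural $2$-dimensional representation of $\mathrm{SL}_2(K)$. The eight $K\mathrm{SL}_2(K)$-modules obtained from $\mathrm{Sym}^p \mathrm{Sym}^{p^\epsilon} E$ by exchanging the order of the symmetric powers and replacing upper symmetric powers with lower symmetric powers (in any combination) are pairwise non-isomorphic, with the exceptions of the isomorphism $\mathrm{Sym}_p \mathrm{Sym}^{p^\epsilon} E \cong \mathrm{Sym}^{p^\epsilon} \mathrm{Sym}_p E$ and its dual $\mathrm{Sym}^p \mathrm{Sym}_{p^\epsilon} E \cong \mathrm{Sym}_{p^\epsilon} \mathrm{Sym}^p E$ (both of which hold), and the possible exceptions of an isomorphism $\mathrm{Sym}^p \mathrm{Sym}^{p^\epsilon} E \cong \mathrm{Sym}^{p^\epsilon} \mathrm{Sym}^p E$ and its dual $\mathrm{Sym}_p \mathrm{Sym}_{p^\epsilon} E \cong \mathrm{Sym}_{p^\epsilon} \mathrm{Sym}_p E$. Thus there are either four or six isomorphism classes of modules. If $p=2$ the possible exceptions do not occur and there are precisely six isomorphism classes of modules.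
   Context: For a $K$-vector space $V$, the symmetric group $S_r$ acts on $V^{\otimes r}$ by place permutation. The lower symmetric power is $\mathrm{Sym}_r V=(V^{\otimes r})^{S_r}$ (invariants), and the upper symmetric power $\mathrm{Sym}^r V$ is the usual symmetric power (coinvariants: the quotient of $V^{\otimes r}$ by the span of all $w\cdot\sigma-w$). The eight modules are $\mathrm{Sym}^{a}\mathrm{Sym}^{b}E$, $\mathrm{Sym}^{a}\mathrm{Sym}_{b}E$, $\mathrm{Sym}_{a}\mathrm{Sym}^{b}E$, $\mathrm{Sym}_{a}\mathrm{Sym}_{b}E$ for $(a,b)=(p,p^\epsilon)$ and $(a,b)=(p^\epsilon,p)$. *)

theory Defs
  imports
    "HOL-Analysis.Determinants"
    "HOL-Algebra.Algebraic_Closure_Type"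
    "HOL-Algebra.Module"
    "HOL-Combinatorics.Permutations"
    "HOL-Library.Poly_Mapping"
begin

text \<open>
  The ground field is a type \<open>'k\<close> of class \<open>field\<close>; where a ring record is needed it is
  \<^const>\<open>ring_of_type_algebra\<close>. A representation is a HOL-Algebra module (whose fields \<open>mult\<close> and
  \<open>one\<close>, inherited from \<open>ring\<close>, play no role) together with the action of a group.
\<close>

record ('g, 'k, 'v) gmod = "('k, 'v) module" +
  act :: "'g \<Rightarrow> 'v \<Rightarrow> 'v"

locale group_rep =
  G?: group G + M?: module "ring_of_type_algebra :: 'k :: field ring" M
  for G :: "'g monoid" and M :: "('g, 'k :: field, 'v) gmod" (structure) +
  assumes act_closed: "\<lbrakk>g \<in> carrier G; x \<in> carrier M\<rbrakk> \<Longrightarrow> act M g x \<in> carrier M"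
    and act_add: "\<lbrakk>g \<in> carrier G; x \<in> carrier M; y \<in> carrier M\<rbrakk> \<Longrightarrow>
          act M g (x \<oplus> y) = act M g x \<oplus> act M g y"
    and act_smult: "\<lbrakk>g \<in> carrier G; x \<in> carrier M\<rbrakk> \<Longrightarrow> act M g (c \<odot> x) = c \<odot> act M g x"
    and act_one: "x \<in> carrier M \<Longrightarrow> act M \<one>\<^bsub>G\<^esub> x = x"
    and act_mult: "\<lbrakk>g \<in> carrier G; h \<in> carrier G; x \<in> carrier M\<rbrakk> \<Longrightarrow>
          act M (g \<otimes>\<^bsub>G\<^esub> h) x = act M g (act M h x)"

definition rep_iso ::
    "'g monoid \<Rightarrow> ('g, 'k :: field, 'v) gmod \<Rightarrow> ('g, 'k, 'w) gmod \<Rightarrow> bool" where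
  "rep_iso G M N \<longleftrightarrow> (\<exists>f. bij_betw f (carrier M) (carrier N) \<and>
     (\<forall>x\<in>carrier M. \<forall>y\<in>carrier M. f (x \<oplus>\<^bsub>M\<^esub> y) = f x \<oplus>\<^bsub>N\<^esub> f y) \<and>
     (\<forall>c. \<forall>x\<in>carrier M. f (c \<odot>\<^bsub>M\<^esub> x) = c \<odot>\<^bsub>N\<^esub> f x) \<and>
     (\<forall>g\<in>carrier G. \<forall>x\<in>carrier M. f (act M g x) = act N g (f x)))"

text \<open>
  Representations on different types are compared by collecting, for each of them, all isomorphic
  representations on the type \<open>nat \<Rightarrow> 'k\<close>. As this type contains a copy of every finite-dimensional
  space, two finite-dimensional representations are isomorphic iff their classes are equal; the
  classes would be empty for representations too large for \<open>nat \<Rightarrow> 'k\<close>.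
\<close>

definition iso_class ::
    "'g monoid \<Rightarrow> ('g, 'k :: field, 'v) gmod \<Rightarrow> ('g, 'k, nat \<Rightarrow> 'k) gmod set" where
  "iso_class G M = {N. group_rep G N \<and> rep_iso G M N}"

definition dual_rep ::
    "'g monoid \<Rightarrow> ('g, 'k :: field, 'v) gmod \<Rightarrow> ('g, 'k, 'v \<Rightarrow> 'k) gmod" where
  "dual_rep G M =
    \<lparr>carrier = {\<phi> \<in> extensional (carrier M).
       (\<forall>x\<in>carrier M. \<forall>y\<in>carrier M. \<phi> (x \<oplus>\<^bsub>M\<^esub> y) = \<phi> x + \<phi> y) \<and>
       (\<forall>c. \<forall>x\<in>carrier M. \<phi> (c \<odot>\<^bsub>M\<^esub> x) = c * \<phi> x)},
     monoid.mult = undefined, one = undefined,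
     ring.zero = (\<lambda>x\<in>carrier M. 0),
     add = (\<lambda>\<phi> \<psi>. \<lambda>x\<in>carrier M. \<phi> x + \<psi> x),
     module.smult = (\<lambda>c \<phi>. \<lambda>x\<in>carrier M. c * \<phi> x),
     act = (\<lambda>g \<phi>. \<lambda>x\<in>carrier M. \<phi> (act M (inv\<^bsub>G\<^esub> g) x))\<rparr>"


subsection \<open>Quotients\<close>

definition gen_submodule :: "('g, 'k :: field, 'v) gmod \<Rightarrow> 'v set \<Rightarrow> 'v set" where
  "gen_submodule M S = \<Inter>{H. submodule H (ring_of_type_algebra :: 'k ring) M \<and> S \<subseteq> H}"

text \<open>The map induced on cosets of \<open>N\<close> by a linear map \<open>\<phi>\<close> that preserves \<open>N\<close>.\<close>

definition coset_map ::
    "('g, 'k, 'v) gmod \<Rightarrow> 'v set \<Rightarrow> ('v \<Rightarrow> 'v) \<Rightarrow> 'v set \<Rightarrow> 'v set" where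
  "coset_map M N \<phi> C = (\<Union>x\<in>C. N +>\<^bsub>M\<^esub> \<phi> x)"

definition quot_rep ::
    "('g, 'k :: field, 'v) gmod \<Rightarrow> 'v set \<Rightarrow> ('g, 'k, 'v set) gmod" where
  "quot_rep M N =
    \<lparr>carrier = a_rcosets\<^bsub>M\<^esub> N,
     monoid.mult = undefined, one = undefined,
     ring.zero = N,
     add = set_add M,
     module.smult = (\<lambda>c. coset_map M N (\<lambda>x. c \<odot>\<^bsub>M\<^esub> x)),
     act = (\<lambda>g. coset_map M N (act M g))\<rparr>"


subsection \<open>Tensor powers\<close>

text \<open>
  \<open>V\<^sup>\<otimes>\<^sup>r\<close> is the free vector space on the lists of \<open>r\<close> vectors of \<open>V\<close> modulo the relations of
  multilinearity.
\<close>

definition push_forward :: "('x \<Rightarrow> 'y) \<Rightarrow> ('x \<Rightarrow>\<^sub>0 'k :: field) \<Rightarrow> ('y \<Rightarrow>\<^sub>0 'k)" where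
  "push_forward \<phi> f = (\<Sum>x\<in>Poly_Mapping.keys f.
     Poly_Mapping.single (\<phi> x) (Poly_Mapping.lookup f x))"

definition free_rep ::
    "nat \<Rightarrow> ('g, 'k :: field, 'v) gmod \<Rightarrow> ('g, 'k, 'v list \<Rightarrow>\<^sub>0 'k) gmod" where
  "free_rep r V =
    \<lparr>carrier = {f. \<forall>xs\<in>Poly_Mapping.keys f. length xs = r \<and> set xs \<subseteq> carrier V},
     monoid.mult = undefined, one = undefined,
     ring.zero = 0,
     add = (+),
     module.smult = (\<lambda>c. Poly_Mapping.map ((*) c)),
     act = (\<lambda>g. push_forward (map (act V g)))\<rparr>"

definition multilinear_relations ::
    "nat \<Rightarrow> ('g, 'k :: field, 'v) gmod \<Rightarrow> ('v list \<Rightarrow>\<^sub>0 'k) set" where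
  "multilinear_relations r V =
     {Poly_Mapping.single (us @ (x \<oplus>\<^bsub>V\<^esub> y) # ws) 1
        - Poly_Mapping.single (us @ x # ws) 1 - Poly_Mapping.single (us @ y # ws) 1
      | us ws x y. Suc (length us + length ws) = r \<and> set us \<union> set ws \<subseteq> carrier V \<and>
          x \<in> carrier V \<and> y \<in> carrier V} \<union>
     {Poly_Mapping.single (us @ (c \<odot>\<^bsub>V\<^esub> x) # ws) 1 - Poly_Mapping.single (us @ x # ws) c
      | us ws c x. Suc (length us + length ws) = r \<and> set us \<union> set ws \<subseteq> carrier V \<and>
          x \<in> carrier V}"

definition tensor_rel ::
    "nat \<Rightarrow> ('g, 'k :: field, 'v) gmod \<Rightarrow> ('v list \<Rightarrow>\<^sub>0 'k) set" where
  "tensor_rel r V = gen_submodule (free_rep r V) (multilinear_relations r V)"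

definition tensor_power ::
    "nat \<Rightarrow> ('g, 'k :: field, 'v) gmod \<Rightarrow> ('g, 'k, ('v list \<Rightarrow>\<^sub>0 'k) set) gmod" where
  "tensor_power r V = quot_rep (free_rep r V) (tensor_rel r V)"

text \<open>The right action \<open>(v\<^sub>0 \<otimes> \<dots> \<otimes> v\<^sub>r\<^sub>-\<^sub>1) \<cdot> \<sigma> = v\<^bsub>\<sigma> 0\<^esub> \<otimes> \<dots> \<otimes> v\<^bsub>\<sigma> (r-1)\<^esub>\<close>.\<close>

definition place_perm ::
    "nat \<Rightarrow> ('g, 'k :: field, 'v) gmod \<Rightarrow> (nat \<Rightarrow> nat) \<Rightarrow>
      ('v list \<Rightarrow>\<^sub>0 'k) set \<Rightarrow> ('v list \<Rightarrow>\<^sub>0 'k) set" where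
  "place_perm r V \<sigma> =
     coset_map (free_rep r V) (tensor_rel r V) (push_forward (permute_list \<sigma>))"


subsection \<open>Symmetric powers\<close>

definition lower_sym ::
    "nat \<Rightarrow> ('g, 'k :: field, 'v) gmod \<Rightarrow> ('g, 'k, ('v list \<Rightarrow>\<^sub>0 'k) set) gmod"
    (\<open>Sym\<^sub>L\<close>) where
  "Sym\<^sub>L r V = (tensor_power r V)\<lparr>carrier :=
     {w \<in> carrier (tensor_power r V). \<forall>\<sigma>. \<sigma> permutes {..<r} \<longrightarrow> place_perm r V \<sigma> w = w}\<rparr>"

definition upper_sym ::
    "nat \<Rightarrow> ('g, 'k :: field, 'v) gmod \<Rightarrow> ('g, 'k, ('v list \<Rightarrow>\<^sub>0 'k) set set) gmod"
    (\<open>Sym\<^sup>U\<close>) where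
  "Sym\<^sup>U r V = quot_rep (tensor_power r V) (gen_submodule (tensor_power r V)
     {place_perm r V \<sigma> w \<ominus>\<^bsub>tensor_power r V\<^esub> w | \<sigma> w.
        \<sigma> permutes {..<r} \<and> w \<in> carrier (tensor_power r V)})"


subsection \<open>The group \<open>SL\<^sub>2\<close> and its natural representation\<close>

definition SL2 :: "('k :: field ^ 2 ^ 2) monoid" where
  "SL2 = \<lparr>carrier = {A. det A = 1}, monoid.mult = (**), one = mat 1\<rparr>"

definition natural_rep :: "('k :: field ^ 2 ^ 2, 'k, 'k ^ 2) gmod" where
  "natural_rep =
    \<lparr>carrier = UNIV, monoid.mult = undefined, one = undefined, ring.zero = 0, add = (+),
     module.smult = (*s), act = (*v)\<rparr>"

abbreviation SL2_iso ::
    "('k :: field ^ 2 ^ 2, 'k, 'v) gmod \<Rightarrow> ('k ^ 2 ^ 2, 'k, 'w) gmod \<Rightarrow> bool"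
    (infix \<open>\<approx>\<close> 50) where
  "M \<approx> N \<equiv> rep_iso SL2 M N"

end

theory Submission
  imports Defs
begin

text \<open>
  In coordinates, \<open>Sym\<^sup>r\<close> and \<open>Sym\<^sub>r\<close> send a matrix \<open>A\<close> to \<open>symU A\<close> and \<open>symL A\<close>, which are exchanged
  by transposition. Inverse transposition on \<open>SL\<^sub>2\<close> is conjugation by a Weyl element, whence the
  dualities. The isomorphism \<open>Sym\<^sup>l Sym\<^sub>m E \<cong> Sym\<^sub>m Sym\<^sup>l E\<close> is Hermite reciprocity: multiplying \<open>l\<close>
  symmetric polynomials in \<open>m\<close> pairs of variables. By the argument of the fundamental theorem on
  symmetric polynomials, its matrix is unitriangular with respect to conjugation of partitions.

  As \<open>K\<close> has more than \<open>1 + 2 p\<^sup>\<epsilon>\<^sup>+\<^sup>1\<close> elements, the diagonal matrices separate the weights, so that an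
  isomorphism preserves weight spaces and matches highest weight vectors up to a scalar. Let \<open>v\<close> be a
  highest weight vector and \<open>u\<close> the lower unitriangular matrix with entry \<open>1\<close>. Counting the letters
  \<open>Y\<close>, the weight components of \<open>u v\<close> that do not vanish are those in \<open>{0, p\<^sup>\<epsilon>\<^sup>+\<^sup>1}\<close> for two upper
  powers, all of \<open>0, \<dots>, p\<^sup>\<epsilon>\<^sup>+\<^sup>1\<close> for two lower powers, and the multiples of the exponent of the upper
  power in the mixed cases; this is because multinomial coefficients of a power of \<open>p\<close> vanish
  in \<open>K\<close>, except for the trivial ones. For \<open>p = 2\<close> the remaining pair is separated by the upper
  unitriangular invariants of the weight with three letters \<open>Y\<close>.
\<close>

subsection \<open>Symmetric powers of matrices\<close>

text \<open>The bound on |K| is what the torus needs. With N = p^(\<epsilon>+1) letters in all, a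
  basis vector with k letters Y has weight a^(N - 2k). After clearing denominators the exponents 2k
  lie between 0 and 2N, and two different ones agree at all nonzero a only if a nonzero polynomial
  of degree at most 2N has |K| - 1 roots.

  The modules are quotients and subspaces of free spaces on lists, over unrelated types, and are
  compared through coordinates. Dividing by factorials is impossible in characteristic p, hence the
  two different bases for upper and lower powers.

  The levels that occur in u v are the same for both double upper powers, so they say nothing about
  that pair. For p = 2 the upper unitriangular invariants of the weights with zero, one and two
  letters Y have dimensions 1, 0 and 1 on either side; three letters give the first weight where the
  two modules differ.\<close>

definition wtype :: "nat \<Rightarrow> (nat \<Rightarrow> 'i) \<Rightarrow> 'i multiset" where
  "wtype r s = image_mset s (mset_set {..<r})"

text \<open>An orbit of the place permutations on basis tensors. Extensionality makes a word depend
  on its letters alone, so that the orbit is finite and counted without repetition.\<close>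

definition words :: "'i multiset \<Rightarrow> (nat \<Rightarrow> 'i) set" where
  "words \<mu> = {s \<in> extensional {..<size \<mu>}. wtype (size \<mu>) s = \<mu>}"

definition word :: "'i multiset \<Rightarrow> nat \<Rightarrow> 'i" where
  "word \<mu> = (SOME s. s \<in> words \<mu>)"

abbreviation tuples :: "nat \<Rightarrow> 'i set \<Rightarrow> (nat \<Rightarrow> 'i) set" where
  "tuples r I \<equiv> PiE {..<r} (\<lambda>_. I)"

lemma size_wtype [simp]: "size (wtype r s) = r"
  by (simp add: wtype_def)

lemma set_mset_wtype: "set_mset (wtype r s) = s ` {..<r}"
  by (simp add: wtype_def)

lemma wtype_cong: "(\<And>k. k < r \<Longrightarrow> s k = t k) \<Longrightarrow> wtype r s = wtype r t"
  unfolding wtype_def by (intro image_mset_cong) auto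

lemma wtype_nth: "wtype (length xs) (\<lambda>k. xs ! k) = mset xs"
proof -
  have "mset xs = mset (map (\<lambda>k. xs ! k) [0..<length xs])" by (simp add: map_nth)
  also have "\<dots> = wtype (length xs) (\<lambda>k. xs ! k)"
    by (simp add: wtype_def atLeast0LessThan)
  finally show ?thesis by simp
qed

lemma word_words: "word \<mu> \<in> words \<mu>"
proof -
  obtain xs where xs: "mset xs = \<mu>" using ex_mset by blast
  then have [simp]: "size \<mu> = length xs" by auto
  then have "restrict (\<lambda>k. xs ! k) {..<size \<mu>} \<in> words \<mu>"
    using wtype_cong[of "length xs" "restrict (\<lambda>k. xs ! k) {..<length xs}" "\<lambda>k. xs ! k"]
    by (simp add: words_def wtype_nth xs)
  then show ?thesis unfolding word_def by (rule someI[where P = "\<lambda>s. s \<in> words \<mu>"])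
qed

lemma wordsD:
  assumes "s \<in> words \<mu>"
  shows "s \<in> extensional {..<size \<mu>}" "wtype (size \<mu>) s = \<mu>"
  using assms by (auto simp: words_def)

lemma words_tuples:
  assumes "\<mu> \<in> multisets_of_size I r"
  shows "words \<mu> = {s \<in> tuples r I. wtype r s = \<mu>}"
proof (intro equalityI subsetI)
  fix s assume "s \<in> words \<mu>"
  then have s: "s \<in> extensional {..<r}" "wtype r s = \<mu>"
    using assms by (auto simp: words_def multisets_of_size_def)
  then have "s ` {..<r} \<subseteq> I"
    using assms set_mset_wtype[of r s] by (simp add: multisets_of_size_def)
  then show "s \<in> {s \<in> tuples r I. wtype r s = \<mu>}" using s by (auto simp: PiE_def)
qed (use assms in \<open>auto simp: words_def multisets_of_size_def PiE_def\<close>)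

lemma tuples_words:
  assumes "s \<in> tuples r I"
  shows "wtype r s \<in> multisets_of_size I r" "s \<in> words (wtype r s)"
  using assms by (auto simp: words_def multisets_of_size_def PiE_def set_mset_wtype)

lemma finite_words [simp]: "finite (words \<mu>)"
proof -
  have "words \<mu> \<subseteq> tuples (size \<mu>) (set_mset \<mu>)"
    by (subst words_tuples[of \<mu> "set_mset \<mu>" "size \<mu>"]) (auto simp: multisets_of_size_def)
  then show ?thesis by (rule finite_subset) (auto intro!: finite_PiE)
qed

text \<open>Sorting the basis tensors by orbit is the bridge between sums over tensors and sums over
  monomials.\<close>

lemma sum_words:
  assumes "finite I"
  shows "(\<Sum>\<mu>\<in>multisets_of_size I r. \<Sum>s\<in>words \<mu>. f s) = (\<Sum>s\<in>tuples r I. f s)"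
proof -
  have "(\<Sum>\<mu>\<in>multisets_of_size I r. \<Sum>s\<in>words \<mu>. f s) =
      (\<Sum>\<mu>\<in>multisets_of_size I r. \<Sum>s\<in>{s \<in> tuples r I. wtype r s = \<mu>}. f s)"
    by (intro sum.cong) (auto simp: words_tuples)
  also have "\<dots> = (\<Sum>s\<in>tuples r I. f s)"
    using assms tuples_words(1) by (intro sum.group finite_PiE finite_multisets_of_size) auto
  finally show ?thesis .
qed

lemma wtype_permute:
  assumes "\<sigma> permutes {..<r}"
  shows "wtype r (s \<circ> \<sigma>) = wtype r s"
proof -
  have "wtype r (s \<circ> \<sigma>) = image_mset s (image_mset \<sigma> (mset_set {..<r}))"
    by (simp add: wtype_def image_mset.compositionality o_def)
  also have "image_mset \<sigma> (mset_set {..<r}) = mset_set (\<sigma> ` {..<r})"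
    using assms by (intro image_mset_mset_set) (auto simp: permutes_inj_on)
  finally show ?thesis using assms by (simp add: wtype_def permutes_image o_def)
qed

lemma extensional_permute:
  assumes "\<sigma> permutes A" "s \<in> extensional A"
  shows "s \<circ> \<sigma> \<in> extensional A"
  using assms by (auto simp: extensional_def permutes_not_in)

lemma words_permute:
  assumes "\<sigma> permutes {..<size \<mu>}" "s \<in> words \<mu>"
  shows "s \<circ> \<sigma> \<in> words \<mu>"
  using assms by (auto simp: words_def wtype_permute extensional_permute)

lemma tuples_permute:
  assumes "\<sigma> permutes {..<r}" "s \<in> tuples r I"
  shows "s \<circ> \<sigma> \<in> tuples r I"
  using assms extensional_permute[of \<sigma> "{..<r}" s] permutes_in_image[OF assms(1)]
  by (auto simp: PiE_def)

lemma bij_betw_permute: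
  assumes \<sigma>: "\<sigma> permutes A"
    and S: "\<And>\<sigma> s. \<sigma> permutes A \<Longrightarrow> s \<in> S \<Longrightarrow> s \<circ> \<sigma> \<in> S"
  shows "bij_betw (\<lambda>s. s \<circ> \<sigma>) S S"
  by (rule bij_betw_byWitness[where f' = "\<lambda>s. s \<circ> Hilbert_Choice.inv \<sigma>"])
    (auto simp: S \<sigma> permutes_inv comp_assoc permutes_inv_o[OF \<sigma>])

text \<open>Transitivity on orbits is what makes everything computed from \<open>word \<mu>\<close>
  independent of that choice.\<close>

lemma ex_permute:
  assumes "s \<in> words \<mu>" "t \<in> words \<mu>"
  obtains \<sigma> where "\<sigma> permutes {..<size \<mu>}" "t = s \<circ> \<sigma>"
proof -
  have "image_mset t (mset_set {..<size \<mu>}) = image_mset s (mset_set {..<size \<mu>})"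
    using assms by (simp add: words_def wtype_def)
  then obtain \<sigma> where \<sigma>: "\<sigma> permutes {..<size \<mu>}" "\<forall>x\<in>{..<size \<mu>}. t x = s (\<sigma> x)"
    by (metis finite_lessThan image_mset_eq_implies_permutes)
  have "t x = (s \<circ> \<sigma>) x" for x
    using \<sigma> assms extensional_permute[OF \<sigma>(1), of s]
    by (cases "x \<in> {..<size \<mu>}") (auto simp: words_def extensional_def)
  then have "t = s \<circ> \<sigma>" ..
  with \<sigma> show ?thesis using that by blast
qed

text \<open>Columns are taken with respect to monomials for \<open>symU\<close>, and to orbit sums of words for \<open>symL\<close>.\<close>

definition symU :: "('i \<Rightarrow> 'j \<Rightarrow> 'k :: comm_semiring_1) \<Rightarrow> 'i multiset \<Rightarrow> 'j multiset \<Rightarrow> 'k" where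
  "symU A \<mu> \<nu> = (\<Sum>s\<in>words \<mu>. \<Prod>k<size \<nu>. A (s k) (word \<nu> k))"

definition symL :: "('i \<Rightarrow> 'j \<Rightarrow> 'k :: comm_semiring_1) \<Rightarrow> 'i multiset \<Rightarrow> 'j multiset \<Rightarrow> 'k" where
  "symL A \<mu> \<nu> = (\<Sum>t\<in>words \<nu>. \<Prod>k<size \<mu>. A (word \<mu> k) (t k))"

text \<open>A permutation of the positions of the column word is absorbed by the row words, which
  run over a whole orbit.\<close>

lemma symU_word:
  assumes "t \<in> words \<nu>" "size \<mu> = size \<nu>"
  shows "symU A \<mu> \<nu> = (\<Sum>s\<in>words \<mu>. \<Prod>k<size \<nu>. A (s k) (t k))"
proof -
  obtain \<sigma> where \<sigma>: "\<sigma> permutes {..<size \<nu>}" "t = word \<nu> \<circ> \<sigma>"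
    using ex_permute[OF word_words assms(1)] .
  have "symU A \<mu> \<nu> = (\<Sum>s\<in>words \<mu>. \<Prod>k<size \<nu>. A (s (\<sigma> k)) (word \<nu> (\<sigma> k)))"
    unfolding symU_def
    by (intro sum.cong refl, subst prod.permute[OF \<sigma>(1)]) (simp add: o_def)
  also have "\<dots> = (\<Sum>s\<in>words \<mu>. \<Prod>k<size \<nu>. A ((s \<circ> \<sigma>) k) (t k))"
    by (simp add: \<sigma>(2))
  also have "\<dots> = (\<Sum>s\<in>words \<mu>. \<Prod>k<size \<nu>. A (s k) (t k))"
    using \<sigma>(1) assms(2) words_permute[of _ \<mu>]
    by (intro sum.reindex_bij_betw bij_betw_permute[where A = "{..<size \<nu>}"]) auto
  finally show ?thesis .
qed

lemma symL_symU:
  assumes "size \<mu> = size \<nu>"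
  shows "symL A \<mu> \<nu> = symU (\<lambda>i j. A j i) \<nu> \<mu>"
  using assms by (simp add: symL_def symU_def)

lemma multisets_of_sizeD: "\<mu> \<in> multisets_of_size I r \<Longrightarrow> size \<mu> = r"
  by (simp add: multisets_of_size_def)

lemma words_in: "\<mu> \<in> multisets_of_size I r \<Longrightarrow> s \<in> words \<mu> \<Longrightarrow> k < r \<Longrightarrow> s k \<in> I"
  by (auto simp: words_tuples PiE_def)

lemma symU_cong:
  assumes "\<And>i j. i \<in> I \<Longrightarrow> j \<in> J \<Longrightarrow> A i j = B i j"
    and "\<mu> \<in> multisets_of_size I r" "\<nu> \<in> multisets_of_size J r"
  shows "symU A \<mu> \<nu> = symU B \<mu> \<nu>"
  unfolding symU_def multisets_of_sizeD[OF assms(3)]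
  using words_in[OF assms(2)] words_in[OF assms(3) word_words]
  by (intro sum.cong prod.cong refl assms(1)) auto

lemma symL_cong:
  assumes "\<And>i j. i \<in> I \<Longrightarrow> j \<in> J \<Longrightarrow> A i j = B i j"
    and "\<mu> \<in> multisets_of_size I r" "\<nu> \<in> multisets_of_size J r"
  shows "symL A \<mu> \<nu> = symL B \<mu> \<nu>"
  using symU_cong[of J I "\<lambda>i j. A j i" "\<lambda>i j. B j i" \<nu> r \<mu>] assms
  by (simp add: symL_symU multisets_of_sizeD)

section \<open>Functoriality of the symmetric powers of matrices\<close>

definition mmul :: "'j set \<Rightarrow> ('i \<Rightarrow> 'j \<Rightarrow> 'a :: comm_semiring_1) \<Rightarrow> ('j \<Rightarrow> 'l \<Rightarrow> 'a) \<Rightarrow> 'i \<Rightarrow> 'l \<Rightarrow> 'a" where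
  "mmul J A B = (\<lambda>i l. \<Sum>j\<in>J. A i j * B j l)"

text \<open>Multiplying out turns a product of sums over \<open>J\<close> into a sum over tuples
  \<open>u\<close>. By \<open>symU_word\<close> the factor coming from \<open>A\<close> depends on
  the content of \<open>u\<close> only, so the tuples can be grouped by content.\<close>

lemma symU_mult:
  assumes J: "finite J" and \<mu>: "size \<mu> = r" and \<nu>: "size \<nu> = r"
  shows "symU (mmul J A B) \<mu> \<nu> = mmul (multisets_of_size J r) (symU A) (symU B) \<mu> \<nu>"
proof -
  have "symU (mmul J A B) \<mu> \<nu> =
      (\<Sum>s\<in>words \<mu>. \<Sum>u\<in>tuples r J. (\<Prod>k<r. A (s k) (u k)) * (\<Prod>k<r. B (u k) (word \<nu> k)))"
    using J by (simp add: symU_def mmul_def \<nu> prod_sum_PiE prod.distrib)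
  also have "\<dots> = (\<Sum>u\<in>tuples r J. (\<Sum>s\<in>words \<mu>. \<Prod>k<r. A (s k) (u k)) * (\<Prod>k<r. B (u k) (word \<nu> k)))"
    by (subst sum.swap) (simp add: sum_distrib_right)
  also have "\<dots> = (\<Sum>\<kappa>\<in>multisets_of_size J r. \<Sum>u\<in>words \<kappa>.
      (\<Sum>s\<in>words \<mu>. \<Prod>k<r. A (s k) (u k)) * (\<Prod>k<r. B (u k) (word \<nu> k)))"
    by (rule sum_words[OF J, symmetric])
  also have "\<dots> = (\<Sum>\<kappa>\<in>multisets_of_size J r. \<Sum>u\<in>words \<kappa>. symU A \<mu> \<kappa> * (\<Prod>k<r. B (u k) (word \<nu> k)))"
    using \<mu> by (intro sum.cong refl) (simp add: symU_word multisets_of_sizeD)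
  also have "\<dots> = mmul (multisets_of_size J r) (symU A) (symU B) \<mu> \<nu>"
    by (simp add: mmul_def symU_def[of B] \<nu> sum_distrib_left)
  finally show ?thesis .
qed

lemma symL_mult:
  assumes J: "finite J" and \<mu>: "size \<mu> = r" and \<nu>: "size \<nu> = r"
  shows "symL (mmul J A B) \<mu> \<nu> = mmul (multisets_of_size J r) (symL A) (symL B) \<mu> \<nu>"
proof -
  \<comment> \<open>Transposition reverses the order of the factors.\<close>
  have "symL (mmul J A B) \<mu> \<nu> = symU (mmul J (\<lambda>i j. B j i) (\<lambda>i j. A j i)) \<nu> \<mu>"
    using assms by (simp add: symL_symU mmul_def mult.commute)
  also have "\<dots> = mmul (multisets_of_size J r) (symL A) (symL B) \<mu> \<nu>"
    using assms by (subst symU_mult) (auto simp: mmul_def symL_symU multisets_of_sizeD mult.commute intro!: sum.cong)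
  finally show ?thesis .
qed

definition diag :: "('i \<Rightarrow> 'a :: comm_semiring_1) \<Rightarrow> 'i \<Rightarrow> 'i \<Rightarrow> 'a" where
  "diag d i j = (if i = j then d i else 0)"

lemma prod_word:
  assumes "t \<in> words \<mu>"
  shows "(\<Prod>k<size \<mu>. d (t k)) = prod_mset (image_mset d \<mu>)"
proof -
  have "prod_mset (image_mset d \<mu>) = prod_mset (image_mset d (wtype (size \<mu>) t))"
    using wordsD[OF assms] by simp
  then show ?thesis
    by (simp add: wtype_def prod_unfold_prod_mset image_mset.compositionality o_def)
qed

lemma symU_diag:
  assumes "size \<mu> = size \<nu>"
  shows "symU (diag d) \<mu> \<nu> = diag (\<lambda>\<mu>. prod_mset (image_mset d \<mu>)) \<mu> \<nu>"
proof -
  let ?t = "word \<nu>"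
  have t: "?t \<in> words \<nu>" by (rule word_words)
  have "(\<Prod>k<size \<nu>. diag d (s k) (?t k)) = (if s = ?t then prod_mset (image_mset d \<nu>) else 0)"
    if s: "s \<in> words \<mu>" for s
  proof (cases "s = ?t")
    case True
    then show ?thesis using prod_word[OF t, of d] by (simp add: diag_def)
  next
    case False
    then obtain k where "s k \<noteq> ?t k" by auto
    moreover from this have "k < size \<nu>"
      using wordsD(1)[OF s] wordsD(1)[OF t] assms
      by (metis extensional_arb lessThan_iff)
    ultimately show ?thesis using False by (auto simp: diag_def intro!: prod_zero)
  qed
  then have "symU (diag d) \<mu> \<nu> = (\<Sum>s\<in>words \<mu>. if s = ?t then prod_mset (image_mset d \<nu>) else 0)"
    unfolding symU_def by (intro sum.cong refl)
  also have "\<dots> = (if ?t \<in> words \<mu> then prod_mset (image_mset d \<nu>) else 0)"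
    by simp
  also have "?t \<in> words \<mu> \<longleftrightarrow> \<mu> = \<nu>"
    using t assms by (auto simp: words_def)
  finally show ?thesis unfolding diag_def[of "\<lambda>\<mu>. prod_mset (image_mset d \<mu>)"] by auto
qed

lemma symL_diag:
  assumes "size \<mu> = size \<nu>"
  shows "symL (diag d) \<mu> \<nu> = diag (\<lambda>\<mu>. prod_mset (image_mset d \<mu>)) \<mu> \<nu>"
proof -
  have "(\<lambda>i j. diag d j i) = diag d" by (auto simp: diag_def fun_eq_iff)
  then show ?thesis using assms
    by (simp add: symL_symU symU_diag) (auto simp: diag_def)
qed

subsection \<open>Grids\<close>

definition grid :: "nat \<Rightarrow> nat \<Rightarrow> (nat \<times> nat \<Rightarrow> 'i) set" where
  "grid l m = extensional ({..<l} \<times> {..<m})"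

definition grid_rows :: "nat \<Rightarrow> nat \<Rightarrow> (nat \<Rightarrow> 'i multiset) \<Rightarrow> (nat \<times> nat \<Rightarrow> 'i) set" where
  "grid_rows l m t = {w \<in> grid l m. \<forall>i<l. wtype m (\<lambda>k. w (i, k)) = t i}"

definition grid_cols :: "nat \<Rightarrow> nat \<Rightarrow> (nat \<Rightarrow> 'i multiset) \<Rightarrow> (nat \<times> nat \<Rightarrow> 'i) set" where
  "grid_cols l m s = {w \<in> grid l m. \<forall>k<m. wtype l (\<lambda>i. w (i, k)) = s k}"

text \<open>The coefficients of the multiplication map \<open>Sym\<^sup>l Sym\<^sub>m E \<rightarrow> Sym\<^sub>m Sym\<^sup>l E\<close>: row \<open>i\<close> of a grid is a term
  of the \<open>i\<close>-th factor.\<close>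

definition hermite :: "nat \<Rightarrow> nat \<Rightarrow> 'i multiset multiset \<Rightarrow> 'i multiset multiset \<Rightarrow> nat" where
  "hermite l m \<eta> \<mu> = card (grid_cols l m (word \<eta>) \<inter> grid_rows l m (word \<mu>))"

lemma finite_grid [simp]: "finite (grid l m :: (nat \<times> nat \<Rightarrow> 'i :: finite) set)"
proof -
  have "grid l m = PiE ({..<l} \<times> {..<m}) (\<lambda>_. UNIV :: 'i set)" by (auto simp: grid_def PiE_def)
  then show ?thesis by (auto intro!: finite_PiE)
qed

lemma finite_grid_rows [simp]: "finite (grid_rows l m t :: (nat \<times> nat \<Rightarrow> 'i :: finite) set)"
  by (rule finite_subset[OF _ finite_grid]) (auto simp: grid_rows_def)

lemma finite_grid_cols [simp]: "finite (grid_cols l m t :: (nat \<times> nat \<Rightarrow> 'i :: finite) set)"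
  by (rule finite_subset[OF _ finite_grid]) (auto simp: grid_cols_def)

lemma grid_swap: "w \<in> grid l m \<Longrightarrow> w \<circ> prod.swap \<in> grid m l"
  by (auto simp: grid_def extensional_def)

lemma bij_betw_swap: "bij_betw (\<lambda>w. w \<circ> prod.swap) (grid_rows l m t) (grid_cols m l t)"
  by (rule bij_betw_byWitness[where f' = "\<lambda>w. w \<circ> prod.swap"])
    (auto simp: grid_rows_def grid_cols_def grid_swap comp_assoc)

lemma bij_betw_swap': "bij_betw (\<lambda>w. w \<circ> prod.swap) (grid_cols l m t) (grid_rows m l t)"
  by (rule bij_betw_byWitness[where f' = "\<lambda>w. w \<circ> prod.swap"])
    (auto simp: grid_rows_def grid_cols_def grid_swap comp_assoc)

lemma hermite_swap: "hermite l m \<eta> \<mu> = hermite m l \<mu> \<eta>"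
proof -
  have "bij_betw (\<lambda>w. w \<circ> prod.swap) (grid_cols l m (word \<eta>) \<inter> grid_rows l m (word \<mu>))
    (grid_cols m l (word \<mu>) \<inter> grid_rows m l (word \<eta>))"
    by (rule bij_betw_byWitness[where f' = "\<lambda>w. w \<circ> prod.swap"])
      (auto simp: grid_rows_def grid_cols_def grid_swap comp_assoc)
  then show ?thesis unfolding hermite_def by (rule bij_betw_same_card)
qed

text \<open>Rows and columns of a grid may be permuted independently: a permutation of the rows
  leaves the contents of the columns alone, and conversely.\<close>

lemma hermite_words:
  assumes s: "s \<in> words \<eta>" and t: "t \<in> words \<mu>" and "size \<eta> = m" "size \<mu> = l"
  shows "hermite l m \<eta> \<mu> = card (grid_cols l m s \<inter> grid_rows l m t)"
proof -
  obtain \<sigma> where \<sigma>: "\<sigma> permutes {..<m}" "s = word \<eta> \<circ> \<sigma>"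
    using ex_permute[OF word_words s] assms by auto
  obtain \<tau> where \<tau>: "\<tau> permutes {..<l}" "t = word \<mu> \<circ> \<tau>"
    using ex_permute[OF word_words t] assms by auto
  have ext: "w \<circ> map_prod \<tau>' \<sigma>' \<in> grid l m"
    if "w \<in> grid l m" "\<tau>' permutes {..<l}" "\<sigma>' permutes {..<m}" for w \<tau>' \<sigma>'
    using that permutes_in_image[OF that(2)] permutes_in_image[OF that(3)]
    by (auto simp: grid_def extensional_def)
  have row: "wtype m (\<lambda>k. w (i, \<sigma>' k)) = wtype m (\<lambda>k. w (i, k))"
    if "\<sigma>' permutes {..<m}" for w :: "nat \<times> nat \<Rightarrow> 'a" and \<sigma>' i
    using wtype_permute[OF that, of "\<lambda>k. w (i, k)"] by (simp add: o_def)
  have col: "wtype l (\<lambda>i. w (\<tau>' i, k)) = wtype l (\<lambda>i. w (i, k))"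
    if "\<tau>' permutes {..<l}" for w :: "nat \<times> nat \<Rightarrow> 'a" and \<tau>' k
    using wtype_permute[OF that, of "\<lambda>i. w (i, k)"] by (simp add: o_def)
  have lt: "\<sigma>' k < n" if "\<sigma>' permutes {..<n}" "k < n" for \<sigma>' k n
    using permutes_in_image[OF that(1), of k] that(2) by simp
  note inv = permutes_inv[OF \<sigma>(1)] permutes_inv[OF \<tau>(1)]
  note pinv = permutes_inverses[OF \<sigma>(1)] permutes_inverses[OF \<tau>(1)]
  have "bij_betw (\<lambda>w. w \<circ> map_prod \<tau> \<sigma>) (grid_cols l m (word \<eta>) \<inter> grid_rows l m (word \<mu>))
    (grid_cols l m s \<inter> grid_rows l m t)"
  proof (rule bij_betw_byWitness[where f' = "\<lambda>w. w \<circ> map_prod (Hilbert_Choice.inv \<tau>) (Hilbert_Choice.inv \<sigma>)"])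
    show "\<forall>w\<in>grid_cols l m (word \<eta>) \<inter> grid_rows l m (word \<mu>).
        w \<circ> map_prod \<tau> \<sigma> \<circ> map_prod (Hilbert_Choice.inv \<tau>) (Hilbert_Choice.inv \<sigma>) = w"
      by (auto simp: fun_eq_iff pinv)
    show "\<forall>w\<in>grid_cols l m s \<inter> grid_rows l m t. w \<circ> map_prod (Hilbert_Choice.inv \<tau>) (Hilbert_Choice.inv \<sigma>) \<circ> map_prod \<tau> \<sigma> = w"
      by (auto simp: fun_eq_iff pinv)
    show "(\<lambda>w. w \<circ> map_prod \<tau> \<sigma>) ` (grid_cols l m (word \<eta>) \<inter> grid_rows l m (word \<mu>)) \<subseteq> grid_cols l m s \<inter> grid_rows l m t"
      using \<sigma> \<tau> by (auto simp: grid_cols_def grid_rows_def ext row col lt)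
    show "(\<lambda>w. w \<circ> map_prod (Hilbert_Choice.inv \<tau>) (Hilbert_Choice.inv \<sigma>)) ` (grid_cols l m s \<inter> grid_rows l m t) \<subseteq>
        grid_cols l m (word \<eta>) \<inter> grid_rows l m (word \<mu>)"
      using \<sigma>(2) \<tau>(2) inv by (auto simp: grid_cols_def grid_rows_def ext row col lt pinv)
  qed
  then show ?thesis unfolding hermite_def by (rule bij_betw_same_card)
qed

text \<open>Rewrites the composite of the multiplication map and the action as a sum over pairs of
  grids, a form in which rows and columns can be exchanged. The grid \<open>w\<close> records the
  terms chosen by the multiplication, \<open>w'\<close> those chosen by the action.\<close>

lemma hermite_symL_symU:
  fixes A :: "'i :: finite \<Rightarrow> 'i \<Rightarrow> 'k :: comm_semiring_1"
  assumes \<eta>: "\<eta> \<in> multisets_of_size (multisets_of_size UNIV l) m"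
    and \<mu>: "\<mu> \<in> multisets_of_size (multisets_of_size UNIV m) l"
  shows "(\<Sum>\<kappa>\<in>multisets_of_size (multisets_of_size UNIV l) m.
      symL (symU A) \<eta> \<kappa> * of_nat (hermite l m \<kappa> \<mu>)) =
    (\<Sum>w\<in>grid_rows l m (word \<mu>). \<Sum>w'\<in>grid_cols l m (word \<eta>). \<Prod>x\<in>{..<l} \<times> {..<m}. A (w' x) (w x))"
proof -
  let ?M = "multisets_of_size (UNIV :: 'i set) l"
  let ?s = "word \<eta>" and ?t = "word \<mu>"
  let ?ct = "\<lambda>w. restrict (\<lambda>k. wtype l (\<lambda>i. w (i, k))) {..<m}"
  have fM: "finite ?M" by (intro finite_multisets_of_size) auto
  have sz: "size \<eta> = m" "size \<mu> = l" using \<eta> \<mu> by (auto simp: multisets_of_sizeD)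
  have "(\<Sum>\<kappa>\<in>multisets_of_size ?M m. symL (symU A) \<eta> \<kappa> * of_nat (hermite l m \<kappa> \<mu>)) =
    (\<Sum>\<kappa>\<in>multisets_of_size ?M m. \<Sum>s\<in>words \<kappa>.
      (\<Prod>k<m. symU A (?s k) (s k)) * of_nat (card (grid_cols l m s \<inter> grid_rows l m ?t)))"
    unfolding symL_def sum_distrib_right sz
    by (intro sum.cong refl) (simp add: hermite_words[OF _ word_words] multisets_of_sizeD sz)
  also have "\<dots> = (\<Sum>s\<in>tuples m ?M. (\<Prod>k<m. symU A (?s k) (s k)) * of_nat (card (grid_cols l m s \<inter> grid_rows l m ?t)))"
    by (rule sum_words[OF fM])
  \<comment> \<open>The number of grids is replaced by a sum over the grids themselves, sorted by
    the contents \<open>?ct w\<close> of their columns.\<close>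
  also have "\<dots> = (\<Sum>s\<in>tuples m ?M. \<Sum>w\<in>{w \<in> grid_rows l m ?t. ?ct w = s}. \<Prod>k<m. symU A (?s k) (?ct w k))"
  proof (intro sum.cong refl)
    fix s assume s: "s \<in> tuples m ?M"
    have eq: "grid_cols l m s \<inter> grid_rows l m ?t = {w \<in> grid_rows l m ?t. ?ct w = s}"
    proof -
      have "(\<forall>k<m. wtype l (\<lambda>i. w (i, k)) = s k) \<longleftrightarrow> ?ct w = s" for w :: "nat \<times> nat \<Rightarrow> 'i"
        using s by (auto simp: PiE_def extensional_def fun_eq_iff)
      then show ?thesis by (auto simp: grid_cols_def grid_rows_def)
    qed
    have "(\<Sum>w\<in>{w \<in> grid_rows l m ?t. ?ct w = s}. \<Prod>k<m. symU A (?s k) (?ct w k)) =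
        (\<Sum>w\<in>{w \<in> grid_rows l m ?t. ?ct w = s}. \<Prod>k<m. symU A (?s k) (s k))"
      by (intro sum.cong refl) auto
    then show "(\<Prod>k<m. symU A (?s k) (s k)) * of_nat (card (grid_cols l m s \<inter> grid_rows l m ?t)) =
        (\<Sum>w\<in>{w \<in> grid_rows l m ?t. ?ct w = s}. \<Prod>k<m. symU A (?s k) (?ct w k))"
      unfolding eq by (simp add: mult.commute)
  qed
  also have "\<dots> = (\<Sum>w\<in>grid_rows l m ?t. \<Prod>k<m. symU A (?s k) (?ct w k))"
  proof (rule sum.group)
    show "finite (tuples m ?M)" using fM by (intro finite_PiE) auto
    show "?ct ` grid_rows l m ?t \<subseteq> tuples m ?M" 
    proof (rule image_subsetI)
      fix w :: "nat \<times> nat \<Rightarrow> 'i"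
      have "\<forall>k\<in>{..<m}. wtype l (\<lambda>i. w (i, k)) \<in> ?M" by (simp add: multisets_of_size_def)
      then show "?ct w \<in> tuples m ?M" by (simp only: restrict_PiE_iff)
    qed
  qed simp
  also have "\<dots> = (\<Sum>w\<in>grid_rows l m ?t. \<Sum>w'\<in>grid_cols l m ?s. \<Prod>x\<in>{..<l} \<times> {..<m}. A (w' x) (w x))"
  proof (intro sum.cong refl)
    fix w assume w: "w \<in> grid_rows l m ?t"
    have ssz: "size (?s k) = l" if "k < m" for k
      using words_in[OF \<eta> word_words that] by (simp add: multisets_of_sizeD)
    have "symU A (?s k) (?ct w k) = (\<Sum>u\<in>words (?s k). \<Prod>i<l. A (u i) (w (i, k)))" if k: "k < m" for k
    proof -
      \<comment> \<open>A column of \<open>w\<close> serves as representative of its own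
        content.\<close>
      have "restrict (\<lambda>i. w (i, k)) {..<l} \<in> words (?ct w k)"
        using k by (auto simp: words_def intro!: wtype_cong)
      from symU_word[OF this, of "?s k" A] show ?thesis using ssz k by simp
    qed
    then have "(\<Prod>k<m. symU A (?s k) (?ct w k)) =
        (\<Prod>k<m. \<Sum>u\<in>words (?s k). \<Prod>i<l. A (u i) (w (i, k)))"
      by (intro prod.cong refl) auto
    also have "\<dots> = (\<Sum>U\<in>PiE {..<m} (\<lambda>k. words (?s k)). \<Prod>k<m. \<Prod>i<l. A (U k i) (w (i, k)))"
      by (rule prod_sum_PiE) auto
    \<comment> \<open>One word for every column is the same thing as a grid with prescribed contents
      of the columns.\<close>
    also have "\<dots> = (\<Sum>w'\<in>grid_cols l m ?s. \<Prod>k<m. \<Prod>i<l. A (w' (i, k)) (w (i, k)))"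
    proof (rule sum.reindex_bij_witness[where
          i = "\<lambda>w'. restrict (\<lambda>k. restrict (\<lambda>i. w' (i, k)) {..<l}) {..<m}" and
          j = "\<lambda>U. restrict (\<lambda>(i, k). U k i) ({..<l} \<times> {..<m})"])
      fix U assume U: "U \<in> PiE {..<m} (\<lambda>k. words (?s k))"
      then have Uk: "U k \<in> words (?s k)" if "k < m" for k using that by auto
      have ext: "U k \<in> extensional {..<l}" "wtype l (U k) = ?s k" if "k < m" for k
        using wordsD[OF Uk[OF that]] ssz[OF that] by auto
      show "restrict (\<lambda>k. restrict (\<lambda>i. restrict (\<lambda>(i, k). U k i) ({..<l} \<times> {..<m}) (i, k)) {..<l}) {..<m} = U"
      proof
        fix k
        show "restrict (\<lambda>k. restrict (\<lambda>i. restrict (\<lambda>(i, k). U k i) ({..<l} \<times> {..<m}) (i, k)) {..<l}) {..<m} k = U k"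
          using U ext[of k] by (cases "k < m") (auto simp: PiE_def extensional_def fun_eq_iff)
      qed
      have "wtype l (\<lambda>i. restrict (\<lambda>(i, k). U k i) ({..<l} \<times> {..<m}) (i, k)) = ?s k" if "k < m" for k
        using ext(2)[OF that] wtype_cong[of l "\<lambda>i. restrict (\<lambda>(i, k). U k i) ({..<l} \<times> {..<m}) (i, k)" "U k"] that
        by simp
      then show "restrict (\<lambda>(i, k). U k i) ({..<l} \<times> {..<m}) \<in> grid_cols l m ?s"
        by (simp add: grid_cols_def grid_def)
    next
      fix w' assume w': "w' \<in> grid_cols l m ?s"
      then show "restrict (\<lambda>(i, k). restrict (\<lambda>k. restrict (\<lambda>i. w' (i, k)) {..<l}) {..<m} k i) ({..<l} \<times> {..<m}) = w'"
        by (auto simp: grid_cols_def grid_def extensional_def fun_eq_iff)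
      have "restrict (\<lambda>i. w' (i, k)) {..<l} \<in> words (?s k)" if "k < m" for k
        using w' that wtype_cong[of l "restrict (\<lambda>i. w' (i, k)) {..<l}" "\<lambda>i. w' (i, k)"]
        by (simp add: words_def ssz grid_cols_def)
      then show "restrict (\<lambda>k. restrict (\<lambda>i. w' (i, k)) {..<l}) {..<m} \<in> PiE {..<m} (\<lambda>k. words (?s k))"
        by auto
    qed (auto intro!: prod.cong)
    also have "\<dots> = (\<Sum>w'\<in>grid_cols l m ?s. \<Prod>x\<in>{..<l} \<times> {..<m}. A (w' x) (w x))"
      by (intro sum.cong refl, subst prod.swap) (simp add: prod.cartesian_product case_prod_beta)
    finally show "(\<Prod>k<m. symU A (?s k) (?ct w k)) = \<dots>" .
  qed
  finally show ?thesis .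
qed

text \<open>Both sides enumerate the pairs of grids with prescribed rows and columns, respectively.\<close>

lemma hermite_equivariant:
  fixes A :: "'i :: finite \<Rightarrow> 'i \<Rightarrow> 'k :: comm_semiring_1"
  assumes \<eta>: "\<eta> \<in> multisets_of_size (multisets_of_size UNIV l) m"
    and \<mu>: "\<mu> \<in> multisets_of_size (multisets_of_size UNIV m) l"
  shows "(\<Sum>\<kappa>\<in>multisets_of_size (multisets_of_size UNIV l) m.
      symL (symU A) \<eta> \<kappa> * of_nat (hermite l m \<kappa> \<mu>)) =
    (\<Sum>\<nu>\<in>multisets_of_size (multisets_of_size UNIV m) l.
      of_nat (hermite l m \<eta> \<nu>) * symU (symL A) \<nu> \<mu>)"
proof -
  let ?A = "\<lambda>i j. A j i"
  let ?F = "\<lambda>w w'. \<Prod>x\<in>{..<m} \<times> {..<l}. A (w x) (w' x)"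
  let ?N = "multisets_of_size (multisets_of_size (UNIV :: 'i set) m) l"
  \<comment> \<open>Transposing both layers exchanges upper and lower powers, so this side is an
    instance of the preceding lemma for the transposed matrix, with \<open>l\<close> and
    \<open>m\<close> exchanged.\<close>
  have "symU (symL A) \<nu> \<mu> = symL (symU ?A) \<mu> \<nu>" if \<nu>: "\<nu> \<in> ?N" for \<nu>
  proof -
    have "symL (symU ?A) \<mu> \<nu> = symU (\<lambda>i j. symU ?A j i) \<nu> \<mu>"
      using \<mu> \<nu> by (simp add: symL_symU multisets_of_sizeD)
    also have "\<dots> = symU (symL A) \<nu> \<mu>"
      by (rule symU_cong[OF _ \<nu> \<mu>]) (simp add: symL_symU multisets_of_sizeD)
    finally show ?thesis by simp
  qed
  then have "(\<Sum>\<nu>\<in>?N. of_nat (hermite l m \<eta> \<nu>) * symU (symL A) \<nu> \<mu>) =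
      (\<Sum>\<nu>\<in>?N. symL (symU ?A) \<mu> \<nu> * of_nat (hermite m l \<nu> \<eta>))"
    by (intro sum.cong refl) (simp add: mult.commute hermite_swap[of l m])
  also have "\<dots> = (\<Sum>w\<in>grid_rows m l (word \<eta>). \<Sum>w'\<in>grid_cols m l (word \<mu>). \<Prod>x\<in>{..<m} \<times> {..<l}. A (w x) (w' x))"
    by (rule hermite_symL_symU[OF \<mu> \<eta>])
  also have "\<dots> = (\<Sum>w\<in>grid_cols l m (word \<eta>). \<Sum>w'\<in>grid_cols m l (word \<mu>). ?F (w \<circ> prod.swap) w')"
    by (rule sum.reindex_bij_betw[OF bij_betw_swap', symmetric])
  also have "\<dots> = (\<Sum>w\<in>grid_cols l m (word \<eta>). \<Sum>w'\<in>grid_rows l m (word \<mu>). ?F (w \<circ> prod.swap) (w' \<circ> prod.swap))"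
    by (intro sum.cong refl sum.reindex_bij_betw[OF bij_betw_swap, symmetric])
  also have "\<dots> = (\<Sum>w\<in>grid_cols l m (word \<eta>). \<Sum>w'\<in>grid_rows l m (word \<mu>). \<Prod>x\<in>{..<l} \<times> {..<m}. A (w x) (w' x))"
    by (intro sum.cong refl prod.reindex_bij_witness[where i = prod.swap and j = prod.swap]) auto
  also have "\<dots> = (\<Sum>w'\<in>grid_rows l m (word \<mu>). \<Sum>w\<in>grid_cols l m (word \<eta>). \<Prod>x\<in>{..<l} \<times> {..<m}. A (w x) (w' x))"
    by (rule sum.swap)
  finally show ?thesis using hermite_symL_symU[OF \<eta> \<mu>, of A] by simp
qed

subsection \<open>Bijectivity of the multiplication map\<close>

definition mvec :: "'i set \<Rightarrow> 'j set \<Rightarrow> ('j \<Rightarrow> 'i \<Rightarrow> 'k :: semiring_0) \<Rightarrow> ('i \<Rightarrow> 'k) \<Rightarrow> 'j \<Rightarrow> 'k" where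
  "mvec I J T c = (\<lambda>j. if j \<in> J then \<Sum>i\<in>I. T j i * c i else 0)"

definition vecs :: "'i set \<Rightarrow> ('i \<Rightarrow> 'k :: zero) set" where
  "vecs I = {c. \<forall>i. i \<notin> I \<longrightarrow> c i = 0}"

text \<open>Back substitution by layers of \<open>h\<close>. Off the diagonal a row points to
  strictly greater heights only, so the image of the top layer \<open>e\<close> of \<open>d\<close>
  agrees with \<open>d\<close> from height n upwards, and the difference lives further down. The
  diagonal entries are 1, so no division occurs and any commutative ring will do.\<close>

lemma mvec_triangular_surj:
  fixes T :: "'i \<Rightarrow> 'i \<Rightarrow> 'k :: comm_ring_1" and h :: "'i \<Rightarrow> nat"
  assumes I: "finite I" and diag: "\<And>i. i \<in> I \<Longrightarrow> T i i = 1"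
    and tri: "\<And>i j. i \<in> I \<Longrightarrow> j \<in> I \<Longrightarrow> T i j \<noteq> 0 \<Longrightarrow> j = i \<or> h j > h i"
    and d: "d \<in> vecs I" "\<And>i. d i \<noteq> 0 \<Longrightarrow> h i < n"
  shows "\<exists>c\<in>vecs I. mvec I I T c = d"
  using d
proof (induction n arbitrary: d)
  case 0
  then have "d = (\<lambda>_. 0)" by auto
  then show ?case by (intro bexI[of _ "\<lambda>_. 0"]) (auto simp: mvec_def vecs_def)
next
  case (Suc n)
  define e where "e = (\<lambda>i. if h i = n then d i else 0)"
  have row: "mvec I I T e i = d i" if i: "i \<in> I" "h i \<ge> n" for i
  proof -
    have "(\<Sum>j\<in>I. T i j * e j) = (\<Sum>j\<in>{i}. T i j * e j)"
    proof (intro sum.mono_neutral_right I)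
      show "\<forall>j\<in>I - {i}. T i j * e j = 0"
        using tri[OF i(1)] i(2) by (force simp: e_def)
    qed (use i in auto)
    moreover have "h i = n \<or> d i = 0" using Suc.prems(2)[of i] i by (cases "d i = 0") auto
    ultimately show ?thesis using diag i by (auto simp: mvec_def e_def)
  qed
  have "(\<lambda>i. d i - mvec I I T e i) \<in> vecs I"
    using Suc.prems(1) by (auto simp: vecs_def mvec_def)
  moreover have "h i < n" if "d i - mvec I I T e i \<noteq> 0" for i
  proof (rule ccontr)
    assume "\<not> h i < n"
    then show False using that row[of i] Suc.prems(1) by (cases "i \<in> I") (auto simp: vecs_def mvec_def)
  qed
  ultimately obtain c where c: "c \<in> vecs I" "mvec I I T c = (\<lambda>i. d i - mvec I I T e i)"
    using Suc.IH[of "\<lambda>i. d i - mvec I I T e i"] by blast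
  have "mvec I I T (\<lambda>i. c i + e i) = d"
  proof
    fix i
    have "mvec I I T (\<lambda>i. c i + e i) i = mvec I I T c i + mvec I I T e i"
      by (simp add: mvec_def distrib_left sum.distrib)
    then show "mvec I I T (\<lambda>i. c i + e i) i = d i" by (simp add: c)
  qed
  moreover have "(\<lambda>i. c i + e i) \<in> vecs I" using c(1) Suc.prems(1) by (auto simp: vecs_def e_def)
  ultimately show ?case by blast
qed

lemma mvec_triangular_inj:
  fixes T :: "'i \<Rightarrow> 'i \<Rightarrow> 'k :: comm_ring_1" and h :: "'i \<Rightarrow> nat"
  assumes I: "finite I" and diag: "\<And>i. i \<in> I \<Longrightarrow> T i i = 1"
    and tri: "\<And>i j. i \<in> I \<Longrightarrow> j \<in> I \<Longrightarrow> T i j \<noteq> 0 \<Longrightarrow> j = i \<or> h j > h i"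
  shows "inj_on (mvec I I T) (vecs I)"
proof (rule inj_onI, rule ccontr)
  fix a b assume ab: "a \<in> vecs I" "b \<in> vecs I" "mvec I I T a = mvec I I T b" "a \<noteq> b"
  let ?S = "{i \<in> I. a i \<noteq> b i}"
  obtain i0 where "a i0 \<noteq> b i0" using ab(4) by auto
  moreover from this have "i0 \<in> I" using ab(1,2) unfolding vecs_def by fastforce
  ultimately have "i0 \<in> ?S" by simp
  then have S: "finite ?S" "?S \<noteq> {}" using I by (simp, blast)
  \<comment> \<open>At a place of greatest height where the two vectors differ, only the diagonal
    term of the row survives.\<close>
  then have "Max (h ` ?S) \<in> h ` ?S" by (intro Max_in) (simp, blast)
  then obtain i where i: "i \<in> ?S" "h i = Max (h ` ?S)" by (metis (no_types, lifting) imageE)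
  then have i: "i \<in> ?S" "\<forall>j\<in>?S. h j \<le> h i" using S(1) by simp_all
  have "(\<Sum>j\<in>I. T i j * (a j - b j)) = mvec I I T a i - mvec I I T b i"
    using i by (simp add: mvec_def right_diff_distrib sum_subtractf)
  then have "(\<Sum>j\<in>I. T i j * (a j - b j)) = 0" using ab by simp
  moreover have "(\<Sum>j\<in>I. T i j * (a j - b j)) = (\<Sum>j\<in>{i}. T i j * (a j - b j))"
  proof (intro sum.mono_neutral_right I ballI)
    fix j assume j: "j \<in> I - {i}"
    show "T i j * (a j - b j) = 0"
    proof (cases "a j = b j")
      case False
      then have "\<not> h i < h j" using i j by auto
      then have "T i j = 0" using tri[of i j] i j by auto
      then show ?thesis by simp
    qed simp
  qed (use i in auto)
  ultimately show False using i diag by auto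
qed

text \<open>Rows and columns have different index sets; matching them along \<open>f\<close> makes
  the matrix square.\<close>

lemma mvec_triangular_bij:
  fixes T :: "'j \<Rightarrow> 'i \<Rightarrow> 'k :: comm_ring_1" and h :: "'i \<Rightarrow> nat"
  assumes I: "finite I" and f: "bij_betw f I J" and diag: "\<And>i. i \<in> I \<Longrightarrow> T (f i) i = 1"
    and tri: "\<And>i j. i \<in> I \<Longrightarrow> j \<in> I \<Longrightarrow> T (f i) j \<noteq> 0 \<Longrightarrow> j = i \<or> h j > h i"
  shows "bij_betw (mvec I J T) (vecs I) (vecs J)"
proof -
  let ?T = "\<lambda>i. T (f i)"
  have sub: "mvec I J T c (f i) = mvec I I ?T c i" if "i \<in> I" for c i
    using f that by (auto simp: mvec_def bij_betw_def)
  show ?thesis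
  proof (rule bij_betw_imageI)
    show "inj_on (mvec I J T) (vecs I)"
    proof (rule inj_onI)
      fix a b assume ab: "a \<in> vecs I" "b \<in> vecs I" "mvec I J T a = mvec I J T b"
      have *: "mvec I I ?T a i = mvec I I ?T b i" for i
        using sub[of i a] sub[of i b] fun_cong[OF ab(3), of "f i"]
        by (cases "i \<in> I") (simp, simp add: mvec_def)
      show "a = b"
        by (rule inj_onD[OF mvec_triangular_inj[of I ?T h, OF I diag tri] ext[OF *] ab(1,2)])
    qed
    show "mvec I J T ` vecs I = vecs J"
    proof (intro equalityI subsetI)
      fix d :: "'j \<Rightarrow> 'k" assume d: "d \<in> vecs J"
      define d' where "d' = (\<lambda>i. if i \<in> I then d (f i) else 0)"
      have "\<exists>c\<in>vecs I. mvec I I ?T c = d'"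
      proof (rule mvec_triangular_surj[where n = "Suc (Max (h ` I))" and h = h])
        show "h i < Suc (Max (h ` I))" if "d' i \<noteq> 0" for i
          using that I by (auto simp: d'_def less_Suc_eq_le split: if_splits)
      qed (use I diag tri in \<open>auto simp: d'_def vecs_def\<close>)
      then obtain c where c: "c \<in> vecs I" "mvec I I ?T c = d'" by blast
      have "mvec I J T c j = d j" for j
      proof (cases "j \<in> J")
        case True
        then obtain i where "i \<in> I" "j = f i" using f by (auto simp: bij_betw_def)
        then show ?thesis using sub[of i c] c by (simp add: d'_def)
      next
        case False
        then show ?thesis using d by (simp add: mvec_def vecs_def)
      qed
      then show "d \<in> mvec I J T ` vecs I" using c by (auto intro!: image_eqI[of _ _ c])
    qed (auto simp: mvec_def vecs_def)
  qed
qed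

text \<open>Induction by splitting off the maximum, which is at least \<open>card S - 1\<close>. For
  a grid, \<open>S\<close> will be the set of rows in which a given column has the letter 2.\<close>

lemma sum_ge_initial_segment:
  fixes S :: "nat set"
  assumes "finite S"
  shows "\<Sum>{..<card S} \<le> \<Sum>S" and "\<Sum>S = \<Sum>{..<card S} \<Longrightarrow> S = {..<card S}"
proof -
  have "\<Sum>{..<card S} \<le> \<Sum>S \<and> (\<Sum>S = \<Sum>{..<card S} \<longrightarrow> S = {..<card S})"
    using assms
  proof (induction "card S" arbitrary: S)
    case (Suc n)
    let ?m = "Max S"
    have S: "S \<noteq> {}" using Suc.hyps(2) by auto
    have m: "?m \<in> S" using S Suc.prems by simp
    let ?R = "S - {?m}"
    have R: "card ?R = n" "finite ?R" using m Suc by auto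
    have "S \<subseteq> {..?m}" using Suc.prems by auto
    then have "card S \<le> Suc ?m" using card_mono[of "{..?m}" S] by simp
    then have mn: "n \<le> ?m" using Suc.hyps(2) by simp
    have sum: "\<Sum>S = ?m + \<Sum>?R" using m Suc.prems by (simp add: sum.remove)
    have IH: "\<Sum>{..<n} \<le> \<Sum>?R" "\<Sum>?R = \<Sum>{..<n} \<Longrightarrow> ?R = {..<n}"
      using Suc.hyps(1)[of ?R] R by auto
    have cS: "card S = Suc n" using Suc.hyps(2) by simp
    show ?case
    proof
      show "\<Sum>{..<card S} \<le> \<Sum>S" using IH(1) mn by (simp add: cS sum)
      show "\<Sum>S = \<Sum>{..<card S} \<longrightarrow> S = {..<card S}"
      proof
        assume "\<Sum>S = \<Sum>{..<card S}"
        then have "?m + \<Sum>?R = n + \<Sum>{..<n}" by (simp add: cS sum)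
        then have eq: "?m = n" "\<Sum>?R = \<Sum>{..<n}" using IH(1) mn by linarith+
        have "S = insert ?m ?R" using m by blast
        also have "\<dots> = {..<card S}" by (simp only: IH(2)[OF eq(2)] cS lessThan_Suc) (simp only: eq(1))
        finally show "S = {..<card S}" .
      qed
    qed
  qed auto
  then show "\<Sum>{..<card S} \<le> \<Sum>S" and "\<Sum>S = \<Sum>{..<card S} \<Longrightarrow> S = {..<card S}" by auto
qed

section \<open>Partitions, Ferrers diagrams and the unitriangularity of
  \<open>hermite\<close>\<close>

lemma count_1_2: "size (\<mu> :: 2 multiset) = count \<mu> 1 + count \<mu> 2"
proof -
  have "size \<mu> = (\<Sum>x\<in>UNIV. count \<mu> x)"
    unfolding size_multiset_overloaded_eq
    by (intro sum.mono_neutral_left) (auto simp: not_in_iff)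
  then show ?thesis by (simp add: UNIV_2)
qed

lemma multiset_2_eqI:
  fixes \<mu> \<nu> :: "2 multiset"
  assumes "size \<mu> = size \<nu>" "count \<mu> 2 = count \<nu> 2"
  shows "\<mu> = \<nu>"
  using assms count_1_2[of \<mu>] count_1_2[of \<nu>]
  by (intro multiset_eqI) (metis add_right_cancel exhaust_2)

lemma count_wtype: "count (wtype r s) x = card {k. k < r \<and> s k = x}"
proof -
  have "count (wtype r s) x = card (s -` {x} \<inter> {..<r})"
    by (simp add: wtype_def count_image_mset)
  also have "s -` {x} \<inter> {..<r} = {k. k < r \<and> s k = x}" by auto
  finally show ?thesis .
qed

text \<open>A multiset of multisets over two letters is a partition, with the multiplicities of the
  letter 2 as parts. Listing the parts in decreasing order makes the columns of the diagram initial
  segments.\<close>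

definition dword :: "2 multiset multiset \<Rightarrow> nat \<Rightarrow> 2 multiset" where
  "dword \<mu> = (SOME s. s \<in> words \<mu> \<and> antimono_on {..<size \<mu>} (\<lambda>i. count (s i) 2))"

lemma dword:
  shows "dword \<mu> \<in> words \<mu>" "i \<le> j \<Longrightarrow> j < size \<mu> \<Longrightarrow> count (dword \<mu> j) 2 \<le> count (dword \<mu> i) 2"
proof -
  obtain xs0 where xs0: "mset xs0 = \<mu>" using ex_mset by blast
  define xs where "xs = rev (sort_key (\<lambda>x. count x 2) xs0)"
  have xs: "mset xs = \<mu>" "length xs = size \<mu>" using xs0 by (auto simp: xs_def)
  have sorted: "sorted (rev (map (\<lambda>x. count x 2) xs))" by (simp add: xs_def rev_map)
  let ?s = "restrict (\<lambda>k. xs ! k) {..<size \<mu>}"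
  have "?s \<in> words \<mu>"
    using wtype_cong[of "length xs" ?s "\<lambda>k. xs ! k"] by (simp add: words_def wtype_nth xs(1) flip: xs(2))
  moreover have "antimono_on {..<size \<mu>} (\<lambda>i. count (?s i) 2)"
    using sorted unfolding monotone_on_def
    by (auto simp: sorted_rev_iff_nth_mono xs(2))
  ultimately have "?s \<in> words \<mu> \<and> antimono_on {..<size \<mu>} (\<lambda>i. count (?s i) 2)" ..
  then have "dword \<mu> \<in> words \<mu> \<and> antimono_on {..<size \<mu>} (\<lambda>i. count (dword \<mu> i) 2)"
    unfolding dword_def
    by (rule someI[where P = "\<lambda>s. s \<in> words \<mu> \<and> antimono_on {..<size \<mu>} (\<lambda>i. count (s i) 2)"])
  then show "dword \<mu> \<in> words \<mu>" "i \<le> j \<Longrightarrow> j < size \<mu> \<Longrightarrow> count (dword \<mu> j) 2 \<le> count (dword \<mu> i) 2"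
    by (auto simp: monotone_on_def)
qed

text \<open>For fixed column sums, \<open>\<Sum>\<^sub>i i \<cdot> (sum of row i)\<close> is the sum over the columns of the positions of the
  letter \<open>2\<close>; it is minimal exactly for the Ferrers diagram, whose columns are filled from the top.\<close>

definition height :: "2 multiset multiset \<Rightarrow> nat" where
  "height \<mu> = (\<Sum>i<size \<mu>. i * count (dword \<mu> i) 2)"

definition ferrers :: "nat \<Rightarrow> nat \<Rightarrow> 2 multiset multiset \<Rightarrow> nat \<times> nat \<Rightarrow> 2" where
  "ferrers l m \<mu> = restrict (\<lambda>(i, k). if k < count (dword \<mu> i) 2 then 2 else 1) ({..<l} \<times> {..<m})"

definition conj_part :: "nat \<Rightarrow> nat \<Rightarrow> 2 multiset multiset \<Rightarrow> 2 multiset multiset" where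
  "conj_part l m \<mu> = wtype m (\<lambda>k. wtype l (\<lambda>i. ferrers l m \<mu> (i, k)))"

lemma conj_part_in:
  "conj_part l m \<mu> \<in> multisets_of_size (multisets_of_size UNIV l) m"
  by (auto simp: conj_part_def multisets_of_size_def set_mset_wtype)

lemma sum_columns:
  fixes w :: "nat \<times> nat \<Rightarrow> 2"
  shows "(\<Sum>i<l. i * card {k. k < m \<and> w (i, k) = 2}) = (\<Sum>k<m. \<Sum>{i. i < l \<and> w (i, k) = 2})"
proof -
  have "(\<Sum>i<l. i * card {k. k < m \<and> w (i, k) = 2}) = (\<Sum>i<l. \<Sum>k<m. if w (i, k) = 2 then i else 0)"
    by (intro sum.cong refl) (simp add: sum.If_cases mult.commute Collect_conj_eq lessThan_def)
  also have "\<dots> = (\<Sum>k<m. \<Sum>i<l. if w (i, k) = 2 then i else 0)" by (rule sum.swap)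
  also have "\<dots> = (\<Sum>k<m. \<Sum>{i. i < l \<and> w (i, k) = 2})"
  proof (rule sum.cong[OF refl])
    fix k
    have "{i. i < l \<and> w (i, k) = 2} = {i \<in> {..<l}. w (i, k) = 2}" by auto
    then show "(\<Sum>i<l. if w (i, k) = 2 then i else 0) = \<Sum>{i. i < l \<and> w (i, k) = 2}"
      by (simp only: sum.inter_filter[OF finite_lessThan])
  qed
  finally show ?thesis .
qed

text \<open>A grid with the column contents of the Ferrers diagram has as many letters 2 in each
  column as the diagram, but possibly further down, and the height adds up their positions.\<close>

lemma hermite_triangular:
  assumes \<mu>: "\<mu> \<in> multisets_of_size (multisets_of_size UNIV m) l"
    and \<nu>: "\<nu> \<in> multisets_of_size (multisets_of_size UNIV m) l"
    and w: "w \<in> grid_cols l m (restrict (\<lambda>k. wtype l (\<lambda>i. ferrers l m \<mu> (i, k))) {..<m})"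
      "w \<in> grid_rows l m (dword \<nu>)"
  shows "height \<mu> \<le> height \<nu>" and "height \<mu> = height \<nu> \<Longrightarrow> w = ferrers l m \<mu> \<and> \<nu> = \<mu>"
proof -
  have sz: "size \<mu> = l" "size \<nu> = l" using \<mu> \<nu> by (auto simp: multisets_of_sizeD)
  have rsz: "size (dword \<mu> i) = m" "size (dword \<nu> i) = m" if "i < l" for i
    using words_in[OF \<mu> dword(1) that] words_in[OF \<nu> dword(1) that] by (auto simp: multisets_of_sizeD)
  let ?F = "ferrers l m \<mu>"
  let ?S = "\<lambda>w k. {i. i < l \<and> w (i, k) = (2 :: 2)}"
  have cnt\<mu>: "count (dword \<mu> i) 2 = card {k. k < m \<and> ?F (i, k) = 2}" if i: "i < l" for i
  proof -
    have "count (dword \<mu> i) 2 \<le> m" using rsz(1)[OF i] count_1_2[of "dword \<mu> i"] by simp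
    then have "{k. k < m \<and> ?F (i, k) = 2} = {..<count (dword \<mu> i) 2}"
      using i by (auto simp: ferrers_def)
    then show ?thesis by simp
  qed
  have cnt\<nu>: "count (dword \<nu> i) 2 = card {k. k < m \<and> w (i, k) = 2}" if i: "i < l" for i
    using w(2) i count_wtype[of m "\<lambda>k. w (i, k)" 2] by (simp add: grid_rows_def)
  have h: "height \<mu> = (\<Sum>k<m. \<Sum>(?S ?F k))" "height \<nu> = (\<Sum>k<m. \<Sum>(?S w k))"
    unfolding height_def sz by (simp_all add: cnt\<mu> cnt\<nu> flip: sum_columns)
  have col: "card (?S w k) = card (?S ?F k)" if "k < m" for k
  proof -
    have "wtype l (\<lambda>i. w (i, k)) = wtype l (\<lambda>i. ?F (i, k))"
      using w(1) that by (simp add: grid_cols_def)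
    then show ?thesis
      using count_wtype[of l "\<lambda>i. w (i, k)" 2] count_wtype[of l "\<lambda>i. ?F (i, k)" 2] by simp
  qed
  \<comment> \<open>The parts decrease from row to row, so with a cell the diagram contains all
    cells above it.\<close>
  have init: "?S ?F k = {..<card (?S ?F k)}" if k: "k < m" for k
  proof -
    have "finite (?S ?F k)" by simp
    moreover have "j \<in> ?S ?F k" if "i \<in> ?S ?F k" "j \<le> i" for i j
      using that k dword(2)[of j i \<mu>] by (auto simp: ferrers_def sz split: if_splits)
    ultimately obtain n where "?S ?F k = {..<n}"
    proof (cases "?S ?F k = {}")
      case True
      then show ?thesis using that[of 0] by simp
    next
      case False
      assume *: "\<And>i j. i \<in> ?S ?F k \<Longrightarrow> j \<le> i \<Longrightarrow> j \<in> ?S ?F k"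
      assume fin: "finite (?S ?F k)"
      have "Max (?S ?F k) \<in> ?S ?F k" by (rule Max_in[OF fin False])
      then have "{..<Suc (Max (?S ?F k))} \<subseteq> ?S ?F k" using * by (meson lessThan_iff less_Suc_eq_le subsetI)
      moreover have "?S ?F k \<subseteq> {..<Suc (Max (?S ?F k))}"
        using Max_ge[OF fin] by (auto simp: less_Suc_eq_le)
      ultimately show ?thesis using that by blast
    qed
    then show ?thesis by (metis card_lessThan)
  qed
  have le: "\<Sum>(?S ?F k) \<le> \<Sum>(?S w k)" if k: "k < m" for k
    using sum_ge_initial_segment(1)[of "?S w k"] init[OF k] col[OF k] by simp
  then show "height \<mu> \<le> height \<nu>" unfolding h by (intro sum_mono) auto
  assume eq: "height \<mu> = height \<nu>"
  \<comment> \<open>Columnwise inequalities whose totals agree are equalities.\<close>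
  have "\<Sum>(?S w k) = \<Sum>(?S ?F k)" if k: "k < m" for k
    using sum_mono_inv[of "\<lambda>k. \<Sum>(?S ?F k)" "{..<m}" "\<lambda>k. \<Sum>(?S w k)" k] eq le k by (simp add: h)
  then have S: "?S w k = ?S ?F k" if k: "k < m" for k
    using sum_ge_initial_segment(2)[of "?S w k"] init[OF k] col[OF k] k by simp
  have "w x = ?F x" for x
  proof (cases "x \<in> {..<l} \<times> {..<m}")
    case True
    then obtain i k where x: "x = (i, k)" "i < l" "k < m" by auto
    then have "w x = 2 \<longleftrightarrow> ?F x = 2" using S[of k] by auto
    then show ?thesis using exhaust_2[of "w x"] exhaust_2[of "?F x"] by auto
  next
    case False
    then show ?thesis using w(1) extensional_arb[of w "{..<l} \<times> {..<m}" x]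
      by (auto simp: grid_cols_def grid_def ferrers_def)
  qed
  then have wF: "w = ?F" ..
  have "dword \<nu> i = dword \<mu> i" for i
  proof (cases "i < l")
    case True
    then show ?thesis using rsz[OF True] cnt\<mu>[OF True] cnt\<nu>[OF True]
      by (intro multiset_2_eqI) (simp_all add: wF)
  next
    case False
    then show ?thesis using wordsD(1)[OF dword(1)[of \<mu>]] wordsD(1)[OF dword(1)[of \<nu>]] sz
      by (simp add: extensional_def)
  qed
  then have "dword \<nu> = dword \<mu>" ..
  then have "\<nu> = \<mu>" using wordsD(2)[OF dword(1)[of \<mu>]] wordsD(2)[OF dword(1)[of \<nu>]] sz by simp
  with wF show "w = ?F \<and> \<nu> = \<mu>" by simp
qed

lemma ferrers_rows:
  assumes \<mu>: "\<mu> \<in> multisets_of_size (multisets_of_size UNIV m) l"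
  shows "ferrers l m \<mu> \<in> grid_rows l m (dword \<mu>)"
proof -
  have "wtype m (\<lambda>k. ferrers l m \<mu> (i, k)) = dword \<mu> i" if i: "i < l" for i
  proof (rule multiset_2_eqI)
    show sz: "size (wtype m (\<lambda>k. ferrers l m \<mu> (i, k))) = size (dword \<mu> i)"
      using words_in[OF \<mu> dword(1) i] by (simp add: multisets_of_sizeD)
    then have "count (dword \<mu> i) 2 \<le> m" using count_1_2[of "dword \<mu> i"] by simp
    then have "{k. k < m \<and> ferrers l m \<mu> (i, k) = 2} = {..<count (dword \<mu> i) 2}"
      using i by (auto simp: ferrers_def)
    then show "count (wtype m (\<lambda>k. ferrers l m \<mu> (i, k))) 2 = count (dword \<mu> i) 2"
      by (simp add: count_wtype)
  qed
  then show ?thesis by (simp add: grid_rows_def grid_def ferrers_def)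
qed

text \<open>With two letters a grid is a 0-1 matrix, and \<open>hermite\<close> counts those with
  prescribed row and column sums. These are the coefficients of products of elementary symmetric
  polynomials in the monomial basis.\<close>

lemma hermite_conj_part:
  assumes \<mu>: "\<mu> \<in> multisets_of_size (multisets_of_size UNIV m) l"
    and \<nu>: "\<nu> \<in> multisets_of_size (multisets_of_size UNIV m) l"
  shows "hermite l m (conj_part l m \<mu>) \<mu> = 1"
    and "hermite l m (conj_part l m \<mu>) \<nu> \<noteq> 0 \<Longrightarrow> \<nu> = \<mu> \<or> height \<mu> < height \<nu>"
proof -
  let ?s = "restrict (\<lambda>k. wtype l (\<lambda>i. ferrers l m \<mu> (i, k))) {..<m}"
  have "wtype m ?s = conj_part l m \<mu>" unfolding conj_part_def by (rule wtype_cong) simp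
  then have s: "?s \<in> words (conj_part l m \<mu>)" by (simp add: words_def conj_part_def)
  have eq: "hermite l m (conj_part l m \<mu>) \<nu> = card (grid_cols l m ?s \<inter> grid_rows l m (dword \<nu>))"
    if "\<nu> \<in> multisets_of_size (multisets_of_size UNIV m) l" for \<nu>
    using that multisets_of_sizeD[OF conj_part_in[of l m \<mu>]]
    by (intro hermite_words s dword) (auto simp: multisets_of_sizeD)
  have "ferrers l m \<mu> \<in> grid_cols l m ?s"
    by (simp add: grid_cols_def grid_def) (simp add: ferrers_def)
  then have "grid_cols l m ?s \<inter> grid_rows l m (dword \<mu>) = {ferrers l m \<mu>}"
    using ferrers_rows[OF \<mu>] hermite_triangular(2)[OF \<mu> \<mu>] by auto
  then show "hermite l m (conj_part l m \<mu>) \<mu> = 1" using eq[OF \<mu>] by simp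
  assume "hermite l m (conj_part l m \<mu>) \<nu> \<noteq> 0"
  then have "grid_cols l m ?s \<inter> grid_rows l m (dword \<nu>) \<noteq> {}" using eq[OF \<nu>] by auto
  then obtain w where "w \<in> grid_cols l m ?s" "w \<in> grid_rows l m (dword \<nu>)" by blast
  from hermite_triangular[OF \<mu> \<nu> this] show "\<nu> = \<mu> \<or> height \<mu> < height \<nu>" by linarith
qed

text \<open>Two different partitions with the same conjugate would each be strictly higher than the
  other. Surjectivity follows by counting, as both index sets have as many elements as there are
  l-subsets of a set of size l + m.\<close>

lemma bij_betw_conj_part:
  "bij_betw (conj_part l m) (multisets_of_size (multisets_of_size UNIV m) l)
     (multisets_of_size (multisets_of_size UNIV l) m)" (is "bij_betw _ ?M ?N")
proof (rule bij_betw_imageI)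
  have "card (multisets_of_size (UNIV :: 2 set) n) = Suc n" for n
    by (simp add: card_multisets_of_size)
  moreover have fin: "finite (multisets_of_size (UNIV :: 2 set) n)" for n
    by (intro finite_multisets_of_size) simp
  ultimately have card: "card ?M = card ?N"
    using binomial_symmetric[of l "m + l"] by (simp add: card_multisets_of_size add.commute)
  show inj: "inj_on (conj_part l m) ?M"
  proof (rule inj_onI)
    fix \<mu> \<nu> assume *: "\<mu> \<in> ?M" "\<nu> \<in> ?M" "conj_part l m \<mu> = conj_part l m \<nu>"
    then have "hermite l m (conj_part l m \<mu>) \<nu> \<noteq> 0" "hermite l m (conj_part l m \<nu>) \<mu> \<noteq> 0"
      using hermite_conj_part(1)[OF *(1,1)] hermite_conj_part(1)[OF *(2,2)] by auto
    then show "\<mu> = \<nu>"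
      using hermite_conj_part(2)[OF *(1,2)] hermite_conj_part(2)[OF *(2,1)] by auto
  qed
  show "conj_part l m ` ?M = ?N"
  proof (rule card_subset_eq)
    show "finite ?N" by (intro finite_multisets_of_size fin)
    show "conj_part l m ` ?M \<subseteq> ?N" using conj_part_in by auto
    show "card (conj_part l m ` ?M) = card ?N" using card card_image[OF inj] by simp
  qed
qed

lemma hermite_bij:
  "bij_betw (mvec (multisets_of_size (multisets_of_size (UNIV :: 2 set) m) l)
      (multisets_of_size (multisets_of_size UNIV l) m)
      (\<lambda>\<eta> \<mu>. of_nat (hermite l m \<eta> \<mu>) :: 'k :: comm_ring_1))
    (vecs (multisets_of_size (multisets_of_size UNIV m) l))
    (vecs (multisets_of_size (multisets_of_size UNIV l) m))"
proof (rule mvec_triangular_bij[where h = height, OF _ bij_betw_conj_part])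
  fix \<mu> \<nu> :: "2 multiset multiset"
  assume *: "\<mu> \<in> multisets_of_size (multisets_of_size UNIV m) l"
  then show "of_nat (hermite l m (conj_part l m \<mu>) \<mu>) = (1 :: 'k)"
    using hermite_conj_part(1)[OF * *] by simp
  assume "\<nu> \<in> multisets_of_size (multisets_of_size UNIV m) l"
    "of_nat (hermite l m (conj_part l m \<mu>) \<nu>) \<noteq> (0 :: 'k)"
  then show "\<nu> = \<mu> \<or> height \<mu> < height \<nu>"
    using hermite_conj_part(2)[OF *, of \<nu>] by (metis of_nat_0)
qed (intro finite_multisets_of_size, simp)

subsection \<open>Coordinates\<close>

abbreviation kmodule :: "('g, 'k :: field, 'v) gmod \<Rightarrow> bool" where
  "kmodule M \<equiv> module (ring_of_type_algebra :: 'k ring) M"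

lemma ring_of_type_algebra_simps [simp]:
  "carrier ring_of_type_algebra = UNIV"
  "add ring_of_type_algebra = (+)"
  "monoid.mult ring_of_type_algebra = (*)"
  "one ring_of_type_algebra = 1"
  "ring.zero ring_of_type_algebra = 0"
  by (auto simp: ring_of_type_algebra_def)

definition unit_vec :: "'i \<Rightarrow> 'i \<Rightarrow> 'k :: zero_neq_one" where
  "unit_vec j = (\<lambda>i. if i = j then 1 else 0)"

lemma unit_vec_vecs: "j \<in> I \<Longrightarrow> unit_vec j \<in> vecs I"
  by (auto simp: vecs_def unit_vec_def)

definition lin_to :: "('g, 'k :: field, 'v) gmod \<Rightarrow> 'i set \<Rightarrow> ('v \<Rightarrow> 'i \<Rightarrow> 'k) \<Rightarrow> bool" where
  "lin_to M I \<phi> \<longleftrightarrow> (\<forall>x\<in>carrier M. \<phi> x \<in> vecs I) \<and>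
     (\<forall>x\<in>carrier M. \<forall>y\<in>carrier M. \<forall>i. \<phi> (x \<oplus>\<^bsub>M\<^esub> y) i = \<phi> x i + \<phi> y i) \<and>
     (\<forall>c. \<forall>x\<in>carrier M. \<forall>i. \<phi> (c \<odot>\<^bsub>M\<^esub> x) i = c * \<phi> x i)"

lemma lin_toD:
  assumes "lin_to M I \<phi>" "x \<in> carrier M"
  shows "\<phi> x \<in> vecs I"
    and "y \<in> carrier M \<Longrightarrow> \<phi> (x \<oplus>\<^bsub>M\<^esub> y) i = \<phi> x i + \<phi> y i"
    and "\<phi> (c \<odot>\<^bsub>M\<^esub> x) i = c * \<phi> x i"
  using assms unfolding lin_to_def by blast+

lemma lin_to_zero:
  fixes M :: "('g, 'k :: field, 'v) gmod"
  assumes "kmodule M" "lin_to M I \<phi>"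
  shows "\<phi> \<zero>\<^bsub>M\<^esub> i = 0"
proof -
  interpret V: module "ring_of_type_algebra :: 'k ring" M by fact
  have "\<phi> (\<zero>\<^bsub>M\<^esub> \<oplus>\<^bsub>M\<^esub> \<zero>\<^bsub>M\<^esub>) i = \<phi> \<zero>\<^bsub>M\<^esub> i + \<phi> \<zero>\<^bsub>M\<^esub> i"
    using assms(2) by (intro lin_toD) auto
  then show ?thesis by (metis V.M.l_zero V.M.zero_closed add_cancel_right_left)
qed

lemma lin_to_minus:
  fixes M :: "('g, 'k :: field, 'v) gmod"
  assumes "kmodule M" "lin_to M I \<phi>" "x \<in> carrier M" "y \<in> carrier M"
  shows "\<phi> (x \<ominus>\<^bsub>M\<^esub> y) i = \<phi> x i - \<phi> y i"
proof -
  interpret V: module "ring_of_type_algebra :: 'k ring" M by fact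
  have "\<phi> ((x \<ominus>\<^bsub>M\<^esub> y) \<oplus>\<^bsub>M\<^esub> y) i = \<phi> (x \<ominus>\<^bsub>M\<^esub> y) i + \<phi> y i"
    using assms by (intro lin_toD) auto
  moreover have "(x \<ominus>\<^bsub>M\<^esub> y) \<oplus>\<^bsub>M\<^esub> y = x"
    using assms by (simp add: V.M.minus_eq V.M.a_assoc V.M.l_neg)
  ultimately show ?thesis by simp
qed

definition coords :: "('g, 'k :: field, 'v) gmod \<Rightarrow> 'i set \<Rightarrow> ('v \<Rightarrow> 'i \<Rightarrow> 'k) \<Rightarrow> bool" where
  "coords M I \<kappa> \<longleftrightarrow> kmodule M \<and> finite I \<and> lin_to M I \<kappa> \<and> bij_betw \<kappa> (carrier M) (vecs I)"

text \<open>The module axioms hold after applying the injective linear map \<open>\<kappa>\<close>,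
  hence before; the additive inverse is the multiple by -1.\<close>

lemma coordsI:
  fixes M :: "('g, 'k :: field, 'v) gmod"
  assumes fin: "finite I" and lin: "lin_to M I \<kappa>" and bij: "bij_betw \<kappa> (carrier M) (vecs I)"
    and add: "\<And>x y. x \<in> carrier M \<Longrightarrow> y \<in> carrier M \<Longrightarrow> x \<oplus>\<^bsub>M\<^esub> y \<in> carrier M"
    and smult: "\<And>c x. x \<in> carrier M \<Longrightarrow> c \<odot>\<^bsub>M\<^esub> x \<in> carrier M"
    and zero: "\<zero>\<^bsub>M\<^esub> \<in> carrier M" "\<And>i. \<kappa> \<zero>\<^bsub>M\<^esub> i = 0"
  shows "coords M I \<kappa>"
proof -
  note [simp] = lin_toD(2,3)[OF lin]
  have inj: "x = y" if "x \<in> carrier M" "y \<in> carrier M" "\<And>i. \<kappa> x i = \<kappa> y i" for x y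
    using bij that by (auto simp: bij_betw_def inj_on_def fun_eq_iff)
  have "kmodule M"
  proof (rule moduleI)
    show "cring (ring_of_type_algebra :: 'k ring)" by (rule cring_from_type_algebra)
  next
    show "abelian_group M"
    proof (rule abelian_groupI)
      fix x assume "x \<in> carrier M"
      then show "\<exists>y\<in>carrier M. y \<oplus>\<^bsub>M\<^esub> x = \<zero>\<^bsub>M\<^esub>"
        by (intro bexI[of _ "(-1) \<odot>\<^bsub>M\<^esub> x"] inj) (simp_all add: add smult zero)
    qed (rule add zero inj; simp add: add smult zero algebra_simps)+
  qed (rule smult inj; simp add: add smult zero algebra_simps)+
  then show ?thesis using assms by (auto simp: coords_def)
qed

lemma coordsD:
  assumes "coords M I \<kappa>"
  shows "kmodule M" "finite I" "lin_to M I \<kappa>" "bij_betw \<kappa> (carrier M) (vecs I)"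
  using assms by (auto simp: coords_def)

lemma coords_closed:
  fixes M :: "('g, 'k :: field, 'v) gmod"
  assumes "coords M I \<kappa>" "x \<in> carrier M"
  shows "y \<in> carrier M \<Longrightarrow> x \<oplus>\<^bsub>M\<^esub> y \<in> carrier M" "c \<odot>\<^bsub>M\<^esub> x \<in> carrier M"
proof -
  interpret V: module "ring_of_type_algebra :: 'k ring" M using coordsD(1)[OF assms(1)] .
  show "y \<in> carrier M \<Longrightarrow> x \<oplus>\<^bsub>M\<^esub> y \<in> carrier M" "c \<odot>\<^bsub>M\<^esub> x \<in> carrier M"
    using assms by auto
qed

lemma coords_eqI:
  fixes M :: "('g, 'k :: field, 'v) gmod"
  assumes "coords M I \<kappa>" "x \<in> carrier M" "y \<in> carrier M" "\<And>i. i \<in> I \<Longrightarrow> \<kappa> x i = \<kappa> y i"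
  shows "x = y"
proof -
  have "\<kappa> x \<in> vecs I" "\<kappa> y \<in> vecs I"
    using lin_toD(1)[OF coordsD(3)[OF assms(1)]] assms by auto
  then have "\<kappa> x = \<kappa> y" using assms(4) by (force simp: vecs_def fun_eq_iff)
  then show ?thesis
    using assms by (auto simp: coords_def bij_betw_def inj_on_def)
qed

definition basis_vec :: "('g, 'k :: field, 'v) gmod \<Rightarrow> ('v \<Rightarrow> 'i \<Rightarrow> 'k) \<Rightarrow> 'i \<Rightarrow> 'v" where
  "basis_vec M \<kappa> i = inv_into (carrier M) \<kappa> (unit_vec i)"

lemma basis_vec:
  fixes M :: "('g, 'k :: field, 'v) gmod"
  assumes "coords M I \<kappa>" "i \<in> I"
  shows "basis_vec M \<kappa> i \<in> carrier M" "\<kappa> (basis_vec M \<kappa> i) = unit_vec i"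
proof -
  have "unit_vec i \<in> \<kappa> ` carrier M"
    using assms unit_vec_vecs[OF assms(2)] by (auto simp: coords_def bij_betw_def)
  then show "basis_vec M \<kappa> i \<in> carrier M" "\<kappa> (basis_vec M \<kappa> i) = unit_vec i"
    unfolding basis_vec_def by (auto intro: inv_into_into f_inv_into_f)
qed

text \<open>Subtracting one coordinate at a time empties the support. This allows linear statements
  to be checked on the basis.\<close>

lemma coords_induct [consumes 2, case_names zero add smult basis]:
  fixes M :: "('g, 'k :: field, 'v) gmod"
  assumes M: "coords M I \<kappa>" and x: "x \<in> carrier M"
    and zero: "P \<zero>\<^bsub>M\<^esub>"
    and add: "\<And>x y. x \<in> carrier M \<Longrightarrow> y \<in> carrier M \<Longrightarrow> P x \<Longrightarrow> P y \<Longrightarrow> P (x \<oplus>\<^bsub>M\<^esub> y)"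
    and smult: "\<And>c x. x \<in> carrier M \<Longrightarrow> P x \<Longrightarrow> P (c \<odot>\<^bsub>M\<^esub> x)"
    and basis: "\<And>i. i \<in> I \<Longrightarrow> P (basis_vec M \<kappa> i)"
  shows "P x"
proof -
  interpret V: module "ring_of_type_algebra :: 'k ring" M using coordsD(1)[OF M] .
  note lin = coordsD(3)[OF M]
  have *: "P x" if "x \<in> carrier M" "finite J" "J \<subseteq> I" "\<kappa> x \<in> vecs J" for x J
    using that(2,3,1,4)
  proof (induction J arbitrary: x rule: finite_induct)
    case empty
    then have "x = \<zero>\<^bsub>M\<^esub>"
      by (intro coords_eqI[OF M]) (auto simp: vecs_def lin_to_zero[OF coordsD(1)[OF M] lin])
    with zero show ?case by simp
  next
    case (insert j J)
    let ?b = "basis_vec M \<kappa> j" and ?c = "\<kappa> x j"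
    have b: "?b \<in> carrier M" "\<kappa> ?b = unit_vec j" using basis_vec[OF M] insert by auto
    have y: "x \<ominus>\<^bsub>M\<^esub> (?c \<odot>\<^bsub>M\<^esub> ?b) \<in> carrier M" using b insert by auto
    have "\<kappa> (x \<ominus>\<^bsub>M\<^esub> (?c \<odot>\<^bsub>M\<^esub> ?b)) \<in> vecs J"
      using insert.prems b
      by (auto simp: vecs_def lin_to_minus[OF coordsD(1)[OF M] lin] lin_toD[OF lin] unit_vec_def)
    then have "P (x \<ominus>\<^bsub>M\<^esub> (?c \<odot>\<^bsub>M\<^esub> ?b))" using insert y by auto
    moreover have "P (?c \<odot>\<^bsub>M\<^esub> ?b)" using b insert by (auto intro!: smult basis)
    ultimately have "P ((x \<ominus>\<^bsub>M\<^esub> (?c \<odot>\<^bsub>M\<^esub> ?b)) \<oplus>\<^bsub>M\<^esub> (?c \<odot>\<^bsub>M\<^esub> ?b))"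
      using add y b by auto
    moreover have "(x \<ominus>\<^bsub>M\<^esub> (?c \<odot>\<^bsub>M\<^esub> ?b)) \<oplus>\<^bsub>M\<^esub> (?c \<odot>\<^bsub>M\<^esub> ?b) = x"
      using b insert by (simp add: V.M.minus_eq V.M.a_assoc V.M.l_neg)
    ultimately show ?case by simp
  qed
  show ?thesis
    using *[OF x, of I] coordsD(2)[OF M] lin_toD(1)[OF lin x] by auto
qed

subsection \<open>Quotients by kernels\<close>

text \<open>Both quotients in play have this form: the free space on lists modulo multilinearity,
  and the tensor power modulo the effect of place permutations. In each case the generated submodule
  is shown to be the kernel of an explicit \<open>\<phi>\<close>, which then provides
  coordinates.\<close>

locale kernel_quotient =
  fixes M :: "('g, 'k :: field, 'v) gmod" and I :: "'i set" and \<phi> :: "'v \<Rightarrow> 'i \<Rightarrow> 'k" and N :: "'v set"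
  assumes mod: "kmodule M" and fin: "finite I" and lin: "lin_to M I \<phi>"
    and surj: "\<phi> ` carrier M = vecs I" and N_eq: "N = {x \<in> carrier M. \<forall>i. \<phi> x i = 0}"
begin

sublocale V: module "ring_of_type_algebra :: 'k ring" M by (rule mod)

lemma coset_eq:
  assumes "x \<in> carrier M"
  shows "N +>\<^bsub>M\<^esub> x = {y \<in> carrier M. \<phi> y = \<phi> x}"
proof (intro equalityI subsetI)
  fix y assume "y \<in> N +>\<^bsub>M\<^esub> x"
  then obtain n where "n \<in> N" "y = n \<oplus>\<^bsub>M\<^esub> x" by (auto simp: a_r_coset_def')
  then show "y \<in> {y \<in> carrier M. \<phi> y = \<phi> x}"
    using assms by (auto simp: N_eq lin_toD[OF lin])
next
  fix y assume y: "y \<in> {y \<in> carrier M. \<phi> y = \<phi> x}"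
  then have "y \<ominus>\<^bsub>M\<^esub> x \<in> N" using assms by (auto simp: N_eq lin_to_minus[OF mod lin])
  moreover have "y = (y \<ominus>\<^bsub>M\<^esub> x) \<oplus>\<^bsub>M\<^esub> x"
    using y assms by (simp add: V.M.minus_eq V.M.a_assoc V.M.l_neg)
  ultimately have "\<exists>n\<in>N. y = n \<oplus>\<^bsub>M\<^esub> x" by (rule rev_bexI)
  then show "y \<in> N +>\<^bsub>M\<^esub> x" by (simp add: a_r_coset_def')
qed

text \<open>Cosets are the fibres of \<open>\<phi>\<close>, so for a map that respects fibres all
  members of the union in \<open>coset_map\<close> coincide.\<close>

lemma coset_map_coset:
  assumes "\<And>y. y \<in> carrier M \<Longrightarrow> \<psi> y \<in> carrier M"
    and "\<And>y z. y \<in> carrier M \<Longrightarrow> z \<in> carrier M \<Longrightarrow> \<phi> y = \<phi> z \<Longrightarrow> \<phi> (\<psi> y) = \<phi> (\<psi> z)"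
    and "x \<in> carrier M"
  shows "coset_map M N \<psi> (N +>\<^bsub>M\<^esub> x) = N +>\<^bsub>M\<^esub> \<psi> x"
proof -
  have *: "N +>\<^bsub>M\<^esub> \<psi> y = N +>\<^bsub>M\<^esub> \<psi> x" if "y \<in> N +>\<^bsub>M\<^esub> x" for y
  proof -
    have y: "y \<in> carrier M" "\<phi> y = \<phi> x" using that assms(3) by (simp_all add: coset_eq)
    then have "\<phi> (\<psi> y) = \<phi> (\<psi> x)" using assms(2)[OF y(1) assms(3) y(2)] by simp
    then show ?thesis using assms(1,3) y(1) by (simp add: coset_eq)
  qed
  have "(\<Union>y\<in>N +>\<^bsub>M\<^esub> x. N +>\<^bsub>M\<^esub> \<psi> y) = (\<Union>y\<in>N +>\<^bsub>M\<^esub> x. N +>\<^bsub>M\<^esub> \<psi> x)"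
    by (rule SUP_cong[OF refl *])
  moreover have "x \<in> N +>\<^bsub>M\<^esub> x" using assms(3) by (simp add: coset_eq)
  ultimately show ?thesis unfolding coset_map_def by blast
qed

lemma set_add_coset:
  assumes "x \<in> carrier M" "y \<in> carrier M"
  shows "set_add M (N +>\<^bsub>M\<^esub> x) (N +>\<^bsub>M\<^esub> y) = N +>\<^bsub>M\<^esub> (x \<oplus>\<^bsub>M\<^esub> y)"
proof (intro equalityI subsetI)
  fix z assume "z \<in> set_add M (N +>\<^bsub>M\<^esub> x) (N +>\<^bsub>M\<^esub> y)"
  then obtain u v where uv: "u \<in> carrier M" "v \<in> carrier M" "\<phi> u = \<phi> x" "\<phi> v = \<phi> y" "z = u \<oplus>\<^bsub>M\<^esub> v"
    using assms by (auto simp: set_add_def' coset_eq)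
  then have "\<phi> z = \<phi> (x \<oplus>\<^bsub>M\<^esub> y)"
    using assms by (intro ext) (simp add: lin_toD[OF lin])
  then show "z \<in> N +>\<^bsub>M\<^esub> (x \<oplus>\<^bsub>M\<^esub> y)"
    using assms uv by (auto simp: coset_eq)
next
  fix z assume z: "z \<in> N +>\<^bsub>M\<^esub> (x \<oplus>\<^bsub>M\<^esub> y)"
  then have zc: "z \<in> carrier M" "\<phi> z = \<phi> (x \<oplus>\<^bsub>M\<^esub> y)" using assms by (auto simp: coset_eq)
  have "\<phi> (z \<ominus>\<^bsub>M\<^esub> y) = \<phi> x"
    using zc assms by (intro ext) (simp add: lin_toD[OF lin] lin_to_minus[OF mod lin])
  then have u: "z \<ominus>\<^bsub>M\<^esub> y \<in> N +>\<^bsub>M\<^esub> x"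
    using zc assms by (simp add: coset_eq)
  have v: "y \<in> N +>\<^bsub>M\<^esub> y" using assms by (simp add: coset_eq)
  have "z = (z \<ominus>\<^bsub>M\<^esub> y) \<oplus>\<^bsub>M\<^esub> y"
    using zc assms by (simp add: V.M.minus_eq V.M.a_assoc V.M.l_neg)
  then have "\<exists>v\<in>N +>\<^bsub>M\<^esub> y. z = (z \<ominus>\<^bsub>M\<^esub> y) \<oplus>\<^bsub>M\<^esub> v"
    using v by (rule bexI)
  then have "\<exists>u\<in>N +>\<^bsub>M\<^esub> x. \<exists>v\<in>N +>\<^bsub>M\<^esub> y. z = u \<oplus>\<^bsub>M\<^esub> v"
    using u by (rule bexI)
  then show "z \<in> set_add M (N +>\<^bsub>M\<^esub> x) (N +>\<^bsub>M\<^esub> y)"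
    unfolding set_add_def' UN_iff singleton_iff .
qed

definition quot_coord :: "'v set \<Rightarrow> 'i \<Rightarrow> 'k" where
  "quot_coord C = \<phi> (SOME x. x \<in> C)"

lemma quot_coord_coset:
  assumes "x \<in> carrier M"
  shows "quot_coord (N +>\<^bsub>M\<^esub> x) = \<phi> x"
proof -
  have "x \<in> N +>\<^bsub>M\<^esub> x" using assms by (simp add: coset_eq)
  then have "(SOME y. y \<in> N +>\<^bsub>M\<^esub> x) \<in> N +>\<^bsub>M\<^esub> x" by (rule someI)
  then show ?thesis using assms by (auto simp: quot_coord_def coset_eq)
qed

lemma carrier_quot: "carrier (quot_rep M N) = (\<lambda>x. N +>\<^bsub>M\<^esub> x) ` carrier M"
  by (auto simp: quot_rep_def A_RCOSETS_def')

lemma smult_coset: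
  assumes "x \<in> carrier M"
  shows "c \<odot>\<^bsub>quot_rep M N\<^esub> (N +>\<^bsub>M\<^esub> x) = N +>\<^bsub>M\<^esub> (c \<odot>\<^bsub>M\<^esub> x)"
  using coset_map_coset[of "\<lambda>x. c \<odot>\<^bsub>M\<^esub> x" x] assms
  by (simp add: quot_rep_def fun_eq_iff lin_toD[OF lin])

lemma add_coset:
  assumes "x \<in> carrier M" "y \<in> carrier M"
  shows "(N +>\<^bsub>M\<^esub> x) \<oplus>\<^bsub>quot_rep M N\<^esub> (N +>\<^bsub>M\<^esub> y) = N +>\<^bsub>M\<^esub> (x \<oplus>\<^bsub>M\<^esub> y)"
  using set_add_coset[OF assms] by (simp add: quot_rep_def)

lemma zero_coset: "\<zero>\<^bsub>quot_rep M N\<^esub> = N +>\<^bsub>M\<^esub> \<zero>\<^bsub>M\<^esub>"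
  using lin_to_zero[OF mod lin] by (auto simp: quot_rep_def coset_eq N_eq fun_eq_iff)

lemma coords_quot: "coords (quot_rep M N) I quot_coord"
proof (rule coordsI)
  show "lin_to (quot_rep M N) I quot_coord"
    unfolding lin_to_def carrier_quot ball_simps
    by (intro conjI ballI allI)
      (simp_all add: quot_coord_coset lin_toD[OF lin] add_coset smult_coset)
  show "bij_betw quot_coord (carrier (quot_rep M N)) (vecs I)"
    unfolding bij_betw_def
  proof
    show "inj_on quot_coord (carrier (quot_rep M N))"
    proof (rule inj_onI)
      fix C D assume "C \<in> carrier (quot_rep M N)" "D \<in> carrier (quot_rep M N)"
        and eq: "quot_coord C = quot_coord D"
      then obtain x y where "x \<in> carrier M" "C = N +>\<^bsub>M\<^esub> x" "y \<in> carrier M" "D = N +>\<^bsub>M\<^esub> y"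
        by (auto simp: carrier_quot)
      with eq show "C = D" by (simp add: quot_coord_coset) (simp add: coset_eq)
    qed
    have "quot_coord ` carrier (quot_rep M N) = \<phi> ` carrier M"
      unfolding carrier_quot image_image by (intro image_cong refl quot_coord_coset)
    then show "quot_coord ` carrier (quot_rep M N) = vecs I" using surj by simp
  qed
  show "\<zero>\<^bsub>quot_rep M N\<^esub> \<in> carrier (quot_rep M N)"
    by (simp add: zero_coset carrier_quot)
  show "quot_coord \<zero>\<^bsub>quot_rep M N\<^esub> i = 0" for i
    by (simp add: zero_coset quot_coord_coset lin_to_zero[OF mod lin])
  fix C assume "C \<in> carrier (quot_rep M N)"
  then obtain x where x: "x \<in> carrier M" "C = N +>\<^bsub>M\<^esub> x" by (auto simp: carrier_quot)
  then show "c \<odot>\<^bsub>quot_rep M N\<^esub> C \<in> carrier (quot_rep M N)" for c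
    unfolding carrier_quot by (intro image_eqI[of _ _ "c \<odot>\<^bsub>M\<^esub> x"]) (simp_all add: smult_coset)
  fix D assume "D \<in> carrier (quot_rep M N)"
  then obtain y where "y \<in> carrier M" "D = N +>\<^bsub>M\<^esub> y" by (auto simp: carrier_quot)
  then show "C \<oplus>\<^bsub>quot_rep M N\<^esub> D \<in> carrier (quot_rep M N)"
    unfolding carrier_quot using x
    by (intro image_eqI[of _ _ "x \<oplus>\<^bsub>M\<^esub> y"]) (simp_all add: add_coset)
qed (fact fin)

lemma act_coset:
  assumes "\<And>y. y \<in> carrier M \<Longrightarrow> act M g y \<in> carrier M"
    and "\<And>y z. y \<in> carrier M \<Longrightarrow> z \<in> carrier M \<Longrightarrow> \<phi> y = \<phi> z \<Longrightarrow> \<phi> (act M g y) = \<phi> (act M g z)"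
    and "x \<in> carrier M"
  shows "act (quot_rep M N) g (N +>\<^bsub>M\<^esub> x) = N +>\<^bsub>M\<^esub> act M g x"
proof -
  have "coset_map M N (act M g) (N +>\<^bsub>M\<^esub> x) = N +>\<^bsub>M\<^esub> act M g x"
    by (rule coset_map_coset) (fact assms)+
  then show ?thesis unfolding quot_rep_def by simp
qed

end

lemma submodule_kernel:
  fixes M :: "('g, 'k :: field, 'v) gmod"
  assumes "kmodule M" "lin_to M I \<phi>"
  shows "submodule {x \<in> carrier M. \<forall>i. \<phi> x i = 0} ring_of_type_algebra M"
proof -
  interpret V: module "ring_of_type_algebra :: 'k ring" M by fact
  show ?thesis
  proof (rule V.submoduleI)
    fix a assume a: "a \<in> {x \<in> carrier M. \<forall>i. \<phi> x i = 0}"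
    have "\<phi> (\<zero>\<^bsub>M\<^esub> \<ominus>\<^bsub>M\<^esub> a) i = 0" for i
      using a lin_to_minus[OF assms, of "\<zero>\<^bsub>M\<^esub>" a] lin_to_zero[OF assms] by simp
    moreover have "\<zero>\<^bsub>M\<^esub> \<ominus>\<^bsub>M\<^esub> a = \<ominus>\<^bsub>M\<^esub> a" using a by (simp add: V.M.minus_eq)
    ultimately show "\<ominus>\<^bsub>M\<^esub> a \<in> {x \<in> carrier M. \<forall>i. \<phi> x i = 0}" using a by auto
  qed (auto simp: lin_to_zero[OF assms] lin_toD[OF assms(2)])
qed

lemma gen_submodule:
  fixes M :: "('g, 'k :: field, 'v) gmod"
  assumes "kmodule M" "S \<subseteq> carrier M"
  shows "submodule (gen_submodule M S) ring_of_type_algebra M" "S \<subseteq> gen_submodule M S"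
proof -
  interpret V: module "ring_of_type_algebra :: 'k ring" M by fact
  show "S \<subseteq> gen_submodule M S" by (auto simp: gen_submodule_def)
  have 1: "submodule (carrier M) ring_of_type_algebra M" by (rule V.carrier_is_submodule)
  show "submodule (gen_submodule M S) ring_of_type_algebra M"
  proof (rule V.submoduleI)
    show "gen_submodule M S \<subseteq> carrier M" using 1 assms(2) unfolding gen_submodule_def by blast
    show "\<zero>\<^bsub>M\<^esub> \<in> gen_submodule M S"
      using submodule.axioms(1) subgroup.one_closed unfolding gen_submodule_def by fastforce
  next
    fix c x assume "x \<in> gen_submodule M S"
    then show "c \<odot>\<^bsub>M\<^esub> x \<in> gen_submodule M S"
      using V.submoduleE(4)[where a = c] by (auto simp: gen_submodule_def)
  qed (auto simp: gen_submodule_def dest: V.submoduleE(3,5))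
qed

text \<open>A criterion for given relations to generate the whole kernel: every element is congruent
  to a normal form in \<open>Y\<close>, and \<open>\<phi>\<close> kills no normal form except
  zero.\<close>

lemma gen_submodule_eq_kernel:
  fixes M :: "('g, 'k :: field, 'v) gmod"
  assumes M: "kmodule M" and lin: "lin_to M I \<phi>"
    and S: "S \<subseteq> {x \<in> carrier M. \<forall>i. \<phi> x i = 0}"
    and Y: "Y \<subseteq> carrier M" "\<And>y. y \<in> Y \<Longrightarrow> \<forall>i. \<phi> y i = 0 \<Longrightarrow> y = \<zero>\<^bsub>M\<^esub>"
    and span: "\<And>x. x \<in> carrier M \<Longrightarrow> \<exists>y\<in>Y. x \<ominus>\<^bsub>M\<^esub> y \<in> gen_submodule M S"
  shows "gen_submodule M S = {x \<in> carrier M. \<forall>i. \<phi> x i = 0}"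
proof
  show sub: "gen_submodule M S \<subseteq> {x \<in> carrier M. \<forall>i. \<phi> x i = 0}"
    using submodule_kernel[OF M lin] S unfolding gen_submodule_def by blast
  interpret V: module "ring_of_type_algebra :: 'k ring" M by fact
  show "{x \<in> carrier M. \<forall>i. \<phi> x i = 0} \<subseteq> gen_submodule M S"
  proof
    fix x assume x: "x \<in> {x \<in> carrier M. \<forall>i. \<phi> x i = 0}"
    then obtain y where y: "y \<in> Y" "x \<ominus>\<^bsub>M\<^esub> y \<in> gen_submodule M S" using span by blast
    then have "\<forall>i. \<phi> (x \<ominus>\<^bsub>M\<^esub> y) i = 0" using sub by auto
    then have "\<forall>i. \<phi> y i = 0" using x y Y(1) by (auto simp: lin_to_minus[OF M lin])
    then have "y = \<zero>\<^bsub>M\<^esub>" using y Y by auto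
    moreover have "x \<ominus>\<^bsub>M\<^esub> \<zero>\<^bsub>M\<^esub> = x" using x by (simp add: V.M.minus_eq)
    ultimately show "x \<in> gen_submodule M S" using y by simp
  qed
qed

subsection \<open>Tensor powers\<close>

definition lin_ext :: "('x \<Rightarrow> 'k) \<Rightarrow> ('x \<Rightarrow>\<^sub>0 'k :: field) \<Rightarrow> 'k" where
  "lin_ext F f = (\<Sum>x\<in>Poly_Mapping.keys f. Poly_Mapping.lookup f x * F x)"

lemma lin_ext_superset:
  assumes "finite A" "Poly_Mapping.keys f \<subseteq> A"
  shows "lin_ext F f = (\<Sum>x\<in>A. Poly_Mapping.lookup f x * F x)"
  unfolding lin_ext_def using assms by (intro sum.mono_neutral_left) (auto simp: in_keys_iff)

lemma lin_ext_add: "lin_ext F (f + g) = lin_ext F f + lin_ext F g"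
proof -
  let ?A = "Poly_Mapping.keys f \<union> Poly_Mapping.keys g"
  have "lin_ext F (f + g) = (\<Sum>x\<in>?A. Poly_Mapping.lookup (f + g) x * F x)"
    by (rule lin_ext_superset) (auto dest: set_mp[OF Poly_Mapping.keys_add])
  then show ?thesis
    by (simp add: lin_ext_superset[of ?A] lookup_add distrib_right sum.distrib)
qed

lemma sum_single_lookup:
  "(\<Sum>x\<in>Poly_Mapping.keys f. Poly_Mapping.single x (Poly_Mapping.lookup f x)) = f"
  by (rule poly_mapping_eqI)
    (simp add: lookup_sum lookup_single when_def in_keys_iff cong: if_cong)

lemma lin_ext_zero [simp]: "lin_ext F 0 = 0"
  by (simp add: lin_ext_def)

lemma lin_ext_single [simp]: "lin_ext F (Poly_Mapping.single x c) = c * F x"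
  by (simp add: lin_ext_def)

lemma lin_ext_sum: "lin_ext F (\<Sum>x\<in>A. h x) = (\<Sum>x\<in>A. lin_ext F (h x))"
  by (induction A rule: infinite_finite_induct) (auto simp: lin_ext_add)

lemma lin_ext_cong:
  "(\<And>x. x \<in> Poly_Mapping.keys f \<Longrightarrow> F x = F' x) \<Longrightarrow> lin_ext F f = lin_ext F' f"
  unfolding lin_ext_def by (intro sum.cong) auto

lemma lookup_psmult:
  fixes f :: "'x \<Rightarrow>\<^sub>0 'k :: field"
  shows "Poly_Mapping.lookup (Poly_Mapping.map ((*) c) f) x = c * Poly_Mapping.lookup f x"
  by (simp add: Poly_Mapping.map.rep_eq when_def)

lemma psmult_single:
  "Poly_Mapping.map ((*) c) (Poly_Mapping.single x (d :: 'k :: field)) = Poly_Mapping.single x (c * d)"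
  by (rule poly_mapping_eqI) (simp add: lookup_psmult lookup_single when_def)

lemma lin_ext_psmult: "lin_ext F (Poly_Mapping.map ((*) c) f) = c * lin_ext F f"
proof -
  have "lin_ext F (Poly_Mapping.map ((*) c) f) =
      (\<Sum>x\<in>Poly_Mapping.keys f. Poly_Mapping.lookup (Poly_Mapping.map ((*) c) f) x * F x)"
    by (rule lin_ext_superset) (auto simp: in_keys_iff lookup_psmult)
  then show ?thesis by (simp add: lookup_psmult lin_ext_def sum_distrib_left mult.assoc)
qed

lemma lin_ext_push_forward: "lin_ext F (push_forward \<eta> f) = lin_ext (\<lambda>x. F (\<eta> x)) f"
  unfolding push_forward_def by (simp add: lin_ext_sum) (simp add: lin_ext_def)

lemma keys_push_forward: "Poly_Mapping.keys (push_forward \<eta> f) \<subseteq> \<eta> ` Poly_Mapping.keys f"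
proof -
  have "Poly_Mapping.keys (push_forward \<eta> f) \<subseteq>
      (\<Union>x\<in>Poly_Mapping.keys f. Poly_Mapping.keys (Poly_Mapping.single (\<eta> x) (Poly_Mapping.lookup f x)))"
    unfolding push_forward_def by (rule Poly_Mapping.keys_sum)
  also have "\<dots> \<subseteq> \<eta> ` Poly_Mapping.keys f" by (auto split: if_splits)
  finally show ?thesis .
qed

lemma free_rep_sel:
  "add (free_rep r V) = (+)" "ring.zero (free_rep r V) = 0"
  "module.smult (free_rep r V) = (\<lambda>c. Poly_Mapping.map ((*) c))"
  "act (free_rep r V) = (\<lambda>g. push_forward (map (act V g)))"
  by (simp_all add: free_rep_def)

lemma free_rep_carrier:
  "f \<in> carrier (free_rep r V) \<longleftrightarrow>
    (\<forall>xs\<in>Poly_Mapping.keys f. length xs = r \<and> set xs \<subseteq> carrier V)"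
  by (simp add: free_rep_def)

lemma free_rep_closed:
  "f \<in> carrier (free_rep r V) \<Longrightarrow> g \<in> carrier (free_rep r V) \<Longrightarrow> f + g \<in> carrier (free_rep r V)"
  "f \<in> carrier (free_rep r V) \<Longrightarrow> Poly_Mapping.map ((*) c) f \<in> carrier (free_rep r V)"
  "f \<in> carrier (free_rep r V) \<Longrightarrow> - f \<in> carrier (free_rep r V)"
  "0 \<in> carrier (free_rep r V)"
proof -
  assume "f \<in> carrier (free_rep r V)" "g \<in> carrier (free_rep r V)"
  then show "f + g \<in> carrier (free_rep r V)"
    using Poly_Mapping.keys_add[of f g] unfolding free_rep_carrier by blast
qed (simp_all add: free_rep_carrier in_keys_iff lookup_psmult)

lemma free_rep_single:
  "length xs = r \<Longrightarrow> set xs \<subseteq> carrier V \<Longrightarrow> Poly_Mapping.single xs c \<in> carrier (free_rep r V)"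
  by (auto simp: free_rep_carrier split: if_splits)

lemma free_rep_sum:
  "(\<And>x. x \<in> A \<Longrightarrow> h x \<in> carrier (free_rep r V)) \<Longrightarrow> (\<Sum>x\<in>A. h x) \<in> carrier (free_rep r V)"
  by (induction A rule: infinite_finite_induct) (auto simp: free_rep_closed)

lemma kmodule_free_rep:
  fixes V :: "('g, 'k :: field, 'v) gmod"
  shows "kmodule (free_rep r V)"
proof (rule moduleI)
  show "cring (ring_of_type_algebra :: 'k ring)" by (rule cring_from_type_algebra)
  show "abelian_group (free_rep r V)"
  proof (rule abelian_groupI)
    fix f assume "f \<in> carrier (free_rep r V)"
    then show "\<exists>g\<in>carrier (free_rep r V). g \<oplus>\<^bsub>free_rep r V\<^esub> f = \<zero>\<^bsub>free_rep r V\<^esub>"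
      by (intro bexI[of _ "- f"]) (simp_all add: free_rep_sel free_rep_closed)
  qed (simp_all add: free_rep_sel free_rep_closed algebra_simps)
qed (auto simp: free_rep_sel free_rep_closed lookup_psmult lookup_add algebra_simps intro!: poly_mapping_eqI)

lemma free_rep_minus:
  assumes "f \<in> carrier (free_rep r V)" "g \<in> carrier (free_rep r V)"
  shows "f \<ominus>\<^bsub>free_rep r V\<^esub> g = f - g"
proof -
  interpret W: module ring_of_type_algebra "free_rep r V" by (rule kmodule_free_rep)
  have "\<ominus>\<^bsub>free_rep r V\<^esub> g = - g"
    using assms by (intro W.M.minus_equality) (auto simp: free_rep_sel free_rep_closed)
  then show ?thesis by (simp add: W.M.minus_eq free_rep_sel)
qed

lemma nth_middle_other:
  assumes "k \<noteq> length us"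
  shows "(us @ v # ws) ! k = (us @ z # ws) ! k"
proof (cases "k < length us")
  case False
  then obtain n where "k - length us = Suc n" using assms by (metis Suc_diff_Suc linorder_neqE_nat)
  then show ?thesis using False by (simp add: nth_append)
qed (simp add: nth_append)

lemma permute_coords_eq:
  assumes \<sigma>: "\<sigma> permutes {..<r}" and "length xs = r"
  shows "(\<Prod>k<r. h (permute_list \<sigma> xs ! k) (s k)) = (\<Prod>k<r. h (xs ! k) ((s \<circ> Hilbert_Choice.inv \<sigma>) k))"
proof -
  have "(\<Prod>k<r. h (permute_list \<sigma> xs ! k) (s k)) = (\<Prod>k<r. h (xs ! (\<sigma> k)) ((s \<circ> Hilbert_Choice.inv \<sigma>) (\<sigma> k)))"
    using assms by (intro prod.cong refl) (simp add: permute_list_nth permutes_inverses)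
  also have "\<dots> = (\<Prod>k<r. h (xs ! k) ((s \<circ> Hilbert_Choice.inv \<sigma>) k))"
    by (subst (2) prod.permute[OF \<sigma>]) (simp add: o_def)
  finally show ?thesis .
qed

locale tensor_coords =
  fixes V :: "('g, 'k :: field, 'v) gmod" and I :: "'i set" and \<kappa> :: "'v \<Rightarrow> 'i \<Rightarrow> 'k" and r :: nat
  assumes V: "coords V I \<kappa>"
begin

abbreviation "T \<equiv> tuples r I"

text \<open>The dual basis tensor with index \<open>s\<close>, evaluated on a formal combination of
  pure tensors.\<close>

definition fcoord :: "('v list \<Rightarrow>\<^sub>0 'k) \<Rightarrow> (nat \<Rightarrow> 'i) \<Rightarrow> 'k" where
  "fcoord f s = (if s \<in> T then lin_ext (\<lambda>xs. \<Prod>k<r. \<kappa> (xs ! k) (s k)) f else 0)"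

definition blist :: "(nat \<Rightarrow> 'i) \<Rightarrow> 'v list" where
  "blist s = map (\<lambda>k. basis_vec V \<kappa> (s k)) [0..<r]"

text \<open>The normal forms to which \<open>gen_submodule_eq_kernel\<close> will be
  applied.\<close>

definition comb :: "((nat \<Rightarrow> 'i) \<Rightarrow> 'k) \<Rightarrow> 'v list \<Rightarrow>\<^sub>0 'k" where
  "comb c = (\<Sum>s\<in>T. Poly_Mapping.single (blist s) (c s))"

lemma finite_I: "finite I" using coordsD(2)[OF V] .

lemma finite_T: "finite T"
  using finite_I by (intro finite_PiE) auto

lemma T_mem: "s \<in> T \<Longrightarrow> k < r \<Longrightarrow> s k \<in> I"
  using PiE_mem[of s "{..<r}" "\<lambda>_. I" k] by simp

lemma blist_closed: "s \<in> T \<Longrightarrow> length (blist s) = r \<and> set (blist s) \<subseteq> carrier V"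
  using basis_vec(1)[OF V T_mem[of s]] by (simp add: blist_def image_subset_iff)

lemma comb_closed: "comb c \<in> carrier (free_rep r V)"
  unfolding comb_def using blist_closed by (intro free_rep_sum free_rep_single) auto

lemma comb_add: "comb (\<lambda>s. c s + d s) = comb c + comb d"
  by (simp add: comb_def single_add sum.distrib)

lemma comb_psmult: "comb (\<lambda>s. a * c s) = Poly_Mapping.map ((*) a) (comb c)"
  unfolding comb_def
  by (rule poly_mapping_eqI) (simp add: lookup_psmult lookup_sum lookup_single sum_distrib_left when_def if_distrib cong: if_cong)

lemma comb_zero: "(\<And>s. s \<in> T \<Longrightarrow> c s = 0) \<Longrightarrow> comb c = 0"
  by (simp add: comb_def)

lemma comb_unit: "s \<in> T \<Longrightarrow> comb (unit_vec s) = Poly_Mapping.single (blist s) 1"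
proof -
  assume s: "s \<in> T"
  have "comb (unit_vec s) = (\<Sum>t\<in>T. if t = s then Poly_Mapping.single (blist s) 1 else 0)"
    unfolding comb_def by (intro sum.cong refl) (simp add: unit_vec_def)
  then show ?thesis using s finite_T by simp
qed

lemma prod_blist:
  assumes "s \<in> T" "t \<in> T"
  shows "(\<Prod>k<r. \<kappa> (blist s ! k) (t k)) = (if s = t then 1 else 0)"
proof -
  have "(\<Prod>k<r. \<kappa> (blist s ! k) (t k)) = (\<Prod>k<r. if t k = s k then 1 else 0)"
    by (intro prod.cong refl) (simp add: blist_def basis_vec(2)[OF V T_mem[OF assms(1)]] unit_vec_def)
  also have "\<dots> = (if s = t then 1 else 0)"
  proof (cases "s = t")
    case False
    then obtain k where k: "k < r" "t k \<noteq> s k"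
      using PiE_ext[OF assms] by (metis lessThan_iff)
    then have "(\<Prod>k<r. if t k = s k then 1 else 0 :: 'k) = 0" by (intro prod_zero) auto
    then show ?thesis using False by simp
  qed simp
  finally show ?thesis .
qed

lemma fcoord_comb: "t \<in> T \<Longrightarrow> fcoord (comb c) t = c t"
  using finite_T by (simp add: fcoord_def comb_def lin_ext_sum prod_blist if_distrib cong: if_cong)

lemma lin_fcoord: "lin_to (free_rep r V) T fcoord"
  unfolding lin_to_def
  by (auto simp: vecs_def fcoord_def free_rep_sel lin_ext_add lin_ext_psmult)

lemma relations_kernel:
  "multilinear_relations r V \<subseteq> {f \<in> carrier (free_rep r V). \<forall>s. fcoord f s = 0}"
proof
  fix f assume "f \<in> multilinear_relations r V"
  then consider
    (add) us ws x y where "f = Poly_Mapping.single (us @ (x \<oplus>\<^bsub>V\<^esub> y) # ws) 1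
        - Poly_Mapping.single (us @ x # ws) 1 - Poly_Mapping.single (us @ y # ws) 1"
      "Suc (length us + length ws) = r" "set us \<union> set ws \<subseteq> carrier V" "x \<in> carrier V" "y \<in> carrier V"
  | (smult) us ws c x where "f = Poly_Mapping.single (us @ (c \<odot>\<^bsub>V\<^esub> x) # ws) 1 - Poly_Mapping.single (us @ x # ws) c"
      "Suc (length us + length ws) = r" "set us \<union> set ws \<subseteq> carrier V" "x \<in> carrier V"
    unfolding multilinear_relations_def by blast
  then show "f \<in> {f \<in> carrier (free_rep r V). \<forall>s. fcoord f s = 0}"
  proof cases
    case add
    let ?z = "x \<oplus>\<^bsub>V\<^esub> y"
    have z: "?z \<in> carrier V" using coords_closed[OF V] add by auto
    \<comment> \<open>The lists differ at the position \<open>length us\<close> only, so the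
      remaining factors are common to all of them; \<open>?z\<close> is a placeholder there.\<close>
    have prod: "(\<Prod>k<r. \<kappa> ((us @ v # ws) ! k) (s k)) =
        \<kappa> v (s (length us)) * (\<Prod>k\<in>{..<r} - {length us}. \<kappa> ((us @ ?z # ws) ! k) (s k))" for v s
    proof -
      have "(\<Prod>k\<in>{..<r} - {length us}. \<kappa> ((us @ v # ws) ! k) (s k)) =
          (\<Prod>k\<in>{..<r} - {length us}. \<kappa> ((us @ ?z # ws) ! k) (s k))"
        by (intro prod.cong refl fun_cong[OF arg_cong[of _ _ \<kappa>]] nth_middle_other) auto
      then show ?thesis using add(2) by (subst prod.remove[of _ "length us"]) (auto simp: nth_append)
    qed
    have f: "f + Poly_Mapping.single (us @ x # ws) 1 + Poly_Mapping.single (us @ y # ws) 1 = Poly_Mapping.single (us @ ?z # ws) 1"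
      using add(1) by simp
    have "f \<in> carrier (free_rep r V)"
    proof -
      have "f = Poly_Mapping.single (us @ ?z # ws) 1 + - Poly_Mapping.single (us @ x # ws) 1 + - Poly_Mapping.single (us @ y # ws) 1"
        using add(1) by simp
      then show ?thesis
        using add z by (simp only:) (intro free_rep_closed free_rep_single; auto)
    qed
    moreover have "fcoord f s = 0" for s
    proof (cases "s \<in> T")
      case True
      have "lin_ext (\<lambda>xs. \<Prod>k<r. \<kappa> (xs ! k) (s k)) f
          + (\<Prod>k<r. \<kappa> ((us @ x # ws) ! k) (s k)) + (\<Prod>k<r. \<kappa> ((us @ y # ws) ! k) (s k))
          = (\<Prod>k<r. \<kappa> ((us @ ?z # ws) ! k) (s k))"
        using arg_cong[OF f, of "lin_ext (\<lambda>xs. \<Prod>k<r. \<kappa> (xs ! k) (s k))"] by (simp add: lin_ext_add)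
      then show ?thesis using True lin_toD(2)[OF coordsD(3)[OF V] add(4,5)]
        unfolding prod by (simp add: fcoord_def distrib_right)
    qed (simp add: fcoord_def)
    ultimately show ?thesis by simp
  next
    case smult
    let ?z = "c \<odot>\<^bsub>V\<^esub> x"
    have z: "?z \<in> carrier V" using coords_closed[OF V] smult by auto
    have prod: "(\<Prod>k<r. \<kappa> ((us @ v # ws) ! k) (s k)) =
        \<kappa> v (s (length us)) * (\<Prod>k\<in>{..<r} - {length us}. \<kappa> ((us @ ?z # ws) ! k) (s k))" for v s
    proof -
      have "(\<Prod>k\<in>{..<r} - {length us}. \<kappa> ((us @ v # ws) ! k) (s k)) =
          (\<Prod>k\<in>{..<r} - {length us}. \<kappa> ((us @ ?z # ws) ! k) (s k))"
        by (intro prod.cong refl fun_cong[OF arg_cong[of _ _ \<kappa>]] nth_middle_other) auto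
      then show ?thesis using smult(2) by (subst prod.remove[of _ "length us"]) (auto simp: nth_append)
    qed
    have f: "f + Poly_Mapping.single (us @ x # ws) c = Poly_Mapping.single (us @ ?z # ws) 1"
      using smult(1) by simp
    have "f \<in> carrier (free_rep r V)"
    proof -
      have "f = Poly_Mapping.single (us @ ?z # ws) 1 + - Poly_Mapping.single (us @ x # ws) c"
        using smult(1) by simp
      then show ?thesis
        using smult z by (simp only:) (intro free_rep_closed free_rep_single; auto)
    qed
    moreover have "fcoord f s = 0" for s
    proof (cases "s \<in> T")
      case True
      have "lin_ext (\<lambda>xs. \<Prod>k<r. \<kappa> (xs ! k) (s k)) f
          + c * (\<Prod>k<r. \<kappa> ((us @ x # ws) ! k) (s k)) = (\<Prod>k<r. \<kappa> ((us @ ?z # ws) ! k) (s k))"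
        using arg_cong[OF f, of "lin_ext (\<lambda>xs. \<Prod>k<r. \<kappa> (xs ! k) (s k))"] by (simp add: lin_ext_add)
      then show ?thesis using True lin_toD(3)[OF coordsD(3)[OF V] smult(4)]
        unfolding prod by (simp add: fcoord_def mult.assoc)
    qed (simp add: fcoord_def)
    ultimately show ?thesis by simp
  qed
qed

lemma tensor_rel_submodule:
  "0 \<in> tensor_rel r V"
  "f \<in> tensor_rel r V \<Longrightarrow> g \<in> tensor_rel r V \<Longrightarrow> f + g \<in> tensor_rel r V"
  "f \<in> tensor_rel r V \<Longrightarrow> Poly_Mapping.map ((*) c) f \<in> tensor_rel r V"
  "multilinear_relations r V \<subseteq> tensor_rel r V"
proof -
  interpret W: module "ring_of_type_algebra :: 'k ring" "free_rep r V" by (rule kmodule_free_rep)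
  have "multilinear_relations r V \<subseteq> carrier (free_rep r V)" using relations_kernel by blast
  from gen_submodule[OF kmodule_free_rep this]
  have *: "submodule (tensor_rel r V) ring_of_type_algebra (free_rep r V)"
    "multilinear_relations r V \<subseteq> tensor_rel r V" by (auto simp: tensor_rel_def)
  show "multilinear_relations r V \<subseteq> tensor_rel r V" by (rule *(2))
  show "f \<in> tensor_rel r V \<Longrightarrow> g \<in> tensor_rel r V \<Longrightarrow> f + g \<in> tensor_rel r V"
    using W.submoduleE(5)[OF *(1), of f g] by (simp add: free_rep_sel)
  show "f \<in> tensor_rel r V \<Longrightarrow> Poly_Mapping.map ((*) c) f \<in> tensor_rel r V"
    using W.submoduleE(4)[OF *(1), of c f] by (simp add: free_rep_sel)
  show "0 \<in> tensor_rel r V"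
    using subgroup.one_closed[OF submodule.axioms(1)[OF *(1)]] by (simp add: free_rep_sel)
qed

definition spanned :: "('v list \<Rightarrow>\<^sub>0 'k) \<Rightarrow> bool" where
  "spanned f \<longleftrightarrow> (\<exists>c. f - comb c \<in> tensor_rel r V)"

lemma spanned_rel: "f \<in> tensor_rel r V \<Longrightarrow> spanned f"
  unfolding spanned_def by (intro exI[of _ "\<lambda>_. 0"]) (simp add: comb_zero)

lemma spanned_add: "spanned f \<Longrightarrow> spanned g \<Longrightarrow> spanned (f + g)"
  unfolding spanned_def
proof (elim exE)
  fix c d assume "f - comb c \<in> tensor_rel r V" "g - comb d \<in> tensor_rel r V"
  from tensor_rel_submodule(2)[OF this]
  show "\<exists>e. f + g - comb e \<in> tensor_rel r V"
    by (intro exI[of _ "\<lambda>s. c s + d s"]) (simp add: comb_add algebra_simps)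
qed

lemma spanned_psmult: "spanned f \<Longrightarrow> spanned (Poly_Mapping.map ((*) a) f)"
  unfolding spanned_def
proof (elim exE)
  fix c assume "f - comb c \<in> tensor_rel r V"
  then have "Poly_Mapping.map ((*) a) (f - comb c) \<in> tensor_rel r V" by (rule tensor_rel_submodule)
  also have "Poly_Mapping.map ((*) a) (f - comb c) = Poly_Mapping.map ((*) a) f - comb (\<lambda>s. a * c s)"
    unfolding comb_psmult
    by (rule poly_mapping_eqI) (simp add: lookup_psmult lookup_minus algebra_simps)
  finally show "\<exists>e. Poly_Mapping.map ((*) a) f - comb e \<in> tensor_rel r V" by blast
qed

text \<open>The entries are expanded in the basis from left to right, and \<open>is\<close> collects
  the indices of those already treated. The two relations of multilinearity provide the induction
  steps of \<open>coords_induct\<close>.\<close>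

lemma spanned_single:
  assumes "set is \<subseteq> I" "length is + length xs = r" "set xs \<subseteq> carrier V"
  shows "spanned (Poly_Mapping.single (map (basis_vec V \<kappa>) is @ xs) 1)"
  using assms
proof (induction xs arbitrary: "is")
  case Nil
  let ?s = "restrict (\<lambda>k. is ! k) {..<r}"
  have s: "?s \<in> T" using Nil by (auto simp: subset_iff)
  have "blist ?s = map (basis_vec V \<kappa>) is @ []"
    using Nil by (intro nth_equalityI) (auto simp: blist_def)
  then show ?case
    using comb_unit[OF s] tensor_rel_submodule(1) unfolding spanned_def
    by (intro exI[of _ "unit_vec ?s"]) simp
next
  case (Cons x xs)
  let ?us = "map (basis_vec V \<kappa>) is"
  have us: "set ?us \<union> set xs \<subseteq> carrier V" "Suc (length ?us + length xs) = r"
    using Cons.prems basis_vec(1)[OF V] by auto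
  have rel1: "Poly_Mapping.single (?us @ (x \<oplus>\<^bsub>V\<^esub> y) # xs) 1
        - Poly_Mapping.single (?us @ x # xs) 1 - Poly_Mapping.single (?us @ y # xs) 1 \<in> tensor_rel r V"
    if "x \<in> carrier V" "y \<in> carrier V" for x y
    using that us
    by (intro subsetD[OF tensor_rel_submodule(4)[unfolded multilinear_relations_def]] UnI1) blast
  have rel2: "Poly_Mapping.single (?us @ (c \<odot>\<^bsub>V\<^esub> x) # xs) 1 - Poly_Mapping.single (?us @ x # xs) c \<in> tensor_rel r V"
    if "x \<in> carrier V" for c x
    using that us
    by (intro subsetD[OF tensor_rel_submodule(4)[unfolded multilinear_relations_def]] UnI2) blast
  interpret V: module "ring_of_type_algebra :: 'k ring" V by (rule coordsD(1)[OF V])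
  have x: "x \<in> carrier V" using Cons.prems by auto
  have "spanned (Poly_Mapping.single (?us @ x # xs) 1)"
    using V x
  proof (induction rule: coords_induct)
    case zero
    \<comment> \<open>The relation for the scalar 0 says that a tensor with a zero entry
      vanishes.\<close>
    have "0 \<odot>\<^bsub>V\<^esub> \<zero>\<^bsub>V\<^esub> = \<zero>\<^bsub>V\<^esub>"
      by (rule coords_eqI[OF V])
        (auto simp: lin_toD[OF coordsD(3)[OF V]] lin_to_zero[OF coordsD(1)[OF V] coordsD(3)[OF V]])
    then show ?case using rel2[of "\<zero>\<^bsub>V\<^esub>" 0] by (intro spanned_rel) simp
  next
    case (add x y)
    have "Poly_Mapping.single (?us @ (x \<oplus>\<^bsub>V\<^esub> y) # xs) 1 =
        (Poly_Mapping.single (?us @ (x \<oplus>\<^bsub>V\<^esub> y) # xs) 1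
        - Poly_Mapping.single (?us @ x # xs) 1 - Poly_Mapping.single (?us @ y # xs) 1) +
        (Poly_Mapping.single (?us @ x # xs) 1 + Poly_Mapping.single (?us @ y # xs) (1 :: 'k))"
      by simp
    then show ?case using add rel1 by (metis spanned_add spanned_rel)
  next
    case (smult c x)
    have "Poly_Mapping.single (?us @ (c \<odot>\<^bsub>V\<^esub> x) # xs) 1 =
        (Poly_Mapping.single (?us @ (c \<odot>\<^bsub>V\<^esub> x) # xs) 1 - Poly_Mapping.single (?us @ x # xs) c) +
        Poly_Mapping.map ((*) c) (Poly_Mapping.single (?us @ x # xs) (1 :: 'k))"
      by (simp add: psmult_single)
    then show ?case using smult rel2 by (metis spanned_add spanned_rel spanned_psmult)
  next
    case (basis i)
    then show ?case using Cons.IH[of "is @ [i]"] Cons.prems by simp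
  qed
  then show ?case by simp
qed

lemma spanned_free:
  assumes "f \<in> carrier (free_rep r V)"
  shows "spanned f"
proof -
  have "spanned (Poly_Mapping.single xs c)" if "length xs = r" "set xs \<subseteq> carrier V" for xs c
    using spanned_psmult[OF spanned_single[of "[]" xs], of c] that by (simp add: psmult_single)
  then have *: "spanned (Poly_Mapping.single xs (Poly_Mapping.lookup f xs))" if "xs \<in> Poly_Mapping.keys f" for xs
    using that assms by (auto simp: free_rep_carrier)
  have "spanned (\<Sum>xs\<in>A. Poly_Mapping.single xs (Poly_Mapping.lookup f xs))"
    if "finite A" "A \<subseteq> Poly_Mapping.keys f" for A
    using that
  proof (induction A rule: finite_induct)
    case (insert x A)
    then show ?case using spanned_add[OF *[of x]] by simp
  qed (simp add: spanned_rel tensor_rel_submodule(1))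
  from this[of "Poly_Mapping.keys f"] show ?thesis by (simp add: sum_single_lookup)
qed

text \<open>The coordinates vanish on the relations and separate the combinations of basis tensors,
  which span everything modulo the relations. The tensor power therefore has the expected
  basis.\<close>

lemma tensor_rel_eq: "tensor_rel r V = {f \<in> carrier (free_rep r V). \<forall>s. fcoord f s = 0}"
  unfolding tensor_rel_def
proof (rule gen_submodule_eq_kernel[where Y = "range comb", OF kmodule_free_rep lin_fcoord relations_kernel])
  show "range comb \<subseteq> carrier (free_rep r V)" using comb_closed by auto
  show "y = \<zero>\<^bsub>free_rep r V\<^esub>" if y: "y \<in> range comb" "\<forall>s. fcoord y s = 0" for y
  proof -
    obtain c where c: "y = comb c" using y(1) by blast
    then have "c s = 0" if "s \<in> T" for s using y(2) fcoord_comb[OF that, of c] by simp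
    then show ?thesis using comb_zero[of c] c by (simp add: free_rep_sel)
  qed
  show "\<exists>y\<in>range comb. f \<ominus>\<^bsub>free_rep r V\<^esub> y \<in> gen_submodule (free_rep r V) (multilinear_relations r V)"
    if "f \<in> carrier (free_rep r V)" for f
    using spanned_free[OF that] comb_closed
    by (auto simp: spanned_def free_rep_minus[OF that] tensor_rel_def)
qed

lemma fcoord_surj: "fcoord ` carrier (free_rep r V) = vecs T"
proof (intro equalityI subsetI)
  fix c :: "(nat \<Rightarrow> 'i) \<Rightarrow> 'k" assume "c \<in> vecs T"
  then have "c = fcoord (comb c)"
    using fcoord_comb[of _ c] by (auto simp: fun_eq_iff vecs_def fcoord_def)
  then show "c \<in> fcoord ` carrier (free_rep r V)" using comb_closed by blast
qed (use lin_fcoord in \<open>auto simp: lin_to_def\<close>)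

sublocale Q: kernel_quotient "free_rep r V" T fcoord "tensor_rel r V"
  by (rule kernel_quotient.intro[OF kmodule_free_rep finite_T lin_fcoord fcoord_surj tensor_rel_eq])

abbreviation "tcoord \<equiv> Q.quot_coord"

lemma coords_tensor: "coords (tensor_power r V) T tcoord"
  unfolding tensor_power_def by (rule Q.coords_quot)

lemma push_forward_closed:
  assumes "\<And>xs. length xs = r \<Longrightarrow> set xs \<subseteq> carrier V \<Longrightarrow> length (\<eta> xs) = r \<and> set (\<eta> xs) \<subseteq> carrier V"
    and "f \<in> carrier (free_rep r V)"
  shows "push_forward \<eta> f \<in> carrier (free_rep r V)"
  using assms keys_push_forward[of \<eta> f] unfolding free_rep_carrier by blast

text \<open>The Kronecker power of \<open>A\<close>: every factor is expanded in coordinates and the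
  product multiplied out.\<close>

lemma tensor_act:
  assumes a: "\<And>x. x \<in> carrier V \<Longrightarrow> act V g x \<in> carrier V"
    and A: "\<And>x i. x \<in> carrier V \<Longrightarrow> i \<in> I \<Longrightarrow> \<kappa> (act V g x) i = (\<Sum>j\<in>I. A i j * \<kappa> x j)"
    and w: "w \<in> carrier (tensor_power r V)"
  shows "act (tensor_power r V) g w \<in> carrier (tensor_power r V)"
    and "s \<in> T \<Longrightarrow> tcoord (act (tensor_power r V) g w) s = (\<Sum>t\<in>T. (\<Prod>k<r. A (s k) (t k)) * tcoord w t)"
proof -
  have closed: "act (free_rep r V) g f \<in> carrier (free_rep r V)" if "f \<in> carrier (free_rep r V)" for f
    using that unfolding free_rep_sel by (rule push_forward_closed[rotated]) (auto intro!: a)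
  have co: "fcoord (act (free_rep r V) g f) s = (\<Sum>t\<in>T. (\<Prod>k<r. A (s k) (t k)) * fcoord f t)"
    if f: "f \<in> carrier (free_rep r V)" and s: "s \<in> T" for f s
  proof -
    have "fcoord (act (free_rep r V) g f) s = lin_ext (\<lambda>xs. \<Prod>k<r. \<kappa> (map (act V g) xs ! k) (s k)) f"
      using s by (simp add: fcoord_def free_rep_sel lin_ext_push_forward)
    also have "\<dots> = lin_ext (\<lambda>xs. \<Sum>t\<in>T. (\<Prod>k<r. A (s k) (t k)) * (\<Prod>k<r. \<kappa> (xs ! k) (t k))) f"
    proof (rule lin_ext_cong)
      fix xs assume "xs \<in> Poly_Mapping.keys f"
      then have xs: "length xs = r" "set xs \<subseteq> carrier V" using f by (auto simp: free_rep_carrier)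
      have "(\<Prod>k<r. \<kappa> (map (act V g) xs ! k) (s k)) = (\<Prod>k<r. \<Sum>j\<in>I. A (s k) j * \<kappa> (xs ! k) j)"
      proof (intro prod.cong refl)
        fix k assume k: "k \<in> {..<r}"
        then have "xs ! k \<in> carrier V" using xs nth_mem[of k xs] by auto
        then show "\<kappa> (map (act V g) xs ! k) (s k) = (\<Sum>j\<in>I. A (s k) j * \<kappa> (xs ! k) j)"
          using k xs A[OF _ T_mem[OF s]] by simp
      qed
      also have "\<dots> = (\<Sum>t\<in>T. \<Prod>k<r. A (s k) (t k) * \<kappa> (xs ! k) (t k))"
        using finite_I by (intro prod_sum_PiE) auto
      finally show "(\<Prod>k<r. \<kappa> (map (act V g) xs ! k) (s k)) =
          (\<Sum>t\<in>T. (\<Prod>k<r. A (s k) (t k)) * (\<Prod>k<r. \<kappa> (xs ! k) (t k)))"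
        by (simp add: prod.distrib)
    qed
    also have "\<dots> = (\<Sum>t\<in>T. (\<Prod>k<r. A (s k) (t k)) * fcoord f t)"
      unfolding lin_ext_def sum_distrib_left
      by (subst sum.swap) (simp add: fcoord_def lin_ext_def sum_distrib_left mult.left_commute)
    finally show ?thesis .
  qed
  have compat: "fcoord (act (free_rep r V) g f) = fcoord (act (free_rep r V) g f')"
    if "f \<in> carrier (free_rep r V)" "f' \<in> carrier (free_rep r V)" "fcoord f = fcoord f'" for f f'
  proof
    fix s
    show "fcoord (act (free_rep r V) g f) s = fcoord (act (free_rep r V) g f') s"
      using co[OF that(1), of s] co[OF that(2), of s] that(3)
      by (cases "s \<in> T") (simp, simp add: fcoord_def)
  qed
  obtain f where f: "f \<in> carrier (free_rep r V)" "w = tensor_rel r V +>\<^bsub>free_rep r V\<^esub> f"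
    using w unfolding tensor_power_def Q.carrier_quot by blast
  have eq: "act (tensor_power r V) g w = tensor_rel r V +>\<^bsub>free_rep r V\<^esub> act (free_rep r V) g f"
    unfolding tensor_power_def f(2) by (rule Q.act_coset[OF closed compat f(1)])
  show "act (tensor_power r V) g w \<in> carrier (tensor_power r V)"
    unfolding eq unfolding tensor_power_def Q.carrier_quot using closed[OF f(1)] by (rule imageI)
  show "tcoord (act (tensor_power r V) g w) s = (\<Sum>t\<in>T. (\<Prod>k<r. A (s k) (t k)) * tcoord w t)" if "s \<in> T"
    unfolding eq unfolding f(2) Q.quot_coord_coset[OF closed[OF f(1)]] Q.quot_coord_coset[OF f(1)]
    by (rule co[OF f(1) that])
qed

text \<open>The inverse arises when \<open>\<sigma>\<close> moves from the factors of a tensor to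
  the index of its coordinates.\<close>

lemma place_perm:
  assumes \<sigma>: "\<sigma> permutes {..<r}" and w: "w \<in> carrier (tensor_power r V)"
  shows "place_perm r V \<sigma> w \<in> carrier (tensor_power r V)"
    and "tcoord (place_perm r V \<sigma> w) s = tcoord w (s \<circ> Hilbert_Choice.inv \<sigma>)"
proof -
  let ?p = "push_forward (permute_list \<sigma>) :: ('v list \<Rightarrow>\<^sub>0 'k) \<Rightarrow> _"
  have closed: "?p f \<in> carrier (free_rep r V)" if "f \<in> carrier (free_rep r V)" for f
    using that \<sigma> by (intro push_forward_closed) auto
  have T: "s \<circ> Hilbert_Choice.inv \<sigma> \<in> T \<longleftrightarrow> s \<in> T" for s
  proof
    assume "s \<circ> Hilbert_Choice.inv \<sigma> \<in> T"
    from tuples_permute[OF \<sigma> this] show "s \<in> T"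
      by (simp add: comp_assoc permutes_inv_o[OF \<sigma>])
  qed (rule tuples_permute[OF permutes_inv[OF \<sigma>]])
  have co: "fcoord (?p f) s = fcoord f (s \<circ> Hilbert_Choice.inv \<sigma>)" if f: "f \<in> carrier (free_rep r V)" for f s
  proof -
    have "lin_ext (\<lambda>xs. \<Prod>k<r. \<kappa> (permute_list \<sigma> xs ! k) (s k)) f =
        lin_ext (\<lambda>xs. \<Prod>k<r. \<kappa> (xs ! k) ((s \<circ> Hilbert_Choice.inv \<sigma>) k)) f"
      using f by (intro lin_ext_cong permute_coords_eq[OF \<sigma>]) (auto simp: free_rep_carrier)
    then show ?thesis using T[of s] by (simp add: fcoord_def lin_ext_push_forward)
  qed
  have compat: "fcoord (?p f) = fcoord (?p f')"
    if "f \<in> carrier (free_rep r V)" "f' \<in> carrier (free_rep r V)" "fcoord f = fcoord f'" for f f'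
    using that(3) by (intro ext) (simp add: co[OF that(1)] co[OF that(2)])
  obtain f where f: "f \<in> carrier (free_rep r V)" "w = tensor_rel r V +>\<^bsub>free_rep r V\<^esub> f"
    using w unfolding tensor_power_def Q.carrier_quot by blast
  have eq: "place_perm r V \<sigma> w = tensor_rel r V +>\<^bsub>free_rep r V\<^esub> ?p f"
    unfolding place_perm_def f(2) by (rule Q.coset_map_coset[OF closed compat f(1)])
  show "place_perm r V \<sigma> w \<in> carrier (tensor_power r V)"
    unfolding eq unfolding tensor_power_def Q.carrier_quot using closed[OF f(1)] by (rule imageI)
  show "tcoord (place_perm r V \<sigma> w) s = tcoord w (s \<circ> Hilbert_Choice.inv \<sigma>)"
    unfolding eq unfolding f(2) Q.quot_coord_coset[OF closed[OF f(1)]] Q.quot_coord_coset[OF f(1)]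
    by (rule co[OF f(1)])
qed

end

subsection \<open>Symmetric powers\<close>

lemma sum_unit_vec:
  fixes f :: "'i \<Rightarrow> 'k :: comm_semiring_1"
  assumes "finite I" "i \<in> I"
  shows "(\<Sum>j\<in>I. unit_vec i j * f j) = f i" "(\<Sum>j\<in>I. f j * unit_vec i j) = f i"
proof -
  have "(\<Sum>j\<in>I. unit_vec i j * f j) = (\<Sum>j\<in>I. if j = i then f j else 0)"
    by (intro sum.cong refl) (simp add: unit_vec_def)
  then show "(\<Sum>j\<in>I. unit_vec i j * f j) = f i" using assms by simp
  then show "(\<Sum>j\<in>I. f j * unit_vec i j) = f i" by (simp add: mult.commute)
qed

lemma coords_ex:
  assumes "coords M I \<kappa>" "c \<in> vecs I"
  obtains x where "x \<in> carrier M" "\<kappa> x = c"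
  using assms by (auto simp: coords_def bij_betw_def image_iff) (metis imageE)

definition rep_coords ::
    "'g monoid \<Rightarrow> ('g, 'k :: field, 'v) gmod \<Rightarrow> 'i set \<Rightarrow> ('g \<Rightarrow> 'i \<Rightarrow> 'i \<Rightarrow> 'k) \<Rightarrow> ('v \<Rightarrow> 'i \<Rightarrow> 'k) \<Rightarrow> bool" where
  "rep_coords G M I \<rho> \<kappa> \<longleftrightarrow> coords M I \<kappa> \<and> (\<forall>g\<in>carrier G. \<forall>x\<in>carrier M.
     act M g x \<in> carrier M \<and> (\<forall>i\<in>I. \<kappa> (act M g x) i = (\<Sum>j\<in>I. \<rho> g i j * \<kappa> x j)))"

lemma rep_coordsD:
  assumes "rep_coords G M I \<rho> \<kappa>"
  shows "coords M I \<kappa>"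
    and "g \<in> carrier G \<Longrightarrow> x \<in> carrier M \<Longrightarrow> act M g x \<in> carrier M"
    and "g \<in> carrier G \<Longrightarrow> x \<in> carrier M \<Longrightarrow> i \<in> I \<Longrightarrow> \<kappa> (act M g x) i = (\<Sum>j\<in>I. \<rho> g i j * \<kappa> x j)"
  using assms by (auto simp: rep_coords_def)

context tensor_coords
begin

abbreviation "TP \<equiv> tensor_power r V"

abbreviation "Ms \<equiv> multisets_of_size I r"

lemma finite_Ms: "finite Ms"
  using finite_I by (rule finite_multisets_of_size)

lemmas TP = coords_tensor
lemmas TP_mod = coordsD(1)[OF coords_tensor]
lemmas TP_lin = coordsD(3)[OF coords_tensor]
lemmas TP_coord = lin_toD(2,3)[OF TP_lin] lin_to_minus[OF TP_mod TP_lin] lin_to_zero[OF TP_mod TP_lin]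

lemma words_T: "\<mu> \<in> Ms \<Longrightarrow> s \<in> words \<mu> \<Longrightarrow> s \<in> T \<and> wtype r s = \<mu>"
  by (simp add: words_tuples)

lemma sum_permute_words:
  assumes "\<mu> \<in> Ms" "\<sigma> permutes {..<r}"
  shows "(\<Sum>s\<in>words \<mu>. f (s \<circ> \<sigma>)) = (\<Sum>s\<in>words \<mu>. f s)"
  using assms words_permute[of _ \<mu>]
  by (intro sum.reindex_bij_betw bij_betw_permute[where A = "{..<r}"]) (auto simp: multisets_of_sizeD)

section \<open>Upper symmetric powers as coinvariants\<close>

definition sym_rels :: "('v list \<Rightarrow>\<^sub>0 'k) set set" where
  "sym_rels = {place_perm r V \<sigma> w \<ominus>\<^bsub>TP\<^esub> w | \<sigma> w. \<sigma> permutes {..<r} \<and> w \<in> carrier TP}"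

text \<open>All basis tensors of an orbit become one monomial in the quotient, so the coefficient of
  that monomial is the sum of theirs.\<close>

definition ucoord :: "('v list \<Rightarrow>\<^sub>0 'k) set \<Rightarrow> 'i multiset \<Rightarrow> 'k" where
  "ucoord w \<mu> = (if \<mu> \<in> Ms then \<Sum>s\<in>words \<mu>. tcoord w s else 0)"

lemma lin_ucoord: "lin_to TP Ms ucoord"
  unfolding lin_to_def
  by (intro conjI ballI allI)
    (simp_all add: vecs_def ucoord_def TP_coord sum.distrib sum_distrib_left)

lemma sym_rels_kernel: "sym_rels \<subseteq> {w \<in> carrier TP. \<forall>\<mu>. ucoord w \<mu> = 0}"
proof
  interpret W: module "ring_of_type_algebra :: 'k ring" TP by (rule TP_mod)
  fix u assume "u \<in> sym_rels"
  then obtain \<sigma> w where u: "u = place_perm r V \<sigma> w \<ominus>\<^bsub>TP\<^esub> w" "\<sigma> permutes {..<r}" "w \<in> carrier TP"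
    unfolding sym_rels_def by blast
  note p = place_perm[OF u(2,3)]
  have "ucoord u \<mu> = 0" for \<mu>
    using sum_permute_words[of \<mu> "Hilbert_Choice.inv \<sigma>" "tcoord w"] permutes_inv[OF u(2)]
    by (simp add: ucoord_def u(1) TP_coord p u(3) sum_subtractf)
  moreover have "u \<in> carrier TP" using u(1,3) p by simp
  ultimately show "u \<in> {w \<in> carrier TP. \<forall>\<mu>. ucoord w \<mu> = 0}" by simp
qed

lemma gen_sym_rels: "gen_submodule TP sym_rels = {w \<in> carrier TP. \<forall>\<mu>. ucoord w \<mu> = 0}"
proof -
  interpret W: module "ring_of_type_algebra :: 'k ring" TP by (rule TP_mod)
  let ?H = "gen_submodule TP sym_rels"
  \<comment> \<open>Normal forms: the tensors supported on the chosen words, one for each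
    orbit.\<close>
  let ?Y = "{y \<in> carrier TP. \<forall>s\<in>T. tcoord y s \<noteq> 0 \<longrightarrow> s = word (wtype r s)}"
  have S: "sym_rels \<subseteq> carrier TP" using sym_rels_kernel by blast
  note H = gen_submodule[OF TP_mod S]
  note H_add = W.submoduleE(5)[OF H(1)] and H_smult = W.submoduleE(4)[OF H(1)]
  have H_zero: "\<zero>\<^bsub>TP\<^esub> \<in> ?H"
    using subgroup.one_closed[OF submodule.axioms(1)[OF H(1)]] by simp
  show ?thesis
  proof (rule gen_submodule_eq_kernel[where Y = ?Y, OF TP_mod lin_ucoord sym_rels_kernel])
    show "?Y \<subseteq> carrier TP" by blast
  next
    fix y assume y: "y \<in> ?Y" "\<forall>\<mu>. ucoord y \<mu> = 0"
    have Y: "s = word (wtype r s)" if "s \<in> T" "tcoord y s \<noteq> 0" for s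
      using y(1) that by blast
    have "tcoord y s = 0" if s: "s \<in> T" for s
    proof (rule ccontr)
      assume nz: "tcoord y s \<noteq> 0"
      let ?\<mu> = "wtype r s"
      have \<mu>: "?\<mu> \<in> Ms" "s \<in> words ?\<mu>" using tuples_words[OF s] by auto
      \<comment> \<open>In a normal form only the chosen word contributes to the sum over an
        orbit.\<close>
      have "(\<Sum>t\<in>words ?\<mu>. tcoord y t) = (\<Sum>t\<in>{s}. tcoord y t)"
      proof (rule sum.mono_neutral_right)
        show "\<forall>t\<in>words ?\<mu> - {s}. tcoord y t = 0"
        proof
          fix t assume t: "t \<in> words ?\<mu> - {s}"
          then have "t \<in> T" "wtype r t = ?\<mu>" using words_T[OF \<mu>(1)] by auto
          show "tcoord y t = 0"
          proof (rule ccontr)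
            assume "tcoord y t \<noteq> 0"
            then have "t = word ?\<mu>" using Y[OF \<open>t \<in> T\<close>] \<open>wtype r t = ?\<mu>\<close> by simp
            moreover have "s = word ?\<mu>" by (rule Y[OF s nz])
            ultimately show False using t by simp
          qed
        qed
      qed (use \<mu> in auto)
      moreover have "(\<Sum>t\<in>words ?\<mu>. tcoord y t) = 0" using y(2) \<mu> by (metis ucoord_def)
      ultimately show False using nz by simp
    qed
    then show "y = \<zero>\<^bsub>TP\<^esub>" using y(1) by (intro coords_eqI[OF TP]) (auto simp: TP_coord)
  next
    fix x assume "x \<in> carrier TP"
    with TP show "\<exists>y\<in>?Y. x \<ominus>\<^bsub>TP\<^esub> y \<in> ?H"
    proof (induction rule: coords_induct)
      case zero
      have "\<zero>\<^bsub>TP\<^esub> \<ominus>\<^bsub>TP\<^esub> \<zero>\<^bsub>TP\<^esub> = \<zero>\<^bsub>TP\<^esub>" by (rule coords_eqI[OF TP]) (simp_all add: TP_coord)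
      then show ?case using H_zero by (intro bexI[of _ "\<zero>\<^bsub>TP\<^esub>"]) (simp_all add: TP_coord)
    next
      case (add u v)
      then obtain y z where yz: "y \<in> ?Y" "u \<ominus>\<^bsub>TP\<^esub> y \<in> ?H" "z \<in> ?Y" "v \<ominus>\<^bsub>TP\<^esub> z \<in> ?H" by blast
      have eq: "(u \<oplus>\<^bsub>TP\<^esub> v) \<ominus>\<^bsub>TP\<^esub> (y \<oplus>\<^bsub>TP\<^esub> z) = (u \<ominus>\<^bsub>TP\<^esub> y) \<oplus>\<^bsub>TP\<^esub> (v \<ominus>\<^bsub>TP\<^esub> z)"
        using add yz by (intro coords_eqI[OF TP]) (simp_all add: TP_coord)
      have "tcoord (y \<oplus>\<^bsub>TP\<^esub> z) s \<noteq> 0 \<longrightarrow> s = word (wtype r s)" if "s \<in> T" for s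
        using yz that by (simp add: TP_coord) (metis add.right_neutral)
      then have "y \<oplus>\<^bsub>TP\<^esub> z \<in> ?Y" using yz by simp
      moreover have "(u \<oplus>\<^bsub>TP\<^esub> v) \<ominus>\<^bsub>TP\<^esub> (y \<oplus>\<^bsub>TP\<^esub> z) \<in> ?H" unfolding eq by (rule H_add[OF yz(2,4)])
      ultimately show ?case by (rule rev_bexI)
    next
      case (smult c u)
      then obtain y where y: "y \<in> ?Y" "u \<ominus>\<^bsub>TP\<^esub> y \<in> ?H" by blast
      have eq: "(c \<odot>\<^bsub>TP\<^esub> u) \<ominus>\<^bsub>TP\<^esub> (c \<odot>\<^bsub>TP\<^esub> y) = c \<odot>\<^bsub>TP\<^esub> (u \<ominus>\<^bsub>TP\<^esub> y)"
        using smult y by (intro coords_eqI[OF TP]) (simp_all add: TP_coord right_diff_distrib)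
      have "c \<odot>\<^bsub>TP\<^esub> y \<in> ?Y" using y by (simp add: TP_coord)
      moreover have "(c \<odot>\<^bsub>TP\<^esub> u) \<ominus>\<^bsub>TP\<^esub> (c \<odot>\<^bsub>TP\<^esub> y) \<in> ?H"
        unfolding eq by (rule H_smult[OF _ y(2)]) simp
      ultimately show ?case by (rule rev_bexI)
    next
      case (basis s)
      let ?\<mu> = "wtype r s"
      have \<mu>: "?\<mu> \<in> Ms" "s \<in> words ?\<mu>" using tuples_words[OF basis] by auto
      let ?t = "word ?\<mu>"
      have t: "?t \<in> T" "wtype r ?t = ?\<mu>" using words_T[OF \<mu>(1) word_words] by auto
      obtain \<sigma> where \<sigma>: "\<sigma> permutes {..<r}" "s = ?t \<circ> \<sigma>"
        using ex_permute[OF word_words \<mu>(2)] by auto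
      let ?e = "basis_vec TP tcoord"
      note es = basis_vec[OF TP basis] and et = basis_vec[OF TP t(1)]
      \<comment> \<open>A basis tensor differs from the chosen one of its orbit by a generating
        relation.\<close>
      have "place_perm r V \<sigma> (?e ?t) = ?e s"
      proof (rule coords_eqI[OF TP place_perm(1)[OF \<sigma>(1) et(1)] es(1)])
        fix u
        have "u \<circ> Hilbert_Choice.inv \<sigma> = ?t \<longleftrightarrow> u = s"
        proof
          assume "u \<circ> Hilbert_Choice.inv \<sigma> = ?t"
          then have "u \<circ> Hilbert_Choice.inv \<sigma> \<circ> \<sigma> = s" using \<sigma>(2) by simp
          then show "u = s" by (simp add: comp_assoc permutes_inv_o[OF \<sigma>(1)])
        next
          assume "u = s"
          then have u: "u = ?t \<circ> \<sigma>" using \<sigma>(2) by (rule trans)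
          show "u \<circ> Hilbert_Choice.inv \<sigma> = ?t"
            unfolding u comp_assoc permutes_inv_o(1)[OF \<sigma>(1)] by simp
        qed
        then show "tcoord (place_perm r V \<sigma> (?e ?t)) u = tcoord (?e s) u"
          unfolding place_perm(2)[OF \<sigma>(1) et(1)] et(2) es(2) by (simp add: unit_vec_def)
      qed
      then have "?e s \<ominus>\<^bsub>TP\<^esub> ?e ?t \<in> sym_rels"
        unfolding sym_rels_def using \<sigma>(1) et(1) by (intro CollectI exI[of _ \<sigma>] exI[of _ "?e ?t"]) simp
      then have "?e s \<ominus>\<^bsub>TP\<^esub> ?e ?t \<in> ?H" using H(2) by blast
      moreover have "?e ?t \<in> ?Y" using et t(2) by (simp add: unit_vec_def)
      ultimately show ?case by (rule_tac rev_bexI)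
    qed
  qed
qed

lemma ucoord_surj: "ucoord ` carrier TP = vecs Ms"
proof (intro equalityI subsetI)
  fix c :: "'i multiset \<Rightarrow> 'k" assume c: "c \<in> vecs Ms"
  let ?d = "\<lambda>s. if s \<in> T \<and> s = word (wtype r s) then c (wtype r s) else 0"
  have "?d \<in> vecs T" by (simp add: vecs_def)
  from coords_ex[OF TP this] obtain w where w: "w \<in> carrier TP" "tcoord w = ?d" .
  have "ucoord w \<mu> = c \<mu>" for \<mu>
  proof (cases "\<mu> \<in> Ms")
    case True
    have t: "word \<mu> \<in> T" "wtype r (word \<mu>) = \<mu>" using words_T[OF True word_words] by auto
    have "(\<Sum>s\<in>words \<mu>. ?d s) = (\<Sum>s\<in>{word \<mu>}. ?d s)"
      using words_T[OF True] by (intro sum.mono_neutral_right) (auto simp: word_words)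
    then show ?thesis using True t by (simp add: ucoord_def w)
  next
    case False
    then show ?thesis using c by (simp add: ucoord_def vecs_def)
  qed
  then have "c = ucoord w" by auto
  then show "c \<in> ucoord ` carrier TP" using w by blast
qed (use lin_ucoord in \<open>auto simp: lin_to_def\<close>)

sublocale S: kernel_quotient TP Ms ucoord "gen_submodule TP sym_rels"
  by (rule kernel_quotient.intro[OF TP_mod finite_Ms lin_ucoord ucoord_surj gen_sym_rels])

text \<open>Summed over the rows of an orbit, the Kronecker power depends on the orbit of the column
  only, by \<open>symU_word\<close>; this is why it descends to the quotient.\<close>

lemma rep_coords_upper_sym:
  assumes \<rho>: "rep_coords G V I \<rho> \<kappa>"
  shows "rep_coords G (Sym\<^sup>U r V) Ms (\<lambda>g. symU (\<rho> g)) S.quot_coord"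
proof -
  have U: "Sym\<^sup>U r V = quot_rep TP (gen_submodule TP sym_rels)"
    by (simp add: upper_sym_def sym_rels_def)
  show ?thesis
    unfolding rep_coords_def
  proof (intro conjI ballI)
    show "coords (Sym\<^sup>U r V) Ms S.quot_coord" unfolding U by (rule S.coords_quot)
  next
    fix g x assume g: "g \<in> carrier G" and x: "x \<in> carrier (Sym\<^sup>U r V)"
    have act: "act TP g w \<in> carrier TP"
        "s \<in> T \<Longrightarrow> tcoord (act TP g w) s = (\<Sum>t\<in>T. (\<Prod>k<r. \<rho> g (s k) (t k)) * tcoord w t)"
      if "w \<in> carrier TP" for w s
      using tensor_act[of g "\<rho> g" w] rep_coordsD(2,3)[OF \<rho> g] that by blast+
    have co: "ucoord (act TP g w) \<mu> = (\<Sum>\<nu>\<in>Ms. symU (\<rho> g) \<mu> \<nu> * ucoord w \<nu>)"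
      if w: "w \<in> carrier TP" and \<mu>: "\<mu> \<in> Ms" for w \<mu>
    proof -
      have "ucoord (act TP g w) \<mu> = (\<Sum>s\<in>words \<mu>. \<Sum>t\<in>T. (\<Prod>k<r. \<rho> g (s k) (t k)) * tcoord w t)"
        using \<mu> words_T[OF \<mu>] by (simp add: ucoord_def act(2)[OF w])
      also have "\<dots> = (\<Sum>t\<in>T. \<Sum>s\<in>words \<mu>. (\<Prod>k<r. \<rho> g (s k) (t k)) * tcoord w t)"
        by (rule sum.swap)
      also have "\<dots> = (\<Sum>\<nu>\<in>Ms. \<Sum>t\<in>words \<nu>. \<Sum>s\<in>words \<mu>. (\<Prod>k<r. \<rho> g (s k) (t k)) * tcoord w t)"
        by (rule sum_words[OF finite_I, symmetric])
      also have "\<dots> = (\<Sum>\<nu>\<in>Ms. symU (\<rho> g) \<mu> \<nu> * ucoord w \<nu>)"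
      proof (intro sum.cong refl)
        fix \<nu> assume \<nu>: "\<nu> \<in> Ms"
        have "(\<Sum>s\<in>words \<mu>. (\<Prod>k<r. \<rho> g (s k) (t k)) * tcoord w t) = symU (\<rho> g) \<mu> \<nu> * tcoord w t"
          if "t \<in> words \<nu>" for t
          using symU_word[OF that, of \<mu> "\<rho> g"] \<mu> \<nu> by (simp add: multisets_of_sizeD sum_distrib_right)
        then show "(\<Sum>t\<in>words \<nu>. \<Sum>s\<in>words \<mu>. (\<Prod>k<r. \<rho> g (s k) (t k)) * tcoord w t) =
            symU (\<rho> g) \<mu> \<nu> * ucoord w \<nu>"
          using \<nu> by (simp add: ucoord_def sum_distrib_left)
      qed
      finally show ?thesis .
    qed
    have compat: "ucoord (act TP g w) = ucoord (act TP g w')"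
      if "w \<in> carrier TP" "w' \<in> carrier TP" "ucoord w = ucoord w'" for w w'
    proof
      fix \<mu>
      show "ucoord (act TP g w) \<mu> = ucoord (act TP g w') \<mu>"
        using co[OF that(1), of \<mu>] co[OF that(2), of \<mu>] that(3)
        by (cases "\<mu> \<in> Ms") (simp, simp add: ucoord_def)
    qed
    let ?H = "gen_submodule TP sym_rels"
    obtain w where w: "w \<in> carrier TP" "x = ?H +>\<^bsub>TP\<^esub> w"
      using x unfolding U S.carrier_quot by blast
    have eq: "act (Sym\<^sup>U r V) g x = ?H +>\<^bsub>TP\<^esub> act TP g w"
      unfolding U unfolding w(2) by (rule S.act_coset[OF act(1) compat w(1)])
    show "act (Sym\<^sup>U r V) g x \<in> carrier (Sym\<^sup>U r V)"
      unfolding eq unfolding U S.carrier_quot using act(1)[OF w(1)] by (rule imageI)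
    show "S.quot_coord (act (Sym\<^sup>U r V) g x) \<mu> = (\<Sum>\<nu>\<in>Ms. symU (\<rho> g) \<mu> \<nu> * S.quot_coord x \<nu>)"
      if "\<mu> \<in> Ms" for \<mu>
      unfolding eq unfolding w(2) S.quot_coord_coset[OF act(1)[OF w(1)]] S.quot_coord_coset[OF w(1)]
      by (rule co[OF w(1) that])
  qed
qed

section \<open>Lower symmetric powers as invariants\<close>

definition lcoord :: "('v list \<Rightarrow>\<^sub>0 'k) set \<Rightarrow> 'i multiset \<Rightarrow> 'k" where
  "lcoord w \<mu> = (if \<mu> \<in> Ms then tcoord w (word \<mu>) else 0)"

lemma lower_sym_sel:
  "add (Sym\<^sub>L r V) = add TP" "ring.zero (Sym\<^sub>L r V) = \<zero>\<^bsub>TP\<^esub>"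
  "module.smult (Sym\<^sub>L r V) = module.smult TP" "act (Sym\<^sub>L r V) = act TP"
  by (simp_all add: lower_sym_def)

lemma lower_sym_carrier:
  "w \<in> carrier (Sym\<^sub>L r V) \<longleftrightarrow> w \<in> carrier TP \<and>
    (\<forall>\<sigma>. \<sigma> permutes {..<r} \<longrightarrow> (\<forall>s\<in>T. tcoord w (s \<circ> \<sigma>) = tcoord w s))"
proof -
  have "place_perm r V \<sigma> w = w \<longleftrightarrow> (\<forall>s\<in>T. tcoord w (s \<circ> Hilbert_Choice.inv \<sigma>) = tcoord w s)"
    if "w \<in> carrier TP" "\<sigma> permutes {..<r}" for \<sigma>
    using place_perm[OF that(2,1)] coords_eqI[OF TP place_perm(1)[OF that(2,1)] that(1)] by metis
  then have "w \<in> carrier (Sym\<^sub>L r V) \<longleftrightarrow> w \<in> carrier TP \<and>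
    (\<forall>\<sigma>. \<sigma> permutes {..<r} \<longrightarrow> (\<forall>s\<in>T. tcoord w (s \<circ> Hilbert_Choice.inv \<sigma>) = tcoord w s))"
    by (auto simp: lower_sym_def)
  \<comment> \<open>With \<open>\<sigma>\<close> its inverse also runs over all
    permutations.\<close>
  then show ?thesis by (metis permutes_inv permutes_inv_inv)
qed

text \<open>The coefficients of an invariant tensor are constant on orbits; reading them off at the
  chosen words gives its coordinates with respect to the orbit sums.\<close>

lemma lower_sym_coord:
  assumes "w \<in> carrier (Sym\<^sub>L r V)" "s \<in> T"
  shows "tcoord w s = lcoord w (wtype r s)"
proof -
  have \<mu>: "wtype r s \<in> Ms" "s \<in> words (wtype r s)" using tuples_words[OF assms(2)] by auto
  obtain \<sigma> where "\<sigma> permutes {..<r}" "word (wtype r s) = s \<circ> \<sigma>"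
    using ex_permute[OF \<mu>(2) word_words] by auto
  then show ?thesis using assms \<mu>(1) by (simp add: lower_sym_carrier lcoord_def)
qed

lemma coords_lower_sym: "coords (Sym\<^sub>L r V) Ms lcoord"
proof (rule coordsI)
  interpret W: module "ring_of_type_algebra :: 'k ring" TP by (rule TP_mod)
  have sub: "w \<in> carrier TP" if "w \<in> carrier (Sym\<^sub>L r V)" for w
    using that by (simp add: lower_sym_carrier)
  show "finite Ms" by (rule finite_Ms)
  show "lin_to (Sym\<^sub>L r V) Ms lcoord"
    unfolding lin_to_def
    by (intro conjI ballI allI) (simp_all add: vecs_def lcoord_def lower_sym_sel TP_coord sub)
  show "x \<oplus>\<^bsub>Sym\<^sub>L r V\<^esub> y \<in> carrier (Sym\<^sub>L r V)"
    if "x \<in> carrier (Sym\<^sub>L r V)" "y \<in> carrier (Sym\<^sub>L r V)" for x y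
    using that by (simp add: lower_sym_carrier lower_sym_sel TP_coord)
  show "c \<odot>\<^bsub>Sym\<^sub>L r V\<^esub> x \<in> carrier (Sym\<^sub>L r V)" if "x \<in> carrier (Sym\<^sub>L r V)" for c x
    using that by (simp add: lower_sym_carrier lower_sym_sel TP_coord)
  show "\<zero>\<^bsub>Sym\<^sub>L r V\<^esub> \<in> carrier (Sym\<^sub>L r V)" "lcoord \<zero>\<^bsub>Sym\<^sub>L r V\<^esub> \<mu> = 0" for \<mu>
    by (simp_all add: lower_sym_carrier lower_sym_sel TP_coord lcoord_def)
  show "bij_betw lcoord (carrier (Sym\<^sub>L r V)) (vecs Ms)"
  proof (rule bij_betw_imageI)
    show "inj_on lcoord (carrier (Sym\<^sub>L r V))"
      by (intro inj_onI coords_eqI[OF TP]) (simp_all add: sub lower_sym_coord)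
    show "lcoord ` carrier (Sym\<^sub>L r V) = vecs Ms"
    proof (intro equalityI subsetI)
      fix c :: "'i multiset \<Rightarrow> 'k" assume c: "c \<in> vecs Ms"
      let ?d = "\<lambda>s. if s \<in> T then c (wtype r s) else 0"
      have "?d \<in> vecs T" by (simp add: vecs_def)
      from coords_ex[OF TP this] obtain w where w: "w \<in> carrier TP" "tcoord w = ?d" .
      have "s \<circ> \<sigma> \<in> T" if "\<sigma> permutes {..<r}" "s \<in> T" for s \<sigma>
        by (rule tuples_permute[OF that])
      then have "w \<in> carrier (Sym\<^sub>L r V)"
        using w by (simp add: lower_sym_carrier wtype_permute)
      moreover have "c = lcoord w"
        using c words_T[OF _ word_words] by (auto simp: lcoord_def w vecs_def fun_eq_iff)
      ultimately show "c \<in> lcoord ` carrier (Sym\<^sub>L r V)" by blast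
    qed (auto simp: vecs_def lcoord_def)
  qed
qed

lemma rep_coords_lower_sym:
  assumes \<rho>: "rep_coords G V I \<rho> \<kappa>"
  shows "rep_coords G (Sym\<^sub>L r V) Ms (\<lambda>g. symL (\<rho> g)) lcoord"
  unfolding rep_coords_def
proof (intro conjI ballI)
  show "coords (Sym\<^sub>L r V) Ms lcoord" by (rule coords_lower_sym)
next
  fix g w assume g: "g \<in> carrier G" and w: "w \<in> carrier (Sym\<^sub>L r V)"
  then have wT: "w \<in> carrier TP" by (simp add: lower_sym_carrier)
  have act: "act TP g w \<in> carrier TP"
      "s \<in> T \<Longrightarrow> tcoord (act TP g w) s = (\<Sum>t\<in>T. (\<Prod>k<r. \<rho> g (s k) (t k)) * tcoord w t)" for s
    using tensor_act[of g "\<rho> g" w] rep_coordsD(2,3)[OF \<rho> g] wT by blast+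
  have "tcoord (act TP g w) (s \<circ> \<sigma>) = tcoord (act TP g w) s"
    if \<sigma>: "\<sigma> permutes {..<r}" and s: "s \<in> T" for \<sigma> s
  proof -
    have inv: "Hilbert_Choice.inv \<sigma> permutes {..<r}" using \<sigma> by (rule permutes_inv)
    have s\<sigma>: "s \<circ> \<sigma> \<in> T" by (rule tuples_permute[OF \<sigma> s])
    have "tcoord (act TP g w) (s \<circ> \<sigma>) = (\<Sum>t\<in>T. (\<Prod>k<r. \<rho> g ((s \<circ> \<sigma>) k) (t k)) * tcoord w t)"
      by (rule act(2)[OF s\<sigma>])
    \<comment> \<open>Permuting both words at once does not change the product, and \<open>w\<close>
      is invariant.\<close>
    also have "\<dots> = (\<Sum>t\<in>T. (\<Prod>k<r. \<rho> g ((s \<circ> \<sigma>) k) ((t \<circ> \<sigma>) k)) * tcoord w (t \<circ> \<sigma>))"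
      by (rule sum.reindex_bij_betw[OF bij_betw_permute[OF \<sigma>, of T], symmetric])
        (rule tuples_permute)
    also have "\<dots> = (\<Sum>t\<in>T. (\<Prod>k<r. \<rho> g (s k) (t k)) * tcoord w t)"
    proof (intro sum.cong refl)
      fix t assume "t \<in> T"
      then have "tcoord w (t \<circ> \<sigma>) = tcoord w t" using w \<sigma> by (simp add: lower_sym_carrier)
      moreover have "(\<Prod>k<r. \<rho> g (s k) (t k)) = (\<Prod>k<r. \<rho> g ((s \<circ> \<sigma>) k) ((t \<circ> \<sigma>) k))"
        by (subst prod.permute[OF \<sigma>]) (simp add: o_def)
      ultimately show "(\<Prod>k<r. \<rho> g ((s \<circ> \<sigma>) k) ((t \<circ> \<sigma>) k)) * tcoord w (t \<circ> \<sigma>) =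
          (\<Prod>k<r. \<rho> g (s k) (t k)) * tcoord w t" by simp
    qed
    also have "\<dots> = tcoord (act TP g w) s" by (rule act(2)[OF s, symmetric])
    finally show ?thesis .
  qed
  then show "act (Sym\<^sub>L r V) g w \<in> carrier (Sym\<^sub>L r V)"
    using act(1) by (simp add: lower_sym_carrier lower_sym_sel)
  fix \<mu> assume \<mu>: "\<mu> \<in> Ms"
  have t: "word \<mu> \<in> T" "size \<mu> = r" using words_T[OF \<mu> word_words] \<mu> by (auto simp: multisets_of_sizeD)
  have "lcoord (act (Sym\<^sub>L r V) g w) \<mu> = (\<Sum>t\<in>T. (\<Prod>k<r. \<rho> g (word \<mu> k) (t k)) * tcoord w t)"
    using \<mu> act(2)[OF t(1)] by (simp add: lower_sym_sel lcoord_def)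
  also have "\<dots> = (\<Sum>\<nu>\<in>Ms. \<Sum>t\<in>words \<nu>. (\<Prod>k<r. \<rho> g (word \<mu> k) (t k)) * tcoord w t)"
    by (rule sum_words[OF finite_I, symmetric])
  also have "\<dots> = (\<Sum>\<nu>\<in>Ms. \<Sum>t\<in>words \<nu>. (\<Prod>k<r. \<rho> g (word \<mu> k) (t k)) * lcoord w \<nu>)"
    using words_T by (intro sum.cong refl) (simp add: lower_sym_coord[OF w])
  also have "\<dots> = (\<Sum>\<nu>\<in>Ms. symL (\<rho> g) \<mu> \<nu> * lcoord w \<nu>)"
    by (simp add: symL_def t(2) sum_distrib_right)
  finally show "lcoord (act (Sym\<^sub>L r V) g w) \<mu> = (\<Sum>\<nu>\<in>Ms. symL (\<rho> g) \<mu> \<nu> * lcoord w \<nu>)" .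
qed

end

subsection \<open>Duals\<close>

lemma linear_expansion:
  fixes M :: "('g, 'k :: field, 'v) gmod" and \<phi> :: "'v \<Rightarrow> 'k"
  assumes M: "coords M I \<kappa>" and x: "x \<in> carrier M"
    and add: "\<And>x y. x \<in> carrier M \<Longrightarrow> y \<in> carrier M \<Longrightarrow> \<phi> (x \<oplus>\<^bsub>M\<^esub> y) = \<phi> x + \<phi> y"
    and smult: "\<And>c x. x \<in> carrier M \<Longrightarrow> \<phi> (c \<odot>\<^bsub>M\<^esub> x) = c * \<phi> x"
  shows "\<phi> x = (\<Sum>i\<in>I. \<kappa> x i * \<phi> (basis_vec M \<kappa> i))"
  using M x
proof (induction rule: coords_induct)
  case zero
  interpret V: module "ring_of_type_algebra :: 'k ring" M by (rule coordsD(1)[OF M])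
  have "\<phi> \<zero>\<^bsub>M\<^esub> = \<phi> \<zero>\<^bsub>M\<^esub> + \<phi> \<zero>\<^bsub>M\<^esub>" using add[of "\<zero>\<^bsub>M\<^esub>" "\<zero>\<^bsub>M\<^esub>"] by simp
  then have "\<phi> \<zero>\<^bsub>M\<^esub> = 0" by (metis add_cancel_right_right)
  then show ?case by (simp add: lin_to_zero[OF coordsD(1,3)[OF M]])
next
  case (add x y)
  then show ?case
    by (simp add: assms(3) lin_toD(2)[OF coordsD(3)[OF M]] distrib_right sum.distrib)
next
  case (smult c x)
  then show ?case
    by (simp add: assms(4) lin_toD(3)[OF coordsD(3)[OF M]] sum_distrib_left mult.assoc)
next
  case (basis i)
  then show ?case
    by (simp add: basis_vec(2)[OF M basis] sum_unit_vec[OF coordsD(2)[OF M] basis])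
qed

text \<open>The values of a functional on the basis are its coefficients in the dual basis, where
  the contragredient action is the transposed inverse.\<close>

lemma rep_coords_dual:
  fixes M :: "('g, 'k :: field, 'v) gmod" and I :: "'i set"
  assumes M: "rep_coords G M I \<rho> \<kappa>" and G: "group G"
  shows "rep_coords G (dual_rep G M) I (\<lambda>g i j. \<rho> (inv\<^bsub>G\<^esub> g) j i)
    (\<lambda>\<phi> i. if i \<in> I then \<phi> (basis_vec M \<kappa> i) else 0)" (is "rep_coords _ ?D _ _ ?\<kappa>")
proof -
  note C = rep_coordsD(1)[OF M]
  note b = basis_vec[OF C]
  note closed = coords_closed[OF C]
  note lin = lin_toD[OF coordsD(3)[OF C]]
  have carrier: "\<phi> \<in> carrier ?D \<longleftrightarrow> \<phi> \<in> extensional (carrier M) \<and>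
       (\<forall>x\<in>carrier M. \<forall>y\<in>carrier M. \<phi> (x \<oplus>\<^bsub>M\<^esub> y) = \<phi> x + \<phi> y) \<and>
       (\<forall>c. \<forall>x\<in>carrier M. \<phi> (c \<odot>\<^bsub>M\<^esub> x) = c * \<phi> x)" for \<phi>
    by (simp add: dual_rep_def)
  have expand: "\<phi> x = (\<Sum>i\<in>I. \<kappa> x i * \<phi> (basis_vec M \<kappa> i))" if "\<phi> \<in> carrier ?D" "x \<in> carrier M" for \<phi> x
    using linear_expansion[OF C that(2), of \<phi>] that(1) unfolding carrier by blast
  have sel: "\<phi> \<oplus>\<^bsub>?D\<^esub> \<psi> = (\<lambda>x\<in>carrier M. \<phi> x + \<psi> x)" "c \<odot>\<^bsub>?D\<^esub> \<phi> = (\<lambda>x\<in>carrier M. c * \<phi> x)"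
    "\<zero>\<^bsub>?D\<^esub> = (\<lambda>x\<in>carrier M. 0)" "act ?D g \<phi> = (\<lambda>x\<in>carrier M. \<phi> (act M (inv\<^bsub>G\<^esub> g) x))" for \<phi> \<psi> c g
    by (simp_all add: dual_rep_def)
  have ext: "\<phi> = \<psi>" if "\<phi> \<in> carrier ?D" "\<psi> \<in> carrier ?D" "\<And>x. x \<in> carrier M \<Longrightarrow> \<phi> x = \<psi> x" for \<phi> \<psi>
    using that by (intro extensionalityI[of _ "carrier M"]) (simp_all add: carrier)
  have coords: "coords ?D I ?\<kappa>"
  proof (rule coordsI)
    show "finite I" by (rule coordsD(2)[OF C])
    show "lin_to ?D I ?\<kappa>"
      unfolding lin_to_def by (intro conjI ballI allI) (simp_all add: vecs_def sel b)
    show "\<phi> \<oplus>\<^bsub>?D\<^esub> \<psi> \<in> carrier ?D" if "\<phi> \<in> carrier ?D" "\<psi> \<in> carrier ?D" for \<phi> \<psi>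
      using that unfolding carrier sel by (simp add: closed algebra_simps)
    show "c \<odot>\<^bsub>?D\<^esub> \<phi> \<in> carrier ?D" if "\<phi> \<in> carrier ?D" for \<phi> c
      using that unfolding carrier sel by (simp add: closed algebra_simps)
    show "\<zero>\<^bsub>?D\<^esub> \<in> carrier ?D" unfolding carrier sel by (simp add: closed)
    show "?\<kappa> \<zero>\<^bsub>?D\<^esub> i = 0" for i by (simp add: sel b)
    show "bij_betw ?\<kappa> (carrier ?D) (vecs I)"
    proof (rule bij_betw_imageI)
      show "inj_on ?\<kappa> (carrier ?D)"
      proof (rule inj_onI)
        fix \<phi> \<psi> assume *: "\<phi> \<in> carrier ?D" "\<psi> \<in> carrier ?D" "?\<kappa> \<phi> = ?\<kappa> \<psi>"
        have "\<phi> (basis_vec M \<kappa> i) = \<psi> (basis_vec M \<kappa> i)" if "i \<in> I" for i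
          using fun_cong[OF *(3), of i] that by simp
        then show "\<phi> = \<psi>" using * by (intro ext) (simp_all add: expand)
      qed
      show "?\<kappa> ` carrier ?D = vecs I"
      proof (intro equalityI subsetI)
        fix c :: "'i \<Rightarrow> 'k" assume c: "c \<in> vecs I"
        let ?\<phi> = "\<lambda>x\<in>carrier M. \<Sum>i\<in>I. \<kappa> x i * c i"
        have "?\<phi> \<in> carrier ?D"
          unfolding carrier by (simp add: closed lin distrib_right sum.distrib sum_distrib_left mult.assoc)
        moreover have "c = ?\<kappa> ?\<phi>"
          using c by (auto simp: fun_eq_iff vecs_def b sum_unit_vec[OF coordsD(2)[OF C]])
        ultimately show "c \<in> ?\<kappa> ` carrier ?D" by blast
      qed (auto simp: vecs_def)
    qed
  qed
  have "act ?D g \<phi> \<in> carrier ?D \<and> (\<forall>i\<in>I. ?\<kappa> (act ?D g \<phi>) i = (\<Sum>j\<in>I. \<rho> (inv\<^bsub>G\<^esub> g) j i * ?\<kappa> \<phi> j))"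
    if g: "g \<in> carrier G" and \<phi>: "\<phi> \<in> carrier ?D" for g \<phi>
  proof
    have ig: "inv\<^bsub>G\<^esub> g \<in> carrier G" using group.inv_closed[OF G g] .
    note A = rep_coordsD(2,3)[OF M ig]
    have A_add: "act M (inv\<^bsub>G\<^esub> g) (x \<oplus>\<^bsub>M\<^esub> y) = act M (inv\<^bsub>G\<^esub> g) x \<oplus>\<^bsub>M\<^esub> act M (inv\<^bsub>G\<^esub> g) y"
      if "x \<in> carrier M" "y \<in> carrier M" for x y
      using that by (intro coords_eqI[OF C]) (simp_all add: A closed lin distrib_left sum.distrib)
    have A_smult: "act M (inv\<^bsub>G\<^esub> g) (c \<odot>\<^bsub>M\<^esub> x) = c \<odot>\<^bsub>M\<^esub> act M (inv\<^bsub>G\<^esub> g) x"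
      if "x \<in> carrier M" for x c
      using that by (intro coords_eqI[OF C]) (simp_all add: A closed lin sum_distrib_left mult.left_commute)
    show "act ?D g \<phi> \<in> carrier ?D"
      using \<phi> unfolding carrier sel by (simp add: closed A A_add A_smult)
    show "\<forall>i\<in>I. ?\<kappa> (act ?D g \<phi>) i = (\<Sum>j\<in>I. \<rho> (inv\<^bsub>G\<^esub> g) j i * ?\<kappa> \<phi> j)"
    proof
      fix i assume i: "i \<in> I"
      have "?\<kappa> (act ?D g \<phi>) i = (\<Sum>j\<in>I. \<kappa> (act M (inv\<^bsub>G\<^esub> g) (basis_vec M \<kappa> i)) j * \<phi> (basis_vec M \<kappa> j))"
        using i b(1)[OF i] by (simp add: sel) (rule expand[OF \<phi> A(1)])
      also have "\<dots> = (\<Sum>j\<in>I. \<rho> (inv\<^bsub>G\<^esub> g) j i * ?\<kappa> \<phi> j)"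
        by (intro sum.cong refl)
          (simp add: A(2)[OF b(1)[OF i]] b(2)[OF i] sum_unit_vec[OF coordsD(2)[OF C] i])
      finally show "?\<kappa> (act ?D g \<phi>) i = (\<Sum>j\<in>I. \<rho> (inv\<^bsub>G\<^esub> g) j i * ?\<kappa> \<phi> j)" .
    qed
  qed
  with coords show ?thesis by (simp add: rep_coords_def)
qed

subsection \<open>Isomorphisms\<close>

lemma rep_isoE:
  assumes "rep_iso G M N"
  obtains f where "bij_betw f (carrier M) (carrier N)"
    "\<And>x y. x \<in> carrier M \<Longrightarrow> y \<in> carrier M \<Longrightarrow> f (x \<oplus>\<^bsub>M\<^esub> y) = f x \<oplus>\<^bsub>N\<^esub> f y"
    "\<And>c x. x \<in> carrier M \<Longrightarrow> f (c \<odot>\<^bsub>M\<^esub> x) = c \<odot>\<^bsub>N\<^esub> f x"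
    "\<And>g x. g \<in> carrier G \<Longrightarrow> x \<in> carrier M \<Longrightarrow> f (act M g x) = act N g (f x)"
  using assms unfolding rep_iso_def by blast

lemma rep_isoI:
  assumes "bij_betw f (carrier M) (carrier N)"
    "\<And>x y. x \<in> carrier M \<Longrightarrow> y \<in> carrier M \<Longrightarrow> f (x \<oplus>\<^bsub>M\<^esub> y) = f x \<oplus>\<^bsub>N\<^esub> f y"
    "\<And>c x. x \<in> carrier M \<Longrightarrow> f (c \<odot>\<^bsub>M\<^esub> x) = c \<odot>\<^bsub>N\<^esub> f x"
    "\<And>g x. g \<in> carrier G \<Longrightarrow> x \<in> carrier M \<Longrightarrow> f (act M g x) = act N g (f x)"
  shows "rep_iso G M N"
  unfolding rep_iso_def by (rule exI[of _ f]) (simp add: assms)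

lemma rep_iso_trans:
  assumes "rep_iso G M N" "rep_iso G N P"
  shows "rep_iso G M P"
proof -
  obtain f where f: "bij_betw f (carrier M) (carrier N)"
    "\<And>x y. x \<in> carrier M \<Longrightarrow> y \<in> carrier M \<Longrightarrow> f (x \<oplus>\<^bsub>M\<^esub> y) = f x \<oplus>\<^bsub>N\<^esub> f y"
    "\<And>c x. x \<in> carrier M \<Longrightarrow> f (c \<odot>\<^bsub>M\<^esub> x) = c \<odot>\<^bsub>N\<^esub> f x"
    "\<And>g x. g \<in> carrier G \<Longrightarrow> x \<in> carrier M \<Longrightarrow> f (act M g x) = act N g (f x)"
    using rep_isoE[OF assms(1)] by metis
  obtain h where h: "bij_betw h (carrier N) (carrier P)"
    "\<And>x y. x \<in> carrier N \<Longrightarrow> y \<in> carrier N \<Longrightarrow> h (x \<oplus>\<^bsub>N\<^esub> y) = h x \<oplus>\<^bsub>P\<^esub> h y"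
    "\<And>c x. x \<in> carrier N \<Longrightarrow> h (c \<odot>\<^bsub>N\<^esub> x) = c \<odot>\<^bsub>P\<^esub> h x"
    "\<And>g x. g \<in> carrier G \<Longrightarrow> x \<in> carrier N \<Longrightarrow> h (act N g x) = act P g (h x)"
    using rep_isoE[OF assms(2)] by metis
  have fN: "f x \<in> carrier N" if "x \<in> carrier M" for x using f(1) that by (rule bij_betwE[rule_format])
  show ?thesis
    by (rule rep_isoI[where f = "h \<circ> f"], rule bij_betw_trans[OF f(1) h(1)]) (simp_all add: f h fN)
qed

text \<open>\<open>rep_iso\<close> speaks of bare operations, and the inverse map respects them as
  soon as the source is closed under them.\<close>

lemma rep_iso_sym_closed:
  assumes "rep_iso G M N"
    and closed: "\<And>x y. x \<in> carrier M \<Longrightarrow> y \<in> carrier M \<Longrightarrow> x \<oplus>\<^bsub>M\<^esub> y \<in> carrier M"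
      "\<And>c x. x \<in> carrier M \<Longrightarrow> c \<odot>\<^bsub>M\<^esub> x \<in> carrier M"
      "\<And>g x. g \<in> carrier G \<Longrightarrow> x \<in> carrier M \<Longrightarrow> act M g x \<in> carrier M"
  shows "rep_iso G N M"
proof -
  obtain f where f: "bij_betw f (carrier M) (carrier N)"
    "\<And>x y. x \<in> carrier M \<Longrightarrow> y \<in> carrier M \<Longrightarrow> f (x \<oplus>\<^bsub>M\<^esub> y) = f x \<oplus>\<^bsub>N\<^esub> f y"
    "\<And>c x. x \<in> carrier M \<Longrightarrow> f (c \<odot>\<^bsub>M\<^esub> x) = c \<odot>\<^bsub>N\<^esub> f x"
    "\<And>g x. g \<in> carrier G \<Longrightarrow> x \<in> carrier M \<Longrightarrow> f (act M g x) = act N g (f x)"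
    using rep_isoE[OF assms(1)] by metis
  let ?h = "inv_into (carrier M) f"
  have h: "?h (f x) = x" if "x \<in> carrier M" for x
    using f(1) that by (simp add: bij_betw_def)
  have ex: "\<exists>x\<in>carrier M. y = f x" if "y \<in> carrier N" for y
    using f(1) that by (auto simp: bij_betw_def)
  show ?thesis
  proof (rule rep_isoI[where f = ?h])
    show "bij_betw ?h (carrier N) (carrier M)" by (rule bij_betw_inv_into[OF f(1)])
  next
    fix x y assume "x \<in> carrier N" "y \<in> carrier N"
    then obtain u v where "u \<in> carrier M" "x = f u" "v \<in> carrier M" "y = f v" using ex by meson
    then show "?h (x \<oplus>\<^bsub>N\<^esub> y) = ?h x \<oplus>\<^bsub>M\<^esub> ?h y"
      using h[OF closed(1)[of u v]] by (simp add: f(2) h)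
  next
    fix c y assume "y \<in> carrier N"
    then obtain v where "v \<in> carrier M" "y = f v" using ex by meson
    then show "?h (c \<odot>\<^bsub>N\<^esub> y) = c \<odot>\<^bsub>M\<^esub> ?h y"
      using h[OF closed(2)[of v c]] by (simp add: f(3) h)
  next
    fix g y assume g: "g \<in> carrier G" and "y \<in> carrier N"
    then obtain v where "v \<in> carrier M" "y = f v" using ex by meson
    then show "?h (act N g y) = act M g (?h y)"
      using h[OF closed(3)[of g v]] g by (simp add: f(4) h)
  qed
qed

lemma rep_iso_sym:
  assumes "rep_iso G M N" "rep_coords G M I \<rho> \<kappa>"
  shows "rep_iso G N M"
  using assms(1) coords_closed[OF rep_coordsD(1)[OF assms(2)]] rep_coordsD(2)[OF assms(2)]
  by (rule rep_iso_sym_closed)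

lemma mvec_vecs: "mvec I J T c \<in> vecs J"
  by (simp add: mvec_def vecs_def)

lemma mvec_in: "j \<in> J \<Longrightarrow> mvec I J T c j = (\<Sum>i\<in>I. T j i * c i)"
  by (simp add: mvec_def)

text \<open>Reduces an isomorphism of modules over unrelated types to an identity between
  matrices.\<close>

lemma rep_iso_intertwine:
  fixes M :: "('g, 'k :: field, 'v) gmod" and N :: "('g, 'k, 'w) gmod"
    and I :: "'i set" and J :: "'j set"
  assumes M: "rep_coords G M I \<rho> \<kappa>" and N: "rep_coords G N J \<tau> \<eta>"
    and T: "bij_betw (mvec I J T) (vecs I) (vecs J)"
    and comm: "\<And>g i j. g \<in> carrier G \<Longrightarrow> i \<in> I \<Longrightarrow> j \<in> J \<Longrightarrow>
      (\<Sum>j'\<in>J. \<tau> g j j' * T j' i) = (\<Sum>i'\<in>I. T j i' * \<rho> g i' i)"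
  shows "rep_iso G M N"
proof -
  note CM = rep_coordsD(1)[OF M] and CN = rep_coordsD(1)[OF N]
  note linM = lin_toD[OF coordsD(3)[OF CM]] and linN = lin_toD[OF coordsD(3)[OF CN]]
  have bM: "bij_betw \<kappa> (carrier M) (vecs I)" and bN: "bij_betw \<eta> (carrier N) (vecs J)"
    using coordsD(4)[OF CM] coordsD(4)[OF CN] .
  let ?f = "inv_into (carrier N) \<eta> \<circ> (mvec I J T \<circ> \<kappa>)"
  have f: "bij_betw ?f (carrier M) (carrier N)"
    by (rule bij_betw_trans[OF bij_betw_trans[OF bM T] bij_betw_inv_into[OF bN]])
  have fN: "?f x \<in> carrier N" if "x \<in> carrier M" for x using f that by (rule bij_betwE[rule_format])
  have \<eta>f: "\<eta> (?f x) = mvec I J T (\<kappa> x)" for x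
    using bN mvec_vecs[of I J T "\<kappa> x"] by (simp add: bij_betw_def f_inv_into_f)
  show ?thesis
  proof (rule rep_isoI[OF f])
    fix x y assume xy: "x \<in> carrier M" "y \<in> carrier M"
    show "?f (x \<oplus>\<^bsub>M\<^esub> y) = ?f x \<oplus>\<^bsub>N\<^esub> ?f y"
    proof (rule coords_eqI[OF CN fN[OF coords_closed(1)[OF CM xy]] coords_closed(1)[OF CN fN[OF xy(1)] fN[OF xy(2)]]])
      fix j assume "j \<in> J"
      then show "\<eta> (?f (x \<oplus>\<^bsub>M\<^esub> y)) j = \<eta> (?f x \<oplus>\<^bsub>N\<^esub> ?f y) j"
        unfolding linN(2)[OF fN[OF xy(1)] fN[OF xy(2)]] \<eta>f
        by (simp add: mvec_in linM(2)[OF xy] distrib_left sum.distrib)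
    qed
  next
    fix c x assume x: "x \<in> carrier M"
    show "?f (c \<odot>\<^bsub>M\<^esub> x) = c \<odot>\<^bsub>N\<^esub> ?f x"
    proof (rule coords_eqI[OF CN fN[OF coords_closed(2)[OF CM x]] coords_closed(2)[OF CN fN[OF x]]])
      fix j assume "j \<in> J"
      then show "\<eta> (?f (c \<odot>\<^bsub>M\<^esub> x)) j = \<eta> (c \<odot>\<^bsub>N\<^esub> ?f x) j"
        unfolding linN(3)[OF fN[OF x]] \<eta>f
        by (simp add: mvec_in linM(3)[OF x] sum_distrib_left mult.left_commute)
    qed
  next
    fix g x assume g: "g \<in> carrier G" and x: "x \<in> carrier M"
    show "?f (act M g x) = act N g (?f x)"
    proof (rule coords_eqI[OF CN fN[OF rep_coordsD(2)[OF M g x]] rep_coordsD(2)[OF N g fN[OF x]]])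
      fix j assume j: "j \<in> J"
      have "\<eta> (?f (act M g x)) j = (\<Sum>i'\<in>I. T j i' * (\<Sum>i\<in>I. \<rho> g i' i * \<kappa> x i))"
        unfolding \<eta>f mvec_in[OF j] by (intro sum.cong refl) (simp add: rep_coordsD(3)[OF M g x])
      also have "\<dots> = (\<Sum>i\<in>I. \<Sum>i'\<in>I. T j i' * \<rho> g i' i * \<kappa> x i)"
        unfolding sum_distrib_left mult.assoc by (rule sum.swap)
      also have "\<dots> = (\<Sum>i\<in>I. \<Sum>j'\<in>J. \<tau> g j j' * T j' i * \<kappa> x i)"
        unfolding sum_distrib_right[symmetric] by (intro sum.cong refl) (simp add: comm[OF g _ j])
      also have "\<dots> = (\<Sum>j'\<in>J. \<tau> g j j' * (\<Sum>i\<in>I. T j' i * \<kappa> x i))"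
        unfolding sum_distrib_left mult.assoc by (rule sum.swap)
      also have "\<dots> = (\<Sum>j'\<in>J. \<tau> g j j' * \<eta> (?f x) j')"
        unfolding \<eta>f by (intro sum.cong refl) (simp add: mvec_in)
      also have "\<dots> = \<eta> (act N g (?f x)) j"
        by (rule rep_coordsD(3)[OF N g fN[OF x] j, symmetric])
      finally show "\<eta> (?f (act M g x)) j = \<eta> (act N g (?f x)) j" .
    qed
  qed
qed

text \<open>Coordinates travel along the isomorphism with the matrices unchanged. This is how
  isomorphic modules are seen to have isomorphic duals.\<close>

lemma rep_iso_transfer:
  fixes M :: "('g, 'k :: field, 'v) gmod" and N :: "('g, 'k, 'w) gmod"
  assumes iso: "rep_iso G M N" and M: "rep_coords G M I \<rho> \<kappa>" and N: "kmodule N"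
  obtains \<eta> where "rep_coords G N I \<rho> \<eta>"
proof -
  note CM = rep_coordsD(1)[OF M]
  note linM = lin_toD[OF coordsD(3)[OF CM]]
  obtain f where f: "bij_betw f (carrier M) (carrier N)"
    "\<And>x y. x \<in> carrier M \<Longrightarrow> y \<in> carrier M \<Longrightarrow> f (x \<oplus>\<^bsub>M\<^esub> y) = f x \<oplus>\<^bsub>N\<^esub> f y"
    "\<And>c x. x \<in> carrier M \<Longrightarrow> f (c \<odot>\<^bsub>M\<^esub> x) = c \<odot>\<^bsub>N\<^esub> f x"
    "\<And>g x. g \<in> carrier G \<Longrightarrow> x \<in> carrier M \<Longrightarrow> f (act M g x) = act N g (f x)"
    using rep_isoE[OF iso] by metis
  let ?h = "inv_into (carrier M) f"
  have h: "?h (f x) = x" if "x \<in> carrier M" for x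
    using f(1) that by (simp add: bij_betw_def)
  have ex: "\<exists>x\<in>carrier M. y = f x" if "y \<in> carrier N" for y
    using f(1) that by (auto simp: bij_betw_def)
  let ?\<eta> = "\<kappa> \<circ> ?h"
  have fN: "f x \<in> carrier N" if "x \<in> carrier M" for x using f(1) that by (rule bij_betwE[rule_format])
  have \<eta>: "?\<eta> (f x) = \<kappa> x" if "x \<in> carrier M" for x using h[OF that] by simp
  have "lin_to N I ?\<eta>"
    unfolding lin_to_def
  proof (intro conjI ballI allI)
    fix x assume "x \<in> carrier N"
    then obtain u where u: "u \<in> carrier M" "x = f u" using ex by blast
    then show "?\<eta> x \<in> vecs I" using linM(1) by (simp add: h)
    show "?\<eta> (c \<odot>\<^bsub>N\<^esub> x) i = c * ?\<eta> x i" for c i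
      using \<eta>[OF coords_closed(2)[OF CM u(1), of c]] u by (simp add: f(3) linM(3) h)
    fix y assume "y \<in> carrier N"
    then obtain v where v: "v \<in> carrier M" "y = f v" using ex by blast
    show "?\<eta> (x \<oplus>\<^bsub>N\<^esub> y) i = ?\<eta> x i + ?\<eta> y i" for i
      using \<eta>[OF coords_closed(1)[OF CM u(1) v(1)]] u v by (simp add: f(2) linM(2) h)
  qed
  moreover have "bij_betw ?\<eta> (carrier N) (vecs I)"
    by (rule bij_betw_trans[OF bij_betw_inv_into[OF f(1)] coordsD(4)[OF CM]])
  ultimately have "coords N I ?\<eta>"
    using N coordsD(2)[OF CM] by (simp add: coords_def)
  moreover have "act N g x \<in> carrier N \<and> (\<forall>i\<in>I. ?\<eta> (act N g x) i = (\<Sum>j\<in>I. \<rho> g i j * ?\<eta> x j))"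
    if g: "g \<in> carrier G" and "x \<in> carrier N" for g x
  proof -
    obtain u where u: "u \<in> carrier M" "x = f u" using ex \<open>x \<in> carrier N\<close> by blast
    have eq: "act N g x = f (act M g u)" unfolding u(2) by (rule f(4)[OF g u(1), symmetric])
    note A = rep_coordsD(2,3)[OF M g u(1)]
    show ?thesis
      unfolding eq using fN[OF A(1)] \<eta>[OF A(1)] \<eta>[OF u(1)] A(2) u(2) by simp
  qed
  ultimately have "rep_coords G N I \<rho> ?\<eta>" by (simp add: rep_coords_def)
  then show thesis by (rule that)
qed

lemma sum_diag:
  fixes f :: "'i \<Rightarrow> 'k :: comm_semiring_1"
  assumes "finite I" "i \<in> I"
  shows "(\<Sum>j\<in>I. diag d i j * f j) = d i * f i" "(\<Sum>j\<in>I. f j * diag d j i) = d i * f i"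
proof -
  have "(\<Sum>j\<in>I. diag d i j * f j) = (\<Sum>j\<in>I. if j = i then d j * f j else 0)"
    by (intro sum.cong refl) (simp add: diag_def)
  then show "(\<Sum>j\<in>I. diag d i j * f j) = d i * f i" using assms by simp
  have "(\<Sum>j\<in>I. f j * diag d j i) = (\<Sum>j\<in>I. if j = i then d j * f j else 0)"
    by (intro sum.cong refl) (simp add: diag_def mult.commute)
  then show "(\<Sum>j\<in>I. f j * diag d j i) = d i * f i" using assms by simp
qed

lemma rep_iso_same_matrix:
  fixes M :: "('g, 'k :: field, 'v) gmod" and N :: "('g, 'k, 'w) gmod" and I :: "'i set"
  assumes M: "rep_coords G M I \<rho> \<kappa>" and N: "rep_coords G N I \<tau> \<eta>"
    and eq: "\<And>g i j. g \<in> carrier G \<Longrightarrow> i \<in> I \<Longrightarrow> j \<in> I \<Longrightarrow> \<rho> g i j = \<tau> g i j"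
  shows "rep_iso G M N"
proof (rule rep_iso_intertwine[OF M N, where T = "diag (\<lambda>_. 1)"])
  have fin: "finite I" by (rule coordsD(2)[OF rep_coordsD(1)[OF M]])
  have "mvec I I (diag (\<lambda>_. 1)) c = c" if "c \<in> vecs I" for c :: "'i \<Rightarrow> 'k"
    using that by (auto simp: mvec_def vecs_def fun_eq_iff sum_diag(1)[OF fin])
  then show "bij_betw (mvec I I (diag (\<lambda>_. 1) :: _ \<Rightarrow> _ \<Rightarrow> 'k)) (vecs I) (vecs I)"
    by (intro bij_betw_byWitness[where f' = "\<lambda>c. c"]) auto
  show "(\<Sum>j'\<in>I. \<tau> g j j' * diag (\<lambda>_. 1) j' i) = (\<Sum>i'\<in>I. diag (\<lambda>_. 1) j i' * \<rho> g i' i)"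
    if "g \<in> carrier G" "i \<in> I" "j \<in> I" for g i j
    using that by (simp add: sum_diag[OF fin] eq)
qed

lemma rep_iso_dual:
  fixes M :: "('g, 'k :: field, 'v) gmod" and N :: "('g, 'k, 'w) gmod"
  assumes iso: "rep_iso G M N" and M: "rep_coords G M I \<rho> \<kappa>" and N: "kmodule N" and G: "group G"
  shows "rep_iso G (dual_rep G M) (dual_rep G N)"
proof -
  obtain \<eta> where "rep_coords G N I \<rho> \<eta>" using rep_iso_transfer[OF iso M N] .
  from rep_iso_same_matrix[OF rep_coords_dual[OF M G] rep_coords_dual[OF this G]]
  show ?thesis by simp
qed

text \<open>The converse of \<open>rep_iso_intertwine\<close>, on which all the non-isomorphisms
  rest. Column \<open>i\<close> of \<open>F\<close> holds the coordinates of the image of the basis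
  vector \<open>i\<close>, and the first property is the injectivity of the isomorphism.\<close>

lemma rep_iso_matrix:
  fixes M :: "('g, 'k :: field, 'v) gmod" and N :: "('g, 'k, 'w) gmod"
    and I :: "'i set" and J :: "'j set"
  assumes iso: "rep_iso G M N" and M: "rep_coords G M I \<rho> \<kappa>" and N: "rep_coords G N J \<tau> \<eta>"
  obtains F where
    "\<And>c. c \<in> vecs I \<Longrightarrow> (\<And>j. j \<in> J \<Longrightarrow> (\<Sum>i\<in>I. F j i * c i) = 0) \<Longrightarrow> c = (\<lambda>_. 0)"
    "\<And>g i j. g \<in> carrier G \<Longrightarrow> i \<in> I \<Longrightarrow> j \<in> J \<Longrightarrow>
      (\<Sum>j'\<in>J. \<tau> g j j' * F j' i) = (\<Sum>i'\<in>I. F j i' * \<rho> g i' i)"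
proof -
  note CM = rep_coordsD(1)[OF M] and CN = rep_coordsD(1)[OF N]
  note linM = lin_toD[OF coordsD(3)[OF CM]] and linN = lin_toD[OF coordsD(3)[OF CN]]
  obtain f where f: "bij_betw f (carrier M) (carrier N)"
    "\<And>x y. x \<in> carrier M \<Longrightarrow> y \<in> carrier M \<Longrightarrow> f (x \<oplus>\<^bsub>M\<^esub> y) = f x \<oplus>\<^bsub>N\<^esub> f y"
    "\<And>c x. x \<in> carrier M \<Longrightarrow> f (c \<odot>\<^bsub>M\<^esub> x) = c \<odot>\<^bsub>N\<^esub> f x"
    "\<And>g x. g \<in> carrier G \<Longrightarrow> x \<in> carrier M \<Longrightarrow> f (act M g x) = act N g (f x)"
    using rep_isoE[OF iso] by metis
  have fN: "f x \<in> carrier N" if "x \<in> carrier M" for x using f(1) that by (rule bij_betwE[rule_format])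
  let ?b = "basis_vec M \<kappa>"
  note b = basis_vec[OF CM]
  define F where "F = (\<lambda>j i. \<eta> (f (?b i)) j)"
  have F: "\<eta> (f x) j = (\<Sum>i\<in>I. F j i * \<kappa> x i)" if "x \<in> carrier M" for x j
    using linear_expansion[OF CM that, of "\<lambda>x. \<eta> (f x) j"]
    by (simp add: f(2,3) linN(2,3) fN F_def mult.commute)
  show thesis
  proof (rule that[of F])
    fix c :: "'i \<Rightarrow> 'k" assume c: "c \<in> vecs I" and z: "\<And>j. j \<in> J \<Longrightarrow> (\<Sum>i\<in>I. F j i * c i) = 0"
    obtain x where x: "x \<in> carrier M" "\<kappa> x = c" using coords_ex[OF CM c] .
    interpret VM: module "ring_of_type_algebra :: 'k ring" M by (rule coordsD(1)[OF CM])
    have 0: "\<kappa> \<zero>\<^bsub>M\<^esub> i = 0" for i by (rule lin_to_zero[OF coordsD(1,3)[OF CM]])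
    have "f x = f \<zero>\<^bsub>M\<^esub>"
    proof (rule coords_eqI[OF CN fN fN])
      show "\<eta> (f x) j = \<eta> (f \<zero>\<^bsub>M\<^esub>) j" if "j \<in> J" for j
        unfolding F[OF x(1)] F[OF VM.M.zero_closed] x(2) using z[OF that] by (simp add: 0)
    qed (use x in auto)
    then have "x = \<zero>\<^bsub>M\<^esub>" using f(1) x(1) by (auto simp: bij_betw_def inj_on_def)
    then show "c = (\<lambda>_. 0)" using x(2) 0 by auto
  next
    fix g i j assume g: "g \<in> carrier G" and i: "i \<in> I" and j: "j \<in> J"
    have "(\<Sum>j'\<in>J. \<tau> g j j' * F j' i) = \<eta> (act N g (f (?b i))) j"
      unfolding F_def by (rule rep_coordsD(3)[OF N g fN[OF b(1)[OF i]] j, symmetric])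
    also have "\<dots> = \<eta> (f (act M g (?b i))) j" by (simp add: f(4)[OF g b(1)[OF i]])
    also have "\<dots> = (\<Sum>i'\<in>I. F j i' * \<kappa> (act M g (?b i)) i')"
      by (rule F[OF rep_coordsD(2)[OF M g b(1)[OF i]]])
    also have "\<dots> = (\<Sum>i'\<in>I. F j i' * \<rho> g i' i)"
      by (intro sum.cong refl)
        (simp add: rep_coordsD(3)[OF M g b(1)[OF i]] b(2)[OF i] sum_unit_vec[OF coordsD(2)[OF CM] i])
    finally show "(\<Sum>j'\<in>J. \<tau> g j j' * F j' i) = (\<Sum>i'\<in>I. F j i' * \<rho> g i' i)" .
  qed
qed

subsection \<open>Matrix representations\<close>

text \<open>\<open>rep_coords\<close> describes each group element separately; the homomorphism law
  is recorded here, on matrices.\<close>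

definition mat_hom :: "'g monoid \<Rightarrow> 'i set \<Rightarrow> ('g \<Rightarrow> 'i \<Rightarrow> 'i \<Rightarrow> 'k :: field) \<Rightarrow> bool" where
  "mat_hom G I \<rho> \<longleftrightarrow>
    (\<forall>g\<in>carrier G. \<forall>h\<in>carrier G. \<forall>i\<in>I. \<forall>j\<in>I. \<rho> (g \<otimes>\<^bsub>G\<^esub> h) i j = mmul I (\<rho> g) (\<rho> h) i j) \<and>
    (\<forall>i\<in>I. \<forall>j\<in>I. \<rho> \<one>\<^bsub>G\<^esub> i j = diag (\<lambda>_. 1) i j)"

lemma mat_homD:
  assumes "mat_hom G I \<rho>" "i \<in> I" "j \<in> I"
  shows "g \<in> carrier G \<Longrightarrow> h \<in> carrier G \<Longrightarrow> \<rho> (g \<otimes>\<^bsub>G\<^esub> h) i j = (\<Sum>l\<in>I. \<rho> g i l * \<rho> h l j)"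
    and "\<rho> \<one>\<^bsub>G\<^esub> i j = diag (\<lambda>_. 1) i j"
  using assms by (auto simp: mat_hom_def mmul_def)

lemma mat_hom_symU:
  assumes "mat_hom G I \<rho>" "finite I"
  shows "mat_hom G (multisets_of_size I r) (\<lambda>g. symU (\<rho> g))"
  unfolding mat_hom_def
proof (intro conjI ballI)
  fix g h \<mu> \<nu> assume *: "g \<in> carrier G" "h \<in> carrier G" "\<mu> \<in> multisets_of_size I r" "\<nu> \<in> multisets_of_size I r"
  have "symU (\<rho> (g \<otimes>\<^bsub>G\<^esub> h)) \<mu> \<nu> = symU (mmul I (\<rho> g) (\<rho> h)) \<mu> \<nu>"
    using assms(1) * by (intro symU_cong[of I I _ _ _ r]) (auto simp: mat_hom_def)
  then show "symU (\<rho> (g \<otimes>\<^bsub>G\<^esub> h)) \<mu> \<nu> = mmul (multisets_of_size I r) (symU (\<rho> g)) (symU (\<rho> h)) \<mu> \<nu>"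
    using assms(2) * by (simp add: symU_mult multisets_of_sizeD)
next
  fix \<mu> \<nu> assume *: "\<mu> \<in> multisets_of_size I r" "\<nu> \<in> multisets_of_size I r"
  have "symU (\<rho> \<one>\<^bsub>G\<^esub>) \<mu> \<nu> = symU (diag (\<lambda>_. 1)) \<mu> \<nu>"
    using assms(1) * by (intro symU_cong[of I I _ _ _ r]) (auto simp: mat_hom_def)
  then show "symU (\<rho> \<one>\<^bsub>G\<^esub>) \<mu> \<nu> = diag (\<lambda>_. 1) \<mu> \<nu>"
    using * by (simp add: symU_diag multisets_of_sizeD)
qed

lemma mat_hom_symL:
  assumes "mat_hom G I \<rho>" "finite I"
  shows "mat_hom G (multisets_of_size I r) (\<lambda>g. symL (\<rho> g))"
  unfolding mat_hom_def
proof (intro conjI ballI)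
  fix g h \<mu> \<nu> assume *: "g \<in> carrier G" "h \<in> carrier G" "\<mu> \<in> multisets_of_size I r" "\<nu> \<in> multisets_of_size I r"
  have "symL (\<rho> (g \<otimes>\<^bsub>G\<^esub> h)) \<mu> \<nu> = symL (mmul I (\<rho> g) (\<rho> h)) \<mu> \<nu>"
    using assms(1) * by (intro symL_cong[of I I _ _ _ r]) (auto simp: mat_hom_def)
  then show "symL (\<rho> (g \<otimes>\<^bsub>G\<^esub> h)) \<mu> \<nu> = mmul (multisets_of_size I r) (symL (\<rho> g)) (symL (\<rho> h)) \<mu> \<nu>"
    using assms(2) * by (simp add: symL_mult multisets_of_sizeD)
next
  fix \<mu> \<nu> assume *: "\<mu> \<in> multisets_of_size I r" "\<nu> \<in> multisets_of_size I r"
  have "symL (\<rho> \<one>\<^bsub>G\<^esub>) \<mu> \<nu> = symL (diag (\<lambda>_. 1)) \<mu> \<nu>"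
    using assms(1) * by (intro symL_cong[of I I _ _ _ r]) (auto simp: mat_hom_def)
  then show "symL (\<rho> \<one>\<^bsub>G\<^esub>) \<mu> \<nu> = diag (\<lambda>_. 1) \<mu> \<nu>"
    using * by (simp add: symL_diag multisets_of_sizeD)
qed

lemma mvec_mat_hom:
  assumes \<rho>: "mat_hom G I \<rho>" and fin: "finite I"
  shows "g \<in> carrier G \<Longrightarrow> h \<in> carrier G \<Longrightarrow> mvec I I (\<rho> (g \<otimes>\<^bsub>G\<^esub> h)) c = mvec I I (\<rho> g) (mvec I I (\<rho> h) c)"
    and "c \<in> vecs I \<Longrightarrow> mvec I I (\<rho> \<one>\<^bsub>G\<^esub>) c = c"
proof -
  assume g: "g \<in> carrier G" "h \<in> carrier G"
  show "mvec I I (\<rho> (g \<otimes>\<^bsub>G\<^esub> h)) c = mvec I I (\<rho> g) (mvec I I (\<rho> h) c)"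
  proof
    fix i
    show "mvec I I (\<rho> (g \<otimes>\<^bsub>G\<^esub> h)) c i = mvec I I (\<rho> g) (mvec I I (\<rho> h) c) i"
    proof (cases "i \<in> I")
      case True
      have "(\<Sum>j\<in>I. \<rho> (g \<otimes>\<^bsub>G\<^esub> h) i j * c j) = (\<Sum>j\<in>I. \<Sum>l\<in>I. \<rho> g i l * \<rho> h l j * c j)"
        by (intro sum.cong refl) (simp add: mat_homD(1)[OF \<rho> True _ g] sum_distrib_right)
      also have "\<dots> = (\<Sum>l\<in>I. \<rho> g i l * (\<Sum>j\<in>I. \<rho> h l j * c j))"
        by (subst sum.swap) (simp add: sum_distrib_left mult.assoc)
      also have "\<dots> = (\<Sum>l\<in>I. \<rho> g i l * mvec I I (\<rho> h) c l)"
        by (intro sum.cong refl) (simp add: mvec_in)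
      finally show ?thesis using True by (simp add: mvec_in)
    qed (simp add: mvec_def)
  qed
next
  assume c: "c \<in> vecs I"
  show "mvec I I (\<rho> \<one>\<^bsub>G\<^esub>) c = c"
  proof
    fix i
    show "mvec I I (\<rho> \<one>\<^bsub>G\<^esub>) c i = c i"
    proof (cases "i \<in> I")
      case True
      have "(\<Sum>j\<in>I. \<rho> \<one>\<^bsub>G\<^esub> i j * c j) = (\<Sum>j\<in>I. diag (\<lambda>_. 1) i j * c j)"
        by (intro sum.cong refl) (simp add: mat_homD(2)[OF \<rho> True])
      then show ?thesis using True by (simp add: mvec_in sum_diag[OF fin])
    qed (use c in \<open>simp add: mvec_def vecs_def\<close>)
  qed
qed

lemma mvec_mat_hom_bij:
  assumes \<rho>: "mat_hom G I \<rho>" and fin: "finite I" and G: "group G" and g: "g \<in> carrier G"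
  shows "bij_betw (mvec I I (\<rho> g)) (vecs I) (vecs I)"
proof (rule bij_betw_byWitness[where f' = "mvec I I (\<rho> (inv\<^bsub>G\<^esub> g))"])
  have ig: "inv\<^bsub>G\<^esub> g \<in> carrier G" using group.inv_closed[OF G g] .
  show "\<forall>c\<in>vecs I. mvec I I (\<rho> (inv\<^bsub>G\<^esub> g)) (mvec I I (\<rho> g) c) = c"
    using mvec_mat_hom[OF \<rho> fin] g ig group.l_inv[OF G g] by metis
  show "\<forall>c\<in>vecs I. mvec I I (\<rho> g) (mvec I I (\<rho> (inv\<^bsub>G\<^esub> g)) c) = c"
    using mvec_mat_hom[OF \<rho> fin] g ig group.r_inv[OF G g] by metis
qed (use mvec_vecs in auto)

text \<open>An inner automorphism twists a representation into an isomorphic one, the isomorphism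
  being the action of the conjugating element or its inverse. Applied to the Weyl element, this
  absorbs the inverse transpose that appears in duals.\<close>

lemma rep_iso_conjugate:
  fixes M :: "('g, 'k :: field, 'v) gmod" and N :: "('g, 'k, 'w) gmod"
  assumes M: "rep_coords G M I \<rho> \<kappa>" and N: "rep_coords G N I \<tau> \<eta>"
    and \<tau>: "mat_hom G I \<tau>" and G: "group G" and a: "a \<in> carrier G"
    and conj: "\<And>g i j. g \<in> carrier G \<Longrightarrow> i \<in> I \<Longrightarrow> j \<in> I \<Longrightarrow> \<rho> g i j = \<tau> (a \<otimes>\<^bsub>G\<^esub> g \<otimes>\<^bsub>G\<^esub> inv\<^bsub>G\<^esub> a) i j"
  shows "rep_iso G M N"
proof (rule rep_iso_intertwine[OF M N])
  interpret G: group G by (rule G)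
  have fin: "finite I" by (rule coordsD(2)[OF rep_coordsD(1)[OF M]])
  have ia: "inv\<^bsub>G\<^esub> a \<in> carrier G" using a by simp
  show "bij_betw (mvec I I (\<tau> (inv\<^bsub>G\<^esub> a))) (vecs I) (vecs I)"
    by (rule mvec_mat_hom_bij[OF \<tau> fin G ia])
  fix g i j assume g: "g \<in> carrier G" and ij: "i \<in> I" "j \<in> I"
  have "(\<Sum>j'\<in>I. \<tau> g j j' * \<tau> (inv\<^bsub>G\<^esub> a) j' i) = \<tau> (g \<otimes>\<^bsub>G\<^esub> inv\<^bsub>G\<^esub> a) j i"
    by (rule mat_homD(1)[OF \<tau> ij(2,1) g ia, symmetric])
  also have "g \<otimes>\<^bsub>G\<^esub> inv\<^bsub>G\<^esub> a = inv\<^bsub>G\<^esub> a \<otimes>\<^bsub>G\<^esub> (a \<otimes>\<^bsub>G\<^esub> g \<otimes>\<^bsub>G\<^esub> inv\<^bsub>G\<^esub> a)"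
    using a g by (simp add: G.m_assoc[symmetric])
  also have "\<tau> \<dots> j i = (\<Sum>i'\<in>I. \<tau> (inv\<^bsub>G\<^esub> a) j i' * \<tau> (a \<otimes>\<^bsub>G\<^esub> g \<otimes>\<^bsub>G\<^esub> inv\<^bsub>G\<^esub> a) i' i)"
    using a g by (intro mat_homD(1)[OF \<tau> ij(2,1)]) auto
  also have "\<dots> = (\<Sum>i'\<in>I. \<tau> (inv\<^bsub>G\<^esub> a) j i' * \<rho> g i' i)"
    by (intro sum.cong refl) (simp add: conj[OF g _ ij(1)])
  finally show "(\<Sum>j'\<in>I. \<tau> g j j' * \<tau> (inv\<^bsub>G\<^esub> a) j' i) = (\<Sum>i'\<in>I. \<tau> (inv\<^bsub>G\<^esub> a) j i' * \<rho> g i' i)" .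
qed

text \<open>Shows that isomorphism classes are inhabited, which is what lets equality of classes
  imply isomorphism.\<close>

lemma ex_standard_model:
  fixes M :: "('g, 'k :: field, 'v) gmod" and I :: "'i set"
  assumes M: "rep_coords G M I \<rho> \<kappa>" and \<rho>: "mat_hom G I \<rho>" and G: "group G"
  shows "\<exists>W :: ('g, 'k, nat \<Rightarrow> 'k) gmod. group_rep G W \<and> rep_iso G M W"
proof -
  have fin: "finite I" by (rule coordsD(2)[OF rep_coordsD(1)[OF M]])
  define n where "n = card I"
  obtain b where b: "bij_betw b {..<n} I"
    using ex_bij_betw_nat_finite[OF fin] by (auto simp: n_def atLeast0LessThan)
  let ?J = "{..<n}"
  define \<tau> where "\<tau> = (\<lambda>g i j. \<rho> g (b i) (b j))"
  have bI: "b i \<in> I" if "i \<in> ?J" for i using b that by (rule bij_betwE[rule_format])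
  have \<tau>_hom: "mat_hom G ?J \<tau>"
    unfolding mat_hom_def
  proof (intro conjI ballI)
    fix g h i j assume "g \<in> carrier G" "h \<in> carrier G" "i \<in> ?J" "j \<in> ?J"
    then show "\<tau> (g \<otimes>\<^bsub>G\<^esub> h) i j = mmul ?J (\<tau> g) (\<tau> h) i j"
      using mat_homD(1)[OF \<rho> bI[of i] bI[of j]] sum.reindex_bij_betw[OF b, of "\<lambda>l. \<rho> g (b i) l * \<rho> h l (b j)"]
      by (simp add: \<tau>_def mmul_def)
  next
    fix i j assume ij: "i \<in> ?J" "j \<in> ?J"
    then have "b i = b j \<longleftrightarrow> i = j" using b by (auto simp: bij_betw_def inj_on_def)
    then show "\<tau> \<one>\<^bsub>G\<^esub> i j = diag (\<lambda>_. 1) i j"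
      using mat_homD(2)[OF \<rho> bI[OF ij(1)] bI[OF ij(2)]] by (simp add: \<tau>_def diag_def)
  qed
  define W :: "('g, 'k, nat \<Rightarrow> 'k) gmod" where
    "W = \<lparr>carrier = vecs ?J, monoid.mult = undefined, one = undefined, ring.zero = (\<lambda>_. 0),
      add = (\<lambda>c d i. c i + d i), module.smult = (\<lambda>a c i. a * c i), act = (\<lambda>g. mvec ?J ?J (\<tau> g))\<rparr>"
  have sel: "carrier W = vecs ?J" "add W = (\<lambda>c d i. c i + d i)" "ring.zero W = (\<lambda>_. 0)"
    "module.smult W = (\<lambda>a c i. a * c i)" "act W = (\<lambda>g. mvec ?J ?J (\<tau> g))"
    by (simp_all add: W_def)
  have CX: "coords W ?J (\<lambda>x. x)"
    by (rule coordsI) (simp_all add: sel lin_to_def vecs_def bij_betw_def)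
  have RX: "rep_coords G W ?J \<tau> (\<lambda>x. x)"
    unfolding rep_coords_def using CX by (simp add: sel mvec_vecs mvec_in)
  have "rep_iso G M W"
  proof (rule rep_iso_intertwine[OF M RX, where T = "\<lambda>j i. if i = b j then 1 else 0"])
    let ?c = "inv_into ?J b"
    have c: "bij_betw ?c I ?J" by (rule bij_betw_inv_into[OF b])
    have bc: "b (?c i) = i" if "i \<in> I" for i by (rule bij_betw_inv_into_right[OF b that])
    \<comment> \<open>A permutation matrix is triangular for a constant height.\<close>
    show "bij_betw (mvec I ?J (\<lambda>j i. if i = b j then 1 else 0 :: 'k)) (vecs I) (vecs ?J)"
      by (rule mvec_triangular_bij[OF fin c, where h = "\<lambda>_. 0"]) (auto simp: bc split: if_splits)
    fix g i j assume g: "g \<in> carrier G" and i: "i \<in> I" and j: "j \<in> ?J"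
    have "(\<Sum>j'\<in>?J. \<tau> g j j' * (if i = b j' then 1 else 0)) = (\<Sum>j'\<in>?J. if j' = ?c i then \<tau> g j j' else 0)"
    proof (intro sum.cong refl)
      fix j' assume j': "j' \<in> ?J"
      have "i = b j' \<longleftrightarrow> j' = ?c i" using bij_betw_inv_into_left[OF b j'] bc[OF i] by auto
      then show "\<tau> g j j' * (if i = b j' then 1 else 0) = (if j' = ?c i then \<tau> g j j' else 0)" by simp
    qed
    also have "\<dots> = \<rho> g (b j) i" using bij_betw_apply[OF c i] bc[OF i] by (simp add: \<tau>_def)
    also have "\<dots> = (\<Sum>i'\<in>I. if i' = b j then \<rho> g i' i else 0)" using fin bI[OF j] by simp
    also have "\<dots> = (\<Sum>i'\<in>I. (if i' = b j then 1 else 0) * \<rho> g i' i)" by (intro sum.cong refl) simp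
    finally show "(\<Sum>j'\<in>?J. \<tau> g j j' * (if i = b j' then 1 else 0)) =
        (\<Sum>i'\<in>I. (if i' = b j then 1 else 0) * \<rho> g i' i)" .
  qed
  moreover have "group_rep G W"
  proof (intro group_rep.intro group_rep_axioms.intro)
    show "group G" by (rule G)
    show "kmodule W" by (rule coordsD(1)[OF CX])
  next
    fix g x assume gx: "g \<in> carrier G" "x \<in> carrier W"
    show "act W g x \<in> carrier W" by (simp add: sel mvec_vecs)
    show "act W g (c \<odot>\<^bsub>W\<^esub> x) = c \<odot>\<^bsub>W\<^esub> act W g x" for c
      by (rule ext) (simp add: sel mvec_def sum_distrib_left mult.left_commute)
    show "act W g (x \<oplus>\<^bsub>W\<^esub> y) = act W g x \<oplus>\<^bsub>W\<^esub> act W g y" for y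
      by (rule ext) (simp add: sel mvec_def distrib_left sum.distrib)
    show "act W (g \<otimes>\<^bsub>G\<^esub> h) x = act W g (act W h x)" if "h \<in> carrier G" for h
      using mvec_mat_hom(1)[OF \<tau>_hom _ gx(1) that] by (simp add: sel)
  next
    fix x assume "x \<in> carrier W"
    then show "act W \<one>\<^bsub>G\<^esub> x = x" using mvec_mat_hom(2)[OF \<tau>_hom] by (simp add: sel)
  qed
  ultimately show ?thesis by blast
qed

lemma iso_class_eq_iff:
  fixes M :: "('g, 'k :: field, 'v) gmod" and N :: "('g, 'k, 'w) gmod"
  assumes M: "rep_coords G M I \<rho> \<kappa>" "mat_hom G I \<rho>" and N: "rep_coords G N J \<tau> \<eta>" and G: "group G"
  shows "iso_class G M = iso_class G N \<longleftrightarrow> rep_iso G M N"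
proof
  assume eq: "iso_class G M = iso_class G N"
  obtain W :: "('g, 'k, nat \<Rightarrow> 'k) gmod" where W: "group_rep G W" "rep_iso G M W"
    using ex_standard_model[OF M G] by blast
  then have "rep_iso G N W" using eq by (auto simp: iso_class_def)
  then show "rep_iso G M N" using W(2) rep_iso_sym[OF _ N] rep_iso_trans by blast
next
  assume MN: "rep_iso G M N"
  have NM: "rep_iso G N M" by (rule rep_iso_sym[OF MN M(1)])
  show "iso_class G M = iso_class G N"
    unfolding iso_class_def using rep_iso_trans[OF MN] rep_iso_trans[OF NM] by blast
qed

subsection \<open>The group \<open>SL\<^sub>2\<close>\<close>

lemma SL2_sel [simp]:
  "carrier SL2 = {A. det A = 1}" "monoid.mult SL2 = (**)" "one SL2 = mat 1"
  by (simp_all add: SL2_def)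

lemma group_SL2: "group (SL2 :: ('k :: field ^ 2 ^ 2) monoid)"
proof (rule groupI)
  fix A :: "'k ^ 2 ^ 2" assume A: "A \<in> carrier SL2"
  then have "invertible A" by (simp add: invertible_det_nz)
  then obtain B where B: "A ** B = mat 1" "B ** A = mat 1" by (auto simp: invertible_def)
  have "det B * det A = 1" using B(2) by (metis det_I det_mul)
  then show "\<exists>y\<in>carrier SL2. y \<otimes>\<^bsub>SL2\<^esub> A = \<one>\<^bsub>SL2\<^esub>"
    using A B by (intro bexI[of _ B]) auto
qed (auto simp: det_mul det_I matrix_mul_assoc)

definition mat2 :: "'k \<Rightarrow> 'k \<Rightarrow> 'k \<Rightarrow> 'k \<Rightarrow> 'k ^ 2 ^ 2" where
  "mat2 a b c d = (\<chi> i j. if i = 1 then if j = 1 then a else b else if j = 1 then c else d)"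

lemma mat2_nth [simp]:
  "mat2 a b c d $ 1 $ 1 = a" "mat2 a b c d $ 1 $ 2 = b" "mat2 a b c d $ 2 $ 1 = c" "mat2 a b c d $ 2 $ 2 = d"
  by (simp_all add: mat2_def)

lemma mat2_eqI:
  fixes A B :: "'k ^ 2 ^ 2"
  assumes "A $ 1 $ 1 = B $ 1 $ 1" "A $ 1 $ 2 = B $ 1 $ 2" "A $ 2 $ 1 = B $ 2 $ 1" "A $ 2 $ 2 = B $ 2 $ 2"
  shows "A = B"
  using assms by (simp add: vec_eq_iff forall_2)

lemma matrix_mult_2:
  fixes A B :: "'k :: comm_ring_1 ^ 2 ^ 2"
  shows "(A ** B) $ i $ j = A $ i $ 1 * B $ 1 $ j + A $ i $ 2 * B $ 2 $ j"
  by (simp add: matrix_matrix_mult_def sum_2)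

lemma inv_SL2:
  fixes g :: "'k :: field ^ 2 ^ 2"
  assumes "g \<in> carrier SL2"
  shows "inv\<^bsub>SL2\<^esub> g = mat2 (g $ 2 $ 2) (- g $ 1 $ 2) (- g $ 2 $ 1) (g $ 1 $ 1)"
proof (rule group.inv_equality[OF group_SL2])
  have det: "g $ 1 $ 1 * g $ 2 $ 2 - g $ 1 $ 2 * g $ 2 $ 1 = 1" using assms by (simp add: det_2)
  then show "mat2 (g $ 2 $ 2) (- g $ 1 $ 2) (- g $ 2 $ 1) (g $ 1 $ 1) \<otimes>\<^bsub>SL2\<^esub> g = \<one>\<^bsub>SL2\<^esub>"
    by (intro mat2_eqI) (simp_all add: matrix_mult_2 mat_def algebra_simps)
  show "mat2 (g $ 2 $ 2) (- g $ 1 $ 2) (- g $ 2 $ 1) (g $ 1 $ 1) \<in> carrier SL2"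
    using det by (simp add: det_2 algebra_simps)
qed (rule assms)

definition entry :: "'k ^ 2 ^ 2 \<Rightarrow> 2 \<Rightarrow> 2 \<Rightarrow> 'k" where
  "entry g = (\<lambda>i j. g $ i $ j)"

definition weyl :: "'k :: field ^ 2 ^ 2" where
  "weyl = mat2 0 1 (-1) 0"

lemma weyl_SL2: "weyl \<in> carrier SL2"
  by (simp add: weyl_def det_2)

text \<open>Hence the natural representation is self-dual.\<close>

lemma entry_inv:
  assumes g: "g \<in> carrier SL2"
  shows "entry (inv\<^bsub>SL2\<^esub> g) j i = entry (weyl \<otimes>\<^bsub>SL2\<^esub> g \<otimes>\<^bsub>SL2\<^esub> inv\<^bsub>SL2\<^esub> weyl) i j"
proof -
  have "\<forall>i j. (inv\<^bsub>SL2\<^esub> g) $ j $ i = (weyl \<otimes>\<^bsub>SL2\<^esub> g \<otimes>\<^bsub>SL2\<^esub> inv\<^bsub>SL2\<^esub> weyl) $ i $ j"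
    unfolding inv_SL2[OF g] inv_SL2[OF weyl_SL2]
    by (simp add: forall_2 matrix_mult_2) (simp add: weyl_def)
  then show ?thesis by (simp add: entry_def)
qed

lemma rep_coords_natural:
  "rep_coords SL2 (natural_rep :: ('k :: field ^ 2 ^ 2, 'k, 'k ^ 2) gmod) UNIV entry vec_nth"
proof -
  have "coords (natural_rep :: ('k ^ 2 ^ 2, 'k, 'k ^ 2) gmod) UNIV vec_nth"
  proof (rule coordsI)
    show "bij_betw vec_nth (carrier (natural_rep :: ('k ^ 2 ^ 2, 'k, 'k ^ 2) gmod)) (vecs UNIV)"
      by (rule bij_betw_byWitness[where f' = vec_lambda]) (auto simp: natural_rep_def vecs_def)
  qed (auto simp: natural_rep_def lin_to_def vecs_def)
  then show ?thesis
    by (auto simp: rep_coords_def natural_rep_def matrix_vector_mult_def entry_def)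
qed

lemma mat_hom_natural: "mat_hom SL2 UNIV entry"
  by (auto simp: mat_hom_def entry_def mmul_def matrix_matrix_mult_def diag_def mat_def)

lemma ex_coords_upper:
  assumes "rep_coords G V I \<rho> \<kappa>"
  shows "\<exists>\<eta>. rep_coords G (Sym\<^sup>U r V) (multisets_of_size I r) (\<lambda>g. symU (\<rho> g)) \<eta>"
proof -
  interpret tensor_coords V I \<kappa> r by (rule tensor_coords.intro[OF rep_coordsD(1)[OF assms]])
  show ?thesis using rep_coords_upper_sym[OF assms] by blast
qed

lemma ex_coords_lower:
  assumes "rep_coords G V I \<rho> \<kappa>"
  shows "\<exists>\<eta>. rep_coords G (Sym\<^sub>L r V) (multisets_of_size I r) (\<lambda>g. symL (\<rho> g)) \<eta>"
proof -
  interpret tensor_coords V I \<kappa> r by (rule tensor_coords.intro[OF rep_coordsD(1)[OF assms]])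
  show ?thesis using rep_coords_lower_sym[OF assms] by blast
qed

abbreviation Idx :: "nat \<Rightarrow> nat \<Rightarrow> 2 multiset multiset set" where
  "Idx r s \<equiv> multisets_of_size (multisets_of_size UNIV s) r"

lemma finite_Idx: "finite (multisets_of_size (UNIV :: 2 set) s)" "finite (Idx r s)"
  by (intro finite_multisets_of_size; simp)+

lemma coords_plethysm:
  fixes r s :: nat
  shows "\<exists>\<kappa>. rep_coords SL2 (Sym\<^sup>U r (Sym\<^sup>U s natural_rep)) (Idx r s) (\<lambda>g :: 'k :: field ^ 2 ^ 2. symU (symU (entry g))) \<kappa>"
    and "\<exists>\<kappa>. rep_coords SL2 (Sym\<^sup>U r (Sym\<^sub>L s natural_rep)) (Idx r s) (\<lambda>g :: 'k ^ 2 ^ 2. symU (symL (entry g))) \<kappa>"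
    and "\<exists>\<kappa>. rep_coords SL2 (Sym\<^sub>L r (Sym\<^sup>U s natural_rep)) (Idx r s) (\<lambda>g :: 'k ^ 2 ^ 2. symL (symU (entry g))) \<kappa>"
    and "\<exists>\<kappa>. rep_coords SL2 (Sym\<^sub>L r (Sym\<^sub>L s natural_rep)) (Idx r s) (\<lambda>g :: 'k ^ 2 ^ 2. symL (symL (entry g))) \<kappa>"
proof -
  obtain u where u: "rep_coords SL2 (Sym\<^sup>U s natural_rep)
      (multisets_of_size UNIV s) (\<lambda>g :: 'k ^ 2 ^ 2. symU (entry g)) u"
    using ex_coords_upper[OF rep_coords_natural, of s] by (rule exE)
  obtain l where l: "rep_coords SL2 (Sym\<^sub>L s natural_rep)
      (multisets_of_size UNIV s) (\<lambda>g :: 'k ^ 2 ^ 2. symL (entry g)) l"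
    using ex_coords_lower[OF rep_coords_natural, of s] by (rule exE)
  show "\<exists>\<kappa>. rep_coords SL2 (Sym\<^sup>U r (Sym\<^sup>U s natural_rep)) (Idx r s) (\<lambda>g :: 'k ^ 2 ^ 2. symU (symU (entry g))) \<kappa>"
    by (rule ex_coords_upper[OF u])
  show "\<exists>\<kappa>. rep_coords SL2 (Sym\<^sup>U r (Sym\<^sub>L s natural_rep)) (Idx r s) (\<lambda>g :: 'k ^ 2 ^ 2. symU (symL (entry g))) \<kappa>"
    by (rule ex_coords_upper[OF l])
  show "\<exists>\<kappa>. rep_coords SL2 (Sym\<^sub>L r (Sym\<^sup>U s natural_rep)) (Idx r s) (\<lambda>g :: 'k ^ 2 ^ 2. symL (symU (entry g))) \<kappa>"
    by (rule ex_coords_lower[OF u])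
  show "\<exists>\<kappa>. rep_coords SL2 (Sym\<^sub>L r (Sym\<^sub>L s natural_rep)) (Idx r s) (\<lambda>g :: 'k ^ 2 ^ 2. symL (symL (entry g))) \<kappa>"
    by (rule ex_coords_lower[OF l])
qed

lemma mat_hom_plethysm:
  shows "mat_hom SL2 (Idx r s) (\<lambda>g. symU (symU (entry g)))"
    and "mat_hom SL2 (Idx r s) (\<lambda>g. symU (symL (entry g)))"
    and "mat_hom SL2 (Idx r s) (\<lambda>g. symL (symU (entry g)))"
    and "mat_hom SL2 (Idx r s) (\<lambda>g. symL (symL (entry g)))"
  by (rule mat_hom_symU mat_hom_symL mat_hom_natural finite_Idx finite)+

lemma hermite_reciprocity:
  "rep_iso SL2 (Sym\<^sup>U l (Sym\<^sub>L m (natural_rep :: ('k :: field ^ 2 ^ 2, 'k, 'k ^ 2) gmod))) (Sym\<^sub>L m (Sym\<^sup>U l natural_rep))"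
proof -
  obtain \<kappa> where M: "rep_coords SL2 (Sym\<^sup>U l (Sym\<^sub>L m (natural_rep :: ('k ^ 2 ^ 2, 'k, 'k ^ 2) gmod)))
      (Idx l m) (\<lambda>g. symU (symL (entry g))) \<kappa>" using coords_plethysm(2) by blast
  obtain \<eta> where N: "rep_coords SL2 (Sym\<^sub>L m (Sym\<^sup>U l (natural_rep :: ('k ^ 2 ^ 2, 'k, 'k ^ 2) gmod)))
      (Idx m l) (\<lambda>g. symL (symU (entry g))) \<eta>" using coords_plethysm(3) by blast
  show ?thesis
    by (rule rep_iso_intertwine[OF M N hermite_bij hermite_equivariant])
qed

lemma dual_coords_conj:
  fixes M :: "('k :: field ^ 2 ^ 2, 'k, 'v) gmod" and N :: "('k ^ 2 ^ 2, 'k, 'w) gmod"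
  assumes M: "rep_coords SL2 M (Idx r s) \<rho> \<kappa>" and N: "rep_coords SL2 N (Idx r s) \<tau> \<eta>"
    and \<tau>: "mat_hom SL2 (Idx r s) \<tau>"
    and eq: "\<And>g i j. g \<in> carrier SL2 \<Longrightarrow> i \<in> Idx r s \<Longrightarrow> j \<in> Idx r s \<Longrightarrow>
      \<rho> (inv\<^bsub>SL2\<^esub> g) j i = \<tau> (weyl \<otimes>\<^bsub>SL2\<^esub> g \<otimes>\<^bsub>SL2\<^esub> inv\<^bsub>SL2\<^esub> weyl) i j"
  shows "rep_iso SL2 (dual_rep SL2 M) N"
  by (rule rep_iso_conjugate[OF rep_coords_dual[OF M group_SL2] N \<tau> group_SL2 weyl_SL2 eq])

lemma symU_transpose:
  assumes "\<mu> \<in> multisets_of_size I r" "\<nu> \<in> multisets_of_size I r"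
    and "\<And>i j. i \<in> I \<Longrightarrow> j \<in> I \<Longrightarrow> A j i = B i j"
  shows "symU A \<nu> \<mu> = symL B \<mu> \<nu>" "symL A \<nu> \<mu> = symU B \<mu> \<nu>"
proof -
  have sz: "size \<mu> = size \<nu>" using assms by (simp add: multisets_of_sizeD)
  have "symU A \<nu> \<mu> = symL (\<lambda>i j. A j i) \<mu> \<nu>" using sz by (simp add: symL_symU)
  also have "\<dots> = symL B \<mu> \<nu>" by (rule symL_cong[OF assms(3) assms(1,2)])
  finally show "symU A \<nu> \<mu> = symL B \<mu> \<nu>" .
  have "symL A \<nu> \<mu> = symU (\<lambda>i j. A j i) \<mu> \<nu>" using sz by (simp add: symL_symU)
  also have "\<dots> = symU B \<mu> \<nu>" by (rule symU_cong[OF assms(3) assms(1,2)])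
  finally show "symL A \<nu> \<mu> = symU B \<mu> \<nu>" .
qed

lemma dual_plethysm:
  fixes r s :: nat
  defines "E \<equiv> natural_rep :: ('k :: field ^ 2 ^ 2, 'k, 'k ^ 2) gmod"
  shows "rep_iso SL2 (dual_rep SL2 (Sym\<^sup>U r (Sym\<^sup>U s E))) (Sym\<^sub>L r (Sym\<^sub>L s E))"
    and "rep_iso SL2 (dual_rep SL2 (Sym\<^sup>U r (Sym\<^sub>L s E))) (Sym\<^sub>L r (Sym\<^sup>U s E))"
    and "rep_iso SL2 (dual_rep SL2 (Sym\<^sub>L r (Sym\<^sup>U s E))) (Sym\<^sup>U r (Sym\<^sub>L s E))"
    and "rep_iso SL2 (dual_rep SL2 (Sym\<^sub>L r (Sym\<^sub>L s E))) (Sym\<^sup>U r (Sym\<^sup>U s E))"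
proof -
  obtain \<kappa>1 where 1: "rep_coords SL2 (Sym\<^sup>U r (Sym\<^sup>U s E)) (Idx r s) (\<lambda>g. symU (symU (entry g))) \<kappa>1"
    unfolding E_def using coords_plethysm(1) by blast
  obtain \<kappa>2 where 2: "rep_coords SL2 (Sym\<^sup>U r (Sym\<^sub>L s E)) (Idx r s) (\<lambda>g. symU (symL (entry g))) \<kappa>2"
    unfolding E_def using coords_plethysm(2) by blast
  obtain \<kappa>3 where 3: "rep_coords SL2 (Sym\<^sub>L r (Sym\<^sup>U s E)) (Idx r s) (\<lambda>g. symL (symU (entry g))) \<kappa>3"
    unfolding E_def using coords_plethysm(3) by blast
  obtain \<kappa>4 where 4: "rep_coords SL2 (Sym\<^sub>L r (Sym\<^sub>L s E)) (Idx r s) (\<lambda>g. symL (symL (entry g))) \<kappa>4"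
    unfolding E_def using coords_plethysm(4) by blast
  \<comment> \<open>Transposition passes from the entries through the inner power to the outer one,
    and each passage exchanges upper and lower.\<close>
  note tr = symU_transpose[OF _ _ symU_transpose(1)[OF _ _ entry_inv]]
    symU_transpose[OF _ _ symU_transpose(2)[OF _ _ entry_inv]]
  show "rep_iso SL2 (dual_rep SL2 (Sym\<^sup>U r (Sym\<^sup>U s E))) (Sym\<^sub>L r (Sym\<^sub>L s E))"
    by (rule dual_coords_conj[OF 1 4 mat_hom_plethysm(4)], rule tr(1)) assumption+
  show "rep_iso SL2 (dual_rep SL2 (Sym\<^sup>U r (Sym\<^sub>L s E))) (Sym\<^sub>L r (Sym\<^sup>U s E))"
    by (rule dual_coords_conj[OF 2 3 mat_hom_plethysm(3)], rule tr(3)) assumption+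
  show "rep_iso SL2 (dual_rep SL2 (Sym\<^sub>L r (Sym\<^sup>U s E))) (Sym\<^sup>U r (Sym\<^sub>L s E))"
    by (rule dual_coords_conj[OF 3 2 mat_hom_plethysm(2)], rule tr(2)) assumption+
  show "rep_iso SL2 (dual_rep SL2 (Sym\<^sub>L r (Sym\<^sub>L s E))) (Sym\<^sup>U r (Sym\<^sup>U s E))"
    by (rule dual_coords_conj[OF 4 1 mat_hom_plethysm(1)], rule tr(4)) assumption+
qed

subsection \<open>Generating functions\<close>

text \<open>Formal polynomials in commuting variables indexed by \<open>'i\<close> are the finitely supported
  functions on the multisets over \<open>'i\<close>.\<close>

definition indet :: "'i \<Rightarrow> 'i multiset \<Rightarrow>\<^sub>0 'k :: comm_semiring_1" where
  "indet i = Poly_Mapping.single {#i#} 1"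

definition lin_form :: "'i set \<Rightarrow> ('i \<Rightarrow> 'k) \<Rightarrow> 'i multiset \<Rightarrow>\<^sub>0 'k :: comm_semiring_1" where
  "lin_form I c = (\<Sum>i\<in>I. Poly_Mapping.single {#i#} (c i))"

lemma wtype_Suc: "wtype (Suc r) s = add_mset (s r) (wtype r s)"
  by (simp add: wtype_def lessThan_Suc)

lemma prod_single:
  "(\<Prod>k<r. Poly_Mapping.single {#s k#} (c k)) = Poly_Mapping.single (wtype r s) (\<Prod>k<r. c k :: 'k :: comm_semiring_1)"
proof (induction r)
  case 0
  then show ?case by (simp add: wtype_def)
next
  case (Suc r)
  then show ?case by (simp add: mult_single wtype_Suc)
qed

lemma indet_power: "indet i ^ n = (Poly_Mapping.single (replicate_mset n i) 1 :: _ \<Rightarrow>\<^sub>0 'k :: comm_semiring_1)"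
  by (induction n) (simp_all add: indet_def mult_single)

text \<open>Choosing one variable from each factor is choosing a word, and the words that yield the
  monomial \<open>\<mu>\<close> form \<open>words \<mu>\<close>. Upper powers thus act by
  substitution of linear forms, and the computation of their columns becomes polynomial
  algebra.\<close>

lemma lookup_genfun:
  fixes A :: "'i \<Rightarrow> 'j \<Rightarrow> 'k :: comm_semiring_1"
  assumes I: "finite I" and \<mu>: "\<mu> \<in> multisets_of_size I r" and \<nu>: "size \<nu> = r"
  shows "Poly_Mapping.lookup (prod_mset (image_mset (\<lambda>j. lin_form I (\<lambda>i. A i j)) \<nu>)) \<mu> = symU A \<mu> \<nu>"
proof -
  let ?t = "word \<nu>"
  have "prod_mset (image_mset (\<lambda>j. lin_form I (\<lambda>i. A i j)) \<nu>) = (\<Prod>k<r. lin_form I (\<lambda>i. A i (?t k)))"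
    using prod_word[OF word_words, of "\<lambda>j. lin_form I (\<lambda>i. A i j)" \<nu>] \<nu> by simp
  also have "\<dots> = (\<Sum>s\<in>tuples r I. Poly_Mapping.single (wtype r s) (\<Prod>k<r. A (s k) (?t k)))"
    unfolding lin_form_def using I by (subst prod_sum_PiE) (simp_all add: prod_single)
  finally have "Poly_Mapping.lookup (prod_mset (image_mset (\<lambda>j. lin_form I (\<lambda>i. A i j)) \<nu>)) \<mu> =
      (\<Sum>s\<in>tuples r I. if wtype r s = \<mu> then \<Prod>k<r. A (s k) (?t k) else 0)"
    by (simp add: lookup_sum lookup_single when_def)
  also have "\<dots> = (\<Sum>s\<in>{s \<in> tuples r I. wtype r s = \<mu>}. \<Prod>k<r. A (s k) (?t k))"
    using I by (intro sum.inter_filter[symmetric] finite_PiE) auto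
  also have "\<dots> = symU A \<mu> \<nu>" by (simp add: symU_def \<nu> words_tuples[OF \<mu>])
  finally show ?thesis .
qed

lemma CHAR_poly_mapping: "CHAR('i multiset \<Rightarrow>\<^sub>0 'k :: comm_semiring_1) = CHAR('k)"
proof (rule CHAR_eqI)
  have single: "(of_nat n :: 'i multiset \<Rightarrow>\<^sub>0 'k) = Poly_Mapping.single 0 (of_nat n)" for n
    by (simp add: single_of_nat)
  show "(of_nat CHAR('k) :: 'i multiset \<Rightarrow>\<^sub>0 'k) = 0" by (simp add: single del: single_of_nat)
  fix n assume "(of_nat n :: 'i multiset \<Rightarrow>\<^sub>0 'k) = 0"
  then have "(of_nat n :: 'k) = 0" unfolding single by (metis lookup_single_eq lookup_zero)
  then show "CHAR('k) dvd n" by (simp add: of_nat_eq_0_iff_char_dvd)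
qed

lemma words_replicate: "words (replicate_mset r j) = {restrict (\<lambda>_. j) {..<r}}"
proof (rule antisym)
  have "wtype r (restrict (\<lambda>_. j) {..<r}) = wtype r (\<lambda>_. j)" by (rule wtype_cong) simp
  also have "\<dots> = replicate_mset r j" by (simp add: wtype_def image_mset_const_eq)
  finally show "{restrict (\<lambda>_. j) {..<r}} \<subseteq> words (replicate_mset r j)" by (simp add: words_def)
  show "words (replicate_mset r j) \<subseteq> {restrict (\<lambda>_. j) {..<r}}"
  proof
    fix t assume t: "t \<in> words (replicate_mset r j)"
    have "t k = j" if "k < r" for k
      using words_in[of "replicate_mset r j" "{j}" r t k] t that by (auto simp: multisets_of_size_def split: if_splits)
    moreover have "t \<in> extensional {..<r}" using wordsD(1)[OF t] by simp
    ultimately show "t \<in> {restrict (\<lambda>_. j) {..<r}}" by (auto simp: extensional_def restrict_def)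
  qed
qed

text \<open>\<open>card (words \<mu>)\<close> is a multinomial coefficient, so compare coefficients in
  \<open>(\<Sum>\<^sub>i x\<^sub>i)\<^sup>r = \<Sum>\<^sub>i x\<^sub>i\<^sup>r\<close>.\<close>

lemma card_words_char:
  fixes \<mu> :: "'i multiset"
  assumes p: "prime p" "CHAR('k :: field) = p" and sz: "size \<mu> = p ^ n"
  shows "of_nat (card (words \<mu>)) \<noteq> (0 :: 'k) \<longleftrightarrow> (\<exists>i. \<mu> = replicate_mset (p ^ n) i)"
proof
  assume nz: "of_nat (card (words \<mu>)) \<noteq> (0 :: 'k)"
  let ?I = "set_mset \<mu>" and ?r = "p ^ n"
  \<comment> \<open>A matrix of ones with a single column, indexed by \<open>()\<close>: the
    corresponding product is the generating function of the multinomial coefficients.\<close>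
  let ?\<nu> = "replicate_mset ?r ()"
  have \<mu>: "\<mu> \<in> multisets_of_size ?I ?r" using sz by (simp add: multisets_of_size_def)
  have lf: "lin_form ?I (\<lambda>_. 1) = (\<Sum>i\<in>?I. indet i :: 'i multiset \<Rightarrow>\<^sub>0 'k)"
    by (simp add: lin_form_def indet_def)
  have "prod_mset (image_mset (\<lambda>j. lin_form ?I (\<lambda>_. 1)) ?\<nu>) = (\<Sum>i\<in>?I. indet i :: 'i multiset \<Rightarrow>\<^sub>0 'k) ^ ?r"
    by (simp add: lf)
  also have "\<dots> = (\<Sum>i\<in>?I. indet i ^ ?r)"
    using p by (intro freshmans_dream_sum') (auto simp: CHAR_poly_mapping)
  finally have "symU (\<lambda>_ _. 1 :: 'k) \<mu> ?\<nu> = (\<Sum>i\<in>?I. if replicate_mset ?r i = \<mu> then 1 else 0)"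
    using lookup_genfun[OF _ \<mu>, of ?\<nu> "\<lambda>_ _. 1 :: 'k"]
    by (simp add: indet_power lookup_sum lookup_single when_def)
  moreover have "symU (\<lambda>_ _. 1 :: 'k) \<mu> ?\<nu> = of_nat (card (words \<mu>))" by (simp add: symU_def)
  ultimately have "(\<Sum>i\<in>?I. if replicate_mset ?r i = \<mu> then 1 else 0 :: 'k) \<noteq> 0" using nz by simp
  then obtain i where "(if replicate_mset ?r i = \<mu> then 1 else 0 :: 'k) \<noteq> 0" by (rule sum.not_neutral_contains_not_neutral)
  then show "\<exists>i. \<mu> = replicate_mset ?r i" by (metis (full_types))
qed (auto simp: words_replicate)

subsection \<open>Weights\<close>

definition level :: "2 multiset multiset \<Rightarrow> nat" where
  "level M = sum_mset (image_mset (\<lambda>\<mu>. count \<mu> 2) M)"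

definition torus :: "'k :: field \<Rightarrow> 'k ^ 2 ^ 2" where
  "torus a = mat2 a 0 0 (inverse a)"

definition weight :: "'k :: field \<Rightarrow> 2 multiset multiset \<Rightarrow> 'k" where
  "weight a M = prod_mset (image_mset (\<lambda>\<mu>. prod_mset (image_mset (\<lambda>i. if i = 1 then a else inverse a) \<mu>)) M)"

lemma torus_SL2: "a \<noteq> 0 \<Longrightarrow> torus a \<in> carrier SL2"
  by (simp add: torus_def det_2)

lemma entry_torus: "entry (torus a) = diag (\<lambda>i. if i = 1 then a else inverse a)"
proof (intro ext)
  fix i j :: 2
  show "entry (torus a) i j = diag (\<lambda>i. if i = 1 then a else inverse a) i j"
    using exhaust_2[of i] exhaust_2[of j] by (auto simp: entry_def torus_def diag_def)
qed

lemma torus_plethysm: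
  assumes "i \<in> Idx r s" "j \<in> Idx r s"
  shows "symU (symU (entry (torus a))) i j = diag (weight a) i j"
    and "symU (symL (entry (torus a))) i j = diag (weight a) i j"
    and "symL (symU (entry (torus a))) i j = diag (weight a) i j"
    and "symL (symL (entry (torus a))) i j = diag (weight a) i j"
proof -
  let ?d = "\<lambda>\<mu>. prod_mset (image_mset (\<lambda>i :: 2. if i = 1 then a else inverse a) \<mu>)"
  have inner: "symU (entry (torus a)) \<mu> \<nu> = diag ?d \<mu> \<nu>" "symL (entry (torus a)) \<mu> \<nu> = diag ?d \<mu> \<nu>"
    if "\<mu> \<in> multisets_of_size UNIV s" "\<nu> \<in> multisets_of_size UNIV s" for \<mu> \<nu>
    using that by (simp_all add: entry_torus symU_diag symL_diag multisets_of_sizeD)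
  have outer: "symU (diag ?d) i j = diag (weight a) i j" "symL (diag ?d) i j = diag (weight a) i j"
    using assms by (simp_all add: symU_diag symL_diag multisets_of_sizeD weight_def[abs_def])
  show "symU (symU (entry (torus a))) i j = diag (weight a) i j"
    using symU_cong[OF inner(1) assms] outer by simp
  show "symU (symL (entry (torus a))) i j = diag (weight a) i j"
    using symU_cong[OF inner(2) assms] outer by simp
  show "symL (symU (entry (torus a))) i j = diag (weight a) i j"
    using symL_cong[OF inner(1) assms] outer by simp
  show "symL (symL (entry (torus a))) i j = diag (weight a) i j"
    using symL_cong[OF inner(2) assms] outer by simp
qed

text \<open>The weight is a power of \<open>a\<close> whose exponent may be negative, so the formula
  is stated with denominators cleared.\<close>

lemma weight_level:
  fixes a :: "'k :: field"
  assumes a: "a \<noteq> 0"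
  shows "weight a M * a ^ (2 * level M) = a ^ sum_mset (image_mset size M)"
proof -
  let ?d = "\<lambda>\<mu>. prod_mset (image_mset (\<lambda>i :: 2. if i = 1 then a else inverse a) \<mu>)"
  have d: "?d \<mu> * a ^ (2 * count \<mu> 2) = a ^ size \<mu>" for \<mu>
  proof (induction \<mu>)
    case (add x \<mu>)
    then show ?case using a exhaust_2[of x] by (auto simp: field_simps power2_eq_square)
  qed simp
  show ?thesis
  proof (induction M)
    case (add \<mu> M)
    have "weight a (add_mset \<mu> M) * a ^ (2 * level (add_mset \<mu> M)) =
        (?d \<mu> * a ^ (2 * count \<mu> 2)) * (weight a M * a ^ (2 * level M))"
      by (simp add: weight_def level_def power_add algebra_simps)
    then show ?case by (simp only: d add) (simp add: power_add)
  qed (simp add: weight_def level_def)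
qed

lemma sum_size_Idx: "M \<in> Idx r s \<Longrightarrow> sum_mset (image_mset size M) = r * s"
proof -
  assume M: "M \<in> Idx r s"
  then have "image_mset size M = image_mset (\<lambda>_. s) M"
    by (intro image_mset_cong) (auto simp: multisets_of_size_def)
  then show ?thesis using M by (simp add: multisets_of_sizeD image_mset_const_eq sum_mset_replicate_mset)
qed

lemma level_le: "M \<in> Idx r s \<Longrightarrow> level M \<le> r * s"
proof -
  assume M: "M \<in> Idx r s"
  have "level M \<le> sum_mset (image_mset size M)"
    unfolding level_def by (intro sum_mset_mono) (simp add: count_1_2)
  then show ?thesis using sum_size_Idx[OF M] by simp
qed

text \<open>Otherwise, for m < n, the nonzero polynomial X^(n - m) - 1 would vanish at every nonzero
  element of the field.\<close>

lemma powers_separated: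
  fixes m n :: nat
  assumes big: "infinite (UNIV :: 'k :: field set) \<or> card (UNIV :: 'k set) > 1 + N"
    and eq: "\<And>a :: 'k. a \<noteq> 0 \<Longrightarrow> a ^ m = a ^ n" and "m \<le> N" "n \<le> N"
  shows "m = n"
proof -
  have *: False if "m < n" "n \<le> N" and eq: "\<And>a :: 'k. a \<noteq> 0 \<Longrightarrow> a ^ m = a ^ n" for m n :: nat
  proof -
    define P where "P = monom (1 :: 'k) (n - m) - 1"
    have "coeff P (n - m) = 1" using that(1) by (simp add: P_def)
    then have P: "P \<noteq> 0" by auto
    have deg: "degree P \<le> n - m" unfolding P_def by (intro degree_diff_le degree_monom_le) simp
    have root: "poly P a = 0" if "a \<noteq> 0" for a
    proof -
      have "a ^ m * a ^ (n - m) = a ^ n" using \<open>m < n\<close> by (simp flip: power_add)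
      then have "a ^ m * a ^ (n - m) = a ^ m" by (simp only: eq[OF that])
      then have "a ^ (n - m) = 1" using that by simp
      then show ?thesis by (simp add: P_def poly_monom)
    qed
    let ?R = "{a. poly P a = 0}"
    have fin: "finite ?R" by (rule poly_roots_finite[OF P])
    \<comment> \<open>The element 0 may fail to be a root; it accounts for the summand 1 in the
      bound.\<close>
    have sub: "UNIV \<subseteq> insert 0 ?R" using root by auto
    then have "finite (UNIV :: 'k set)" using fin by (meson finite_insert finite_subset)
    then have "card (UNIV :: 'k set) > 1 + N" using big by simp
    moreover have "card (UNIV :: 'k set) \<le> card (insert 0 ?R)" using sub fin by (intro card_mono) auto
    moreover have "card (insert 0 ?R) \<le> Suc (card ?R)" by (rule card_insert_le_m1) simp_all
    moreover have "card ?R \<le> n - m" using card_poly_roots_bound[OF P] deg by simp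
    ultimately show False using that(2) by simp
  qed
  show ?thesis using *[of m n] *[of n m] assms by (metis linorder_neqE_nat)
qed

text \<open>The torus is diagonal on both sides, so a nonzero entry of \<open>F\<close> equates two
  weights for every nonzero \<open>a\<close>, and thereby two levels.\<close>

lemma level_intertwiner:
  fixes M :: "('k :: field ^ 2 ^ 2, 'k, 'v) gmod" and N :: "('k ^ 2 ^ 2, 'k, 'w) gmod"
  assumes iso: "rep_iso SL2 M N"
    and M: "rep_coords SL2 M (Idx r s) \<rho> \<kappa>" and N: "rep_coords SL2 N (Idx r' s') \<tau> \<eta>"
    and \<rho>: "\<And>a i j. i \<in> Idx r s \<Longrightarrow> j \<in> Idx r s \<Longrightarrow> \<rho> (torus a) i j = diag (weight a) i j"
    and \<tau>: "\<And>a i j. i \<in> Idx r' s' \<Longrightarrow> j \<in> Idx r' s' \<Longrightarrow> \<tau> (torus a) i j = diag (weight a) i j"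
    and rs: "r' * s' = r * s"
    and big: "infinite (UNIV :: 'k set) \<or> card (UNIV :: 'k set) > 1 + 2 * (r * s)"
  obtains F where
    "\<And>c. c \<in> vecs (Idx r s) \<Longrightarrow> (\<And>j. j \<in> Idx r' s' \<Longrightarrow> (\<Sum>i\<in>Idx r s. F j i * c i) = 0) \<Longrightarrow> c = (\<lambda>_. 0)"
    "\<And>g i j. g \<in> carrier SL2 \<Longrightarrow> i \<in> Idx r s \<Longrightarrow> j \<in> Idx r' s' \<Longrightarrow>
      (\<Sum>j'\<in>Idx r' s'. \<tau> g j j' * F j' i) = (\<Sum>i'\<in>Idx r s. F j i' * \<rho> g i' i)"
    "\<And>i j. i \<in> Idx r s \<Longrightarrow> j \<in> Idx r' s' \<Longrightarrow> F j i \<noteq> 0 \<Longrightarrow> level j = level i"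
proof -
  obtain F where F:
    "\<And>c. c \<in> vecs (Idx r s) \<Longrightarrow> (\<And>j. j \<in> Idx r' s' \<Longrightarrow> (\<Sum>i\<in>Idx r s. F j i * c i) = 0) \<Longrightarrow> c = (\<lambda>_. 0)"
    "\<And>g i j. g \<in> carrier SL2 \<Longrightarrow> i \<in> Idx r s \<Longrightarrow> j \<in> Idx r' s' \<Longrightarrow>
      (\<Sum>j'\<in>Idx r' s'. \<tau> g j j' * F j' i) = (\<Sum>i'\<in>Idx r s. F j i' * \<rho> g i' i)"
    using rep_iso_matrix[OF iso M N] by blast
  show thesis
  proof (rule that[OF F])
    fix i j assume i: "i \<in> Idx r s" and j: "j \<in> Idx r' s'" and nz: "F j i \<noteq> 0"
    have "a ^ (2 * level j) = a ^ (2 * level i)" if a: "a \<noteq> 0" for a :: 'k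
    proof -
      have "(\<Sum>j'\<in>Idx r' s'. \<tau> (torus a) j j' * F j' i) = (\<Sum>j'\<in>Idx r' s'. diag (weight a) j j' * F j' i)"
        by (intro sum.cong refl) (simp add: \<tau> j)
      moreover have "(\<Sum>i'\<in>Idx r s. F j i' * \<rho> (torus a) i' i) = (\<Sum>i'\<in>Idx r s. F j i' * diag (weight a) i' i)"
        by (intro sum.cong refl) (simp add: \<rho> i)
      ultimately have "weight a j * F j i = weight a i * F j i"
        using F(2)[OF torus_SL2[OF a] i j] by (auto simp: sum_diag finite_Idx i j)
      then have w: "weight a j = weight a i" using nz by simp
      have "weight a j * a ^ (2 * level j) = weight a i * a ^ (2 * level i)"
        using weight_level[OF a, of j] weight_level[OF a, of i] sum_size_Idx[OF i] sum_size_Idx[OF j] rs by simp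
      moreover have "weight a i \<noteq> 0" using weight_level[OF a, of i] a by (metis mult_zero_left power_not_zero)
      ultimately show ?thesis using w by simp
    qed
    then have "2 * level j = 2 * level i"
      using level_le[OF i] level_le[OF j] rs by (intro powers_separated[OF big]) auto
    then show "level j = level i" by simp
  qed
qed

section \<open>Highest weight vectors and their images under \<open>lower\<close>\<close>

definition top_index :: "nat \<Rightarrow> nat \<Rightarrow> 2 multiset multiset" where
  "top_index r s = replicate_mset r (replicate_mset s 1)"

lemma top_index_Idx: "top_index r s \<in> Idx r s"
  by (auto simp: top_index_def multisets_of_size_def split: if_splits)

text \<open>The highest weight space is a line, spanned by the basis vector with index
  \<open>top_index r s\<close>.\<close>

lemma level_0: "M \<in> Idx r s \<Longrightarrow> level M = 0 \<longleftrightarrow> M = top_index r s"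
proof
  assume M: "M \<in> Idx r s" and "level M = 0"
  then have "\<mu> = replicate_mset s 1" if "\<mu> \<in># M" for \<mu>
    using that by (intro multiset_2_eqI) (auto simp: level_def multisets_of_size_def)
  then have "set_mset M \<subseteq> {replicate_mset s 1}" by auto
  then show "M = top_index r s"
    using set_mset_subset_singletonD M by (fastforce simp: top_index_def multisets_of_sizeD)
qed (auto simp: level_def top_index_def)

definition lower :: "'k :: field ^ 2 ^ 2" where
  "lower = mat2 1 0 1 1"

lemma lower_SL2: "lower \<in> carrier SL2"
  by (simp add: lower_def det_2)

text \<open>Column \<open>top_index r s\<close> is the image of a highest weight vector.\<close>

definition levels :: "nat \<Rightarrow> nat \<Rightarrow> ('k :: field ^ 2 ^ 2 \<Rightarrow> 2 multiset multiset \<Rightarrow> 2 multiset multiset \<Rightarrow> 'k) \<Rightarrow> nat set" where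
  "levels r s \<rho> = {level M | M. M \<in> Idx r s \<and> \<rho> lower M (top_index r s) \<noteq> 0}"

lemma levels_subset:
  fixes M :: "('k :: field ^ 2 ^ 2, 'k, 'v) gmod" and N :: "('k ^ 2 ^ 2, 'k, 'w) gmod"
  assumes iso: "rep_iso SL2 M N"
    and M: "rep_coords SL2 M (Idx r s) \<rho> \<kappa>" and N: "rep_coords SL2 N (Idx r' s') \<tau> \<eta>"
    and \<rho>: "\<And>a i j. i \<in> Idx r s \<Longrightarrow> j \<in> Idx r s \<Longrightarrow> \<rho> (torus a) i j = diag (weight a) i j"
    and \<tau>: "\<And>a i j. i \<in> Idx r' s' \<Longrightarrow> j \<in> Idx r' s' \<Longrightarrow> \<tau> (torus a) i j = diag (weight a) i j"
    and rs: "r' * s' = r * s"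
    and big: "infinite (UNIV :: 'k set) \<or> card (UNIV :: 'k set) > 1 + 2 * (r * s)"
  shows "levels r s \<rho> \<subseteq> levels r' s' \<tau>"
proof
  let ?I = "Idx r s" and ?J = "Idx r' s'" and ?t = "top_index r s" and ?t' = "top_index r' s'"
  obtain F where inj: "\<And>c. c \<in> vecs ?I \<Longrightarrow> (\<And>j. j \<in> ?J \<Longrightarrow> (\<Sum>i\<in>?I. F j i * c i) = 0) \<Longrightarrow> c = (\<lambda>_. 0)"
    and comm: "\<And>g i j. g \<in> carrier SL2 \<Longrightarrow> i \<in> ?I \<Longrightarrow> j \<in> ?J \<Longrightarrow>
      (\<Sum>j'\<in>?J. \<tau> g j j' * F j' i) = (\<Sum>i'\<in>?I. F j i' * \<rho> g i' i)"
    and lev: "\<And>i j. i \<in> ?I \<Longrightarrow> j \<in> ?J \<Longrightarrow> F j i \<noteq> 0 \<Longrightarrow> level j = level i"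
    using level_intertwiner[OF iso M N \<rho> \<tau> rs big] by blast
  fix k assume "k \<in> levels r s \<rho>"
  then obtain i where i: "i \<in> ?I" "level i = k" "\<rho> lower i ?t \<noteq> 0" by (auto simp: levels_def)
  \<comment> \<open>The component at level \<open>k\<close> of the image of the highest weight
    vector under \<open>lower\<close>. It is nonzero, so \<open>F\<close> sends it to a vector with
    a nonzero coordinate \<open>j\<close>.\<close>
  let ?c = "\<lambda>i. if i \<in> ?I \<and> level i = k then \<rho> lower i ?t else 0"
  have "?c \<in> vecs ?I" by (simp add: vecs_def)
  moreover have "?c \<noteq> (\<lambda>_. 0)" using i by (metis (mono_tags, lifting))
  ultimately obtain j where j: "j \<in> ?J" "(\<Sum>i\<in>?I. F j i * ?c i) \<noteq> 0" using inj by blast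
  then obtain i' where i': "i' \<in> ?I" "F j i' * ?c i' \<noteq> 0" by (meson sum.not_neutral_contains_not_neutral)
  then have lj: "level j = k" using lev[OF i'(1) j(1)] by (auto split: if_splits)
  \<comment> \<open>Row \<open>j\<close> of \<open>F\<close> vanishes outside level
    \<open>k\<close>, so the component may be replaced by the whole image, to which
    \<open>comm\<close> applies.\<close>
  have "(\<Sum>i\<in>?I. F j i * ?c i) = (\<Sum>i\<in>?I. F j i * \<rho> lower i ?t)"
  proof (rule sum.cong[OF refl])
    fix x assume x: "x \<in> ?I"
    show "F j x * ?c x = F j x * \<rho> lower x ?t"
      using lev[OF x j(1)] lj x by (cases "F j x = 0") auto
  qed
  also have "\<dots> = (\<Sum>j'\<in>?J. \<tau> lower j j' * F j' ?t)"
    by (rule comm[OF lower_SL2 top_index_Idx j(1), symmetric])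
  \<comment> \<open>Column \<open>?t\<close> of \<open>F\<close> is concentrated at
    \<open>?t'\<close>, the only index of level 0.\<close>
  also have "\<dots> = (\<Sum>j'\<in>{?t'}. \<tau> lower j j' * F j' ?t)"
  proof (rule sum.mono_neutral_right)
    show "\<forall>j'\<in>?J - {?t'}. \<tau> lower j j' * F j' ?t = 0"
    proof
      fix j' assume j': "j' \<in> ?J - {?t'}"
      then have "F j' ?t = 0"
        using lev[OF top_index_Idx, of j'] level_0[where M = j' and r = r' and s = s'] level_0[OF top_index_Idx, of r s] by auto
      then show "\<tau> lower j j' * F j' ?t = 0" by simp
    qed
  qed (use top_index_Idx finite_Idx in auto)
  finally have "\<tau> lower j ?t' \<noteq> 0" using j(2) by auto
  then show "k \<in> levels r' s' \<tau>" using j(1) lj by (auto simp: levels_def)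
qed

lemma symU_replicate:
  assumes "size \<mu> = r"
  shows "symU B \<mu> (replicate_mset r j) = of_nat (card (words \<mu>)) * prod_mset (image_mset (\<lambda>i. B i j) \<mu>)"
proof -
  have "word (replicate_mset r j) = restrict (\<lambda>_. j) {..<r}"
    using word_words[of "replicate_mset r j"] by (simp add: words_replicate)
  then have "symU B \<mu> (replicate_mset r j) = (\<Sum>s\<in>words \<mu>. \<Prod>k<size \<mu>. B (s k) j)"
    using assms by (simp add: symU_def)
  also have "\<dots> = (\<Sum>s\<in>words \<mu>. prod_mset (image_mset (\<lambda>i. B i j) \<mu>))"
    using prod_word[of _ \<mu> "\<lambda>i. B i j"] by (intro sum.cong refl) auto
  finally show ?thesis by simp
qed

lemma symL_replicate:
  assumes "size \<mu> = r"
  shows "symL B \<mu> (replicate_mset r j) = prod_mset (image_mset (\<lambda>i. B i j) \<mu>)"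
  using prod_word[OF word_words, of "\<lambda>i. B i j" \<mu>] assms by (simp add: symL_def words_replicate)

text \<open>\<open>lower\<close> sends X to X + Y. In the upper power X^s goes to (X + Y)^s, with
  multinomial coefficients; in the lower power the tensor power of X goes to that of X + Y, in which
  each orbit sum has coefficient 1. The same dichotomy recurs in the outer power.\<close>

lemma inner_lower:
  assumes "\<mu> \<in> multisets_of_size UNIV s"
  shows "symU (entry lower) \<mu> (replicate_mset s 1) = (of_nat (card (words \<mu>)) :: 'k :: field)"
    and "symL (entry lower) \<mu> (replicate_mset s 1) = (1 :: 'k :: field)"
proof -
  have 1: "entry lower i 1 = (1 :: 'k)" for i
    using exhaust_2[of i] by (auto simp: entry_def lower_def)
  show "symU (entry lower) \<mu> (replicate_mset s 1) = (of_nat (card (words \<mu>)) :: 'k :: field)"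
    and "symL (entry lower) \<mu> (replicate_mset s 1) = (1 :: 'k :: field)"
    using assms by (simp_all add: symU_replicate symL_replicate multisets_of_sizeD 1)
qed

lemma lower_top_index:
  assumes M: "M \<in> Idx r s"
  shows "symU (symU (entry lower)) M (top_index r s) =
      (of_nat (card (words M)) * prod_mset (image_mset (\<lambda>\<mu>. of_nat (card (words \<mu>))) M) :: 'k :: field)"
    and "symU (symL (entry lower)) M (top_index r s) = (of_nat (card (words M)) :: 'k)"
    and "symL (symU (entry lower)) M (top_index r s) =
      (prod_mset (image_mset (\<lambda>\<mu>. of_nat (card (words \<mu>))) M) :: 'k)"
    and "symL (symL (entry lower)) M (top_index r s) = (1 :: 'k)"
proof -
  have in_M: "\<mu> \<in> multisets_of_size UNIV s" if "\<mu> \<in># M" for \<mu>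
    using M that by (auto simp: multisets_of_size_def)
  have U: "image_mset (\<lambda>\<mu>. symU (entry lower) \<mu> (replicate_mset s 1)) M =
      image_mset (\<lambda>\<mu>. of_nat (card (words \<mu>)) :: 'k) M"
    and L: "image_mset (\<lambda>\<mu>. symL (entry lower) \<mu> (replicate_mset s 1)) M = image_mset (\<lambda>\<mu>. 1 :: 'k) M"
    by (intro image_mset_cong inner_lower in_M; assumption)+
  note sz = multisets_of_sizeD[OF M]
  show "symU (symU (entry lower)) M (top_index r s) =
      (of_nat (card (words M)) * prod_mset (image_mset (\<lambda>\<mu>. of_nat (card (words \<mu>))) M) :: 'k :: field)"
    and "symU (symL (entry lower)) M (top_index r s) = (of_nat (card (words M)) :: 'k)"
    and "symL (symU (entry lower)) M (top_index r s) =
      (prod_mset (image_mset (\<lambda>\<mu>. of_nat (card (words \<mu>))) M) :: 'k)"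
    and "symL (symL (entry lower)) M (top_index r s) = (1 :: 'k)"
    unfolding top_index_def symU_replicate[OF sz] symL_replicate[OF sz] U L by simp_all
qed

lemma levels_plethysm:
  assumes p: "prime p" "CHAR('k :: field) = p" and r: "r = p ^ m" and s: "s = p ^ n"
  shows "levels r s (\<lambda>g :: 'k ^ 2 ^ 2. symU (symU (entry g))) \<subseteq> {0, r * s}"
    and "levels r s (\<lambda>g :: 'k ^ 2 ^ 2. symU (symL (entry g))) \<subseteq> {k. r dvd k}"
    and "r \<in> levels r s (\<lambda>g :: 'k ^ 2 ^ 2. symU (symL (entry g)))"
    and "levels r s (\<lambda>g :: 'k ^ 2 ^ 2. symL (symU (entry g))) \<subseteq> {k. s dvd k}"
    and "s \<in> levels r s (\<lambda>g :: 'k ^ 2 ^ 2. symL (symU (entry g)))"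
    and "1 \<in> levels r s (\<lambda>g :: 'k ^ 2 ^ 2. symL (symL (entry g)))"
proof -
  have pos: "r > 0" "s > 0" using p r s by (auto simp: prime_gt_0_nat)
  then obtain r' s' where Suc: "r = Suc r'" "s = Suc s'" by (meson gr0_implies_Suc)
  have W: "of_nat (card (words M)) \<noteq> (0 :: 'k) \<longleftrightarrow> (\<exists>\<mu>. M = replicate_mset r \<mu>)" if "M \<in> Idx r s" for M
    using card_words_char[OF p, of M m] multisets_of_sizeD[OF that] r by simp
  have w: "of_nat (card (words \<mu>)) \<noteq> (0 :: 'k) \<longleftrightarrow> (\<exists>i. \<mu> = replicate_mset s i)"
    if "M \<in> Idx r s" "\<mu> \<in># M" for M \<mu>
    using card_words_char[OF p, of \<mu> n] that s by (auto simp: multisets_of_size_def)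
  have pure: "count \<mu> 2 = 0 \<or> count \<mu> 2 = s" if "\<mu> = replicate_mset s i" for \<mu> :: "2 multiset" and i
    using that by auto
  have inner: "\<exists>i. \<mu> = replicate_mset s i"
    if "M \<in> Idx r s" "prod_mset (image_mset (\<lambda>\<mu>. of_nat (card (words \<mu>))) M) \<noteq> (0 :: 'k)" "\<mu> \<in># M" for M \<mu>
    using that w[OF that(1,3)] by (auto simp: prod_mset_zero_iff)
  have rep: "level (replicate_mset r \<mu>) = r * count \<mu> 2" for \<mu>
    by (simp add: level_def sum_mset_replicate_mset)
  show "levels r s (\<lambda>g :: 'k ^ 2 ^ 2. symU (symU (entry g))) \<subseteq> {0, r * s}"
  proof
    fix k assume "k \<in> levels r s (\<lambda>g :: 'k ^ 2 ^ 2. symU (symU (entry g)))"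
    then obtain M where M: "M \<in> Idx r s" "k = level M" "of_nat (card (words M)) \<noteq> (0 :: 'k)"
      "prod_mset (image_mset (\<lambda>\<mu>. of_nat (card (words \<mu>))) M) \<noteq> (0 :: 'k)"
      by (auto simp: levels_def lower_top_index)
    obtain \<mu> where \<mu>: "M = replicate_mset r \<mu>" using W[OF M(1)] M(3) by blast
    then have "\<mu> \<in># M" using pos by simp
    then obtain i where "\<mu> = replicate_mset s i" using inner[OF M(1,4)] by blast
    then show "k \<in> {0, r * s}" using pure[of \<mu> i] rep[of \<mu>] M(2) \<mu> by auto
  qed
  show "levels r s (\<lambda>g :: 'k ^ 2 ^ 2. symU (symL (entry g))) \<subseteq> {k. r dvd k}"
  proof
    fix k assume "k \<in> levels r s (\<lambda>g :: 'k ^ 2 ^ 2. symU (symL (entry g)))"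
    then obtain M where M: "M \<in> Idx r s" "k = level M" "of_nat (card (words M)) \<noteq> (0 :: 'k)"
      by (auto simp: levels_def lower_top_index)
    obtain \<mu> where \<mu>: "M = replicate_mset r \<mu>" using W[OF M(1)] M(3) by blast
    then show "k \<in> {k. r dvd k}" using rep[of \<mu>] M(2) by simp
  qed
  show "levels r s (\<lambda>g :: 'k ^ 2 ^ 2. symL (symU (entry g))) \<subseteq> {k. s dvd k}"
  proof
    fix k assume "k \<in> levels r s (\<lambda>g :: 'k ^ 2 ^ 2. symL (symU (entry g)))"
    then obtain M where M: "M \<in> Idx r s" "k = level M"
      "prod_mset (image_mset (\<lambda>\<mu>. of_nat (card (words \<mu>))) M) \<noteq> (0 :: 'k)"
      by (auto simp: levels_def lower_top_index)
    have "s dvd count \<mu> 2" if \<mu>: "\<mu> \<in># M" for \<mu>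
    proof -
      obtain i where "\<mu> = replicate_mset s i" using inner[OF M(1,3) \<mu>] by blast
      from pure[OF this] show ?thesis by auto
    qed
    then have "s dvd level M" unfolding level_def by (induction M) auto
    then show "k \<in> {k. s dvd k}" using M(2) by simp
  qed
  \<comment> \<open>The monomial X^(s-1) Y.\<close>
  let ?a = "add_mset 2 (replicate_mset s' 1) :: 2 multiset"
  have a: "size ?a = s" "count ?a 2 = 1" by (auto simp: Suc)
  show "r \<in> levels r s (\<lambda>g :: 'k ^ 2 ^ 2. symU (symL (entry g)))"
  proof -
    \<comment> \<open>A pure power of one outer variable, so its multinomial coefficient is
      1.\<close>
    let ?M = "replicate_mset r ?a"
    have M: "?M \<in> Idx r s" using a(1) by (auto simp: multisets_of_size_def split: if_splits)
    have "symU (symL (entry lower)) ?M (top_index r s) \<noteq> (0 :: 'k)"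
      unfolding lower_top_index[OF M] using W[OF M] by blast
    moreover have "level ?M = r" using rep[of ?a] a(2) by simp
    ultimately show ?thesis using M unfolding levels_def by force
  qed
  show "s \<in> levels r s (\<lambda>g :: 'k ^ 2 ^ 2. symL (symU (entry g)))"
  proof -
    \<comment> \<open>One Y^s and r - 1 copies of X^s: the inner factors are pure powers, whose
      multinomial coefficients are all 1.\<close>
    let ?M = "add_mset (replicate_mset s 2) (replicate_mset r' (replicate_mset s 1)) :: 2 multiset multiset"
    have M: "?M \<in> Idx r s" by (auto simp: multisets_of_size_def Suc(1) split: if_splits)
    have "prod_mset (image_mset (\<lambda>\<mu>. of_nat (card (words \<mu>))) ?M) = (1 :: 'k)"
      by (simp add: words_replicate)
    then have "symL (symU (entry lower)) ?M (top_index r s) \<noteq> (0 :: 'k)"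
      unfolding lower_top_index[OF M] by simp
    moreover have "level ?M = s" by (simp add: level_def sum_mset_replicate_mset)
    ultimately show ?thesis using M unfolding levels_def by force
  qed
  show "1 \<in> levels r s (\<lambda>g :: 'k ^ 2 ^ 2. symL (symL (entry g)))"
  proof -
    \<comment> \<open>A single letter Y among all the others X; with two lower powers no coefficient
      can vanish.\<close>
    let ?M = "add_mset ?a (replicate_mset r' (replicate_mset s 1)) :: 2 multiset multiset"
    have M: "?M \<in> Idx r s" using a(1) by (auto simp: multisets_of_size_def Suc(1) split: if_splits)
    have "symL (symL (entry lower)) ?M (top_index r s) \<noteq> (0 :: 'k)"
      unfolding lower_top_index[OF M] by simp
    moreover have "level ?M = 1" using a(2) by (simp add: level_def sum_mset_replicate_mset)
    ultimately show ?thesis using M unfolding levels_def by force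
  qed
qed

subsection \<open>Characteristic two\<close>

text \<open>The monomial \<open>X\<^sup>s\<^sup>-\<^sup>iY\<^sup>i\<close>; the subtraction is truncated for \<open>i > s\<close>.\<close>

definition bm :: "nat \<Rightarrow> nat \<Rightarrow> 2 multiset" where
  "bm s i = replicate_mset (s - i) 1 + replicate_mset i 2"

lemma count_bm [simp]: "count (bm s i) 2 = i"
  by (simp add: bm_def)

lemma bm_in: "i \<le> s \<Longrightarrow> bm s i \<in> multisets_of_size UNIV s"
  by (simp add: bm_def multisets_of_size_def)

lemma bm_inject: "bm s i = bm s j \<longleftrightarrow> i = j"
  using count_bm by metis

definition upper :: "'k :: field ^ 2 ^ 2" where
  "upper = mat2 1 1 0 1"

lemma upper_SL2: "upper \<in> carrier SL2"
  by (simp add: upper_def det_2)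

lemma lin_form_add: "lin_form I (\<lambda>i. c i + d i) = lin_form I c + lin_form I d"
  by (simp add: lin_form_def single_add sum.distrib)

lemma lin_form_delta:
  assumes "finite I" "b \<in> I"
  shows "lin_form I (\<lambda>i. if b = i then 1 else 0) = (indet b :: _ \<Rightarrow>\<^sub>0 'k :: comm_semiring_1)"
proof -
  have "lin_form I (\<lambda>i. if b = i then 1 else 0) = (\<Sum>i\<in>I. if i = b then indet b else 0 :: _ \<Rightarrow>\<^sub>0 'k)"
    unfolding lin_form_def by (intro sum.cong refl) (auto simp: indet_def)
  then show ?thesis using assms by simp
qed

lemma two_eq_zero:
  assumes "CHAR('a :: comm_ring_1) = 2"
  shows "(x :: 'a) + x = 0"
proof -
  have "(of_nat 2 :: 'a) = 0" using of_nat_CHAR[where ?'a = 'a] assms by simp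
  then show ?thesis by (metis mult_2 mult_zero_left of_nat_numeral)
qed

text \<open>The hypothesis is stated elementwise because the identities are used for polynomials in
  the variables of the inner power and of the outer power.\<close>

lemma cube_char_2:
  assumes "\<And>z :: 'a :: comm_ring_1. z + z = 0"
  shows "(x + y :: 'a) ^ 2 = x ^ 2 + y ^ 2" "(x + y) ^ 3 = x ^ 3 + x ^ 2 * y + x * y ^ 2 + y ^ 3"
proof -
  have "(x + y) ^ 2 = x ^ 2 + y ^ 2 + (x * y + x * y)" by (simp add: power2_eq_square algebra_simps)
  then show "(x + y) ^ 2 = x ^ 2 + y ^ 2" by (simp only: assms add_0_right)
  have "(x + y) ^ 3 = x ^ 3 + x ^ 2 * y + x * y ^ 2 + y ^ 3 + ((x ^ 2 * y + x * y ^ 2) + (x ^ 2 * y + x * y ^ 2))"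
    by (simp add: power2_eq_square power3_eq_cube algebra_simps)
  then show "(x + y) ^ 3 = x ^ 3 + x ^ 2 * y + x * y ^ 2 + y ^ 3" by (simp only: assms add_0_right)
qed

lemma indet_bm:
  assumes "i \<le> s"
  shows "(Poly_Mapping.single (bm s i) 1 :: 2 multiset \<Rightarrow>\<^sub>0 'k :: comm_semiring_1) = indet 1 ^ (s - i) * indet 2 ^ i"
  by (simp add: indet_power mult_single bm_def)

lemma symU_upper:
  assumes \<mu>: "\<mu> \<in> multisets_of_size UNIV s" and i: "i \<le> s"
  shows "symU (entry (upper :: 'k :: field ^ 2 ^ 2)) \<mu> (bm s i) =
    Poly_Mapping.lookup (indet 1 ^ (s - i) * (indet 1 + indet 2) ^ i) \<mu>"
proof -
  have forms: "lin_form UNIV (\<lambda>i. entry (upper :: 'k ^ 2 ^ 2) i 1) = indet 1"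
    "lin_form UNIV (\<lambda>i. entry (upper :: 'k ^ 2 ^ 2) i 2) = indet 1 + indet 2"
    by (simp_all add: lin_form_def UNIV_2 entry_def upper_def indet_def)
  show ?thesis
    using lookup_genfun[of UNIV \<mu> s "bm s i" "entry (upper :: 'k ^ 2 ^ 2)"] \<mu> i
    by (simp add: bm_def forms)
qed

text \<open>\<open>upper\<close> substitutes X + Y for Y, and X^(s-i) (X + Y)^i is expanded in
  characteristic two. The monomials of the inner power then become the variables
  \<open>indet (bm s i)\<close> of the outer one.\<close>

lemma upper_forms:
  fixes s :: nat
  assumes char: "CHAR('k :: field) = 2"
  defines "L \<equiv> \<lambda>i. lin_form (multisets_of_size UNIV s) (\<lambda>\<mu>. symU (entry (upper :: 'k ^ 2 ^ 2)) \<mu> (bm s i))"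
  shows "L 0 = indet (bm s 0)"
    and "1 \<le> s \<Longrightarrow> L 1 = indet (bm s 0) + indet (bm s 1)"
    and "2 \<le> s \<Longrightarrow> L 2 = indet (bm s 0) + indet (bm s 2)"
    and "3 \<le> s \<Longrightarrow> L 3 = indet (bm s 0) + indet (bm s 1) + indet (bm s 2) + indet (bm s 3)"
proof -
  let ?I = "multisets_of_size (UNIV :: 2 set) s"
  let ?m = "\<lambda>i. Poly_Mapping.single (bm s i) 1 :: 2 multiset \<Rightarrow>\<^sub>0 'k"
  let ?x = "indet 1 :: 2 multiset \<Rightarrow>\<^sub>0 'k" and ?y = "indet 2 :: 2 multiset \<Rightarrow>\<^sub>0 'k"
  have two: "z + z = 0" for z :: "2 multiset \<Rightarrow>\<^sub>0 'k"
    by (rule two_eq_zero) (simp add: CHAR_poly_mapping char)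
  have L: "L i = lin_form ?I (\<lambda>\<mu>. Poly_Mapping.lookup (?x ^ (s - i) * (?x + ?y) ^ i) \<mu>)" if "i \<le> s" for i
    unfolding L_def lin_form_def by (intro sum.cong refl) (simp add: symU_upper that)
  have delta: "lin_form ?I (\<lambda>\<mu>. Poly_Mapping.lookup (?m i) \<mu>) = indet (bm s i)" if "i \<le> s" for i
    using lin_form_delta[OF finite_Idx(1) bm_in[OF that]] by (simp add: lookup_single when_def)
  have add: "lin_form ?I (\<lambda>\<mu>. Poly_Mapping.lookup (f + g) \<mu>) =
      lin_form ?I (\<lambda>\<mu>. Poly_Mapping.lookup f \<mu>) + lin_form ?I (\<lambda>\<mu>. Poly_Mapping.lookup g \<mu>)"
    for f g :: "2 multiset \<Rightarrow>\<^sub>0 'k"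
    by (simp add: lookup_add lin_form_add)
  show "L 0 = indet (bm s 0)"
    using L[of 0] delta[of 0] indet_bm[of 0 s, where ?'k = 'k] by simp
  show "L 1 = indet (bm s 0) + indet (bm s 1)" if s: "1 \<le> s"
  proof -
    obtain n where n: "s = n + 1" using s by (metis add.commute le_Suc_ex)
    have "?x ^ (s - 1) * (?x + ?y) ^ 1 = ?m 0 + ?m 1"
      by (simp add: indet_bm n algebra_simps power_add)
    then show ?thesis using L[OF s] s by (simp only: add delta)
  qed
  show "L 2 = indet (bm s 0) + indet (bm s 2)" if s: "2 \<le> s"
  proof -
    obtain n where n: "s = n + 2" using s by (metis add.commute le_Suc_ex)
    have "?x ^ (s - 2) * (?x + ?y) ^ 2 = ?m 0 + ?m 2"
      unfolding cube_char_2(1)[OF two] by (simp add: indet_bm n algebra_simps power_add power2_eq_square)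
    then show ?thesis using L[OF s] s by (simp only: add delta)
  qed
  show "L 3 = indet (bm s 0) + indet (bm s 1) + indet (bm s 2) + indet (bm s 3)" if s: "3 \<le> s"
  proof -
    obtain n where n: "s = n + 3" using s by (metis add.commute le_Suc_ex)
    have "?x ^ (s - 3) * (?x + ?y) ^ 3 = ?m 0 + ?m 1 + ?m 2 + ?m 3"
      unfolding cube_char_2(2)[OF two]
      by (simp add: indet_bm n algebra_simps power_add power2_eq_square power3_eq_cube)
    then show ?thesis using L[OF s] s by (simp only: add delta)
  qed
qed

text \<open>The vector is \<open>X\<^sup>q \<cdot> X\<^sup>q\<^sup>-\<^sup>3Y\<^sup>3 + X\<^sup>q\<^sup>-\<^sup>1Y \<cdot> X\<^sup>q\<^sup>-\<^sup>2Y\<^sup>2\<close> in \<open>Sym\<^sup>2 Sym\<^sup>q E\<close>.\<close>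

lemma fixed_vector:
  assumes char: "CHAR('k :: field) = 2" and q: "3 \<le> q" and M: "M \<in> Idx 2 q"
  shows "symU (symU (entry (upper :: 'k ^ 2 ^ 2))) M {#bm q 0, bm q 3#} +
      symU (symU (entry (upper :: 'k ^ 2 ^ 2))) M {#bm q 1, bm q 2#} =
    (if M = {#bm q 0, bm q 3#} then 1 else 0) + (if M = {#bm q 1, bm q 2#} then 1 else 0)"
proof -
  let ?S = "symU (entry (upper :: 'k ^ 2 ^ 2))"
  let ?v = "\<lambda>i. indet (bm q i) :: 2 multiset multiset \<Rightarrow>\<^sub>0 'k"
  note forms = upper_forms[OF char, of q]
  have two: "z + z = 0" for z :: "2 multiset multiset \<Rightarrow>\<^sub>0 'k"
    by (rule two_eq_zero) (simp add: CHAR_poly_mapping char)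
  \<comment> \<open>The two products are the images of the two terms of the vector; apart from these
    terms themselves every product of variables occurs twice.\<close>
  have "?v 0 * (?v 0 + ?v 1 + ?v 2 + ?v 3) + (?v 0 + ?v 1) * (?v 0 + ?v 2) =
      ?v 0 * ?v 3 + ?v 1 * ?v 2 + ((?v 0 * ?v 0 + ?v 0 * ?v 1 + ?v 0 * ?v 2) + (?v 0 * ?v 0 + ?v 0 * ?v 1 + ?v 0 * ?v 2))"
    by (simp add: algebra_simps)
  also have "\<dots> = ?v 0 * ?v 3 + ?v 1 * ?v 2" by (simp only: two add_0_right)
  finally have *: "?v 0 * (?v 0 + ?v 1 + ?v 2 + ?v 3) + (?v 0 + ?v 1) * (?v 0 + ?v 2) = ?v 0 * ?v 3 + ?v 1 * ?v 2" .
  have "symU ?S M {#bm q 0, bm q 3#} + symU ?S M {#bm q 1, bm q 2#} =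
      Poly_Mapping.lookup (?v 0 * (?v 0 + ?v 1 + ?v 2 + ?v 3) + (?v 0 + ?v 1) * (?v 0 + ?v 2)) M"
    using lookup_genfun[OF finite_Idx(1) M, of "{#bm q 0, bm q 3#}" ?S]
      lookup_genfun[OF finite_Idx(1) M, of "{#bm q 1, bm q 2#}" ?S] q forms
    by (simp add: lookup_add)
  also have "\<dots> = (if M = {#bm q 0, bm q 3#} then 1 else 0) + (if M = {#bm q 1, bm q 2#} then 1 else 0)"
    unfolding * by (auto simp: lookup_add indet_def mult_single lookup_single when_def add_mset_commute)
  finally show ?thesis .
qed

text \<open>The two cases are the partitions 1 + 1 + 1 and 2 + 1 of the number 3 into parts at most
  2, padded with parts 0.\<close>

lemma Idx_2_cases:
  assumes M: "M \<in> Idx q 2" and level: "level M = 3" and q: "q = n + 3"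
  shows "M = replicate_mset n (bm 2 0) + {#bm 2 1, bm 2 1, bm 2 1#} \<or>
    M = replicate_mset n (bm 2 0) + {#bm 2 0, bm 2 1, bm 2 2#}"
proof -
  let ?c = "\<lambda>i. count M (bm 2 i)"
  have elem: "\<mu> \<in> {bm 2 0, bm 2 1, bm 2 2}" if "\<mu> \<in># M" for \<mu>
  proof -
    have sz: "size \<mu> = 2" using M that by (auto simp: multisets_of_size_def)
    then have "count \<mu> 2 \<le> 2" using count_1_2[of \<mu>] by simp
    then have "count \<mu> 2 = 0 \<or> count \<mu> 2 = 1 \<or> count \<mu> 2 = 2" by linarith
    moreover have "\<mu> = bm 2 (count \<mu> 2)"
      using sz count_1_2[of \<mu>] by (intro multiset_2_eqI) (simp_all add: bm_def)
    ultimately show ?thesis by (metis insertCI)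
  qed
  have eq: "M = replicate_mset (?c 0) (bm 2 0) + replicate_mset (?c 1) (bm 2 1) + replicate_mset (?c 2) (bm 2 2)"
  proof (rule multiset_eqI)
    fix x
    show "count M x = count (replicate_mset (?c 0) (bm 2 0) + replicate_mset (?c 1) (bm 2 1) + replicate_mset (?c 2) (bm 2 2)) x"
    proof (cases "x \<in># M")
      case True
      then show ?thesis using elem[OF True] by (auto simp: bm_inject)
    next
      case False
      then show ?thesis by (auto simp: not_in_iff)
    qed
  qed
  have "size M = ?c 0 + ?c 1 + ?c 2" by (subst eq) simp
  then have sz: "?c 0 + ?c 1 + ?c 2 = n + 3" using M q by (simp add: multisets_of_sizeD)
  have "level M = ?c 1 + 2 * ?c 2"
    unfolding level_def by (subst eq) (simp add: sum_mset_replicate_mset)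
  then have "?c 1 + 2 * ?c 2 = 3" using level by simp
  then have "?c 2 = 0 \<and> ?c 1 = 3 \<or> ?c 2 = 1 \<and> ?c 1 = 1" by presburger
  then show ?thesis
  proof
    assume c: "?c 2 = 0 \<and> ?c 1 = 3"
    then have "?c 0 = n" using sz by simp
    then show ?thesis using eq c by (simp add: numeral_3_eq_3)
  next
    assume c: "?c 2 = 1 \<and> ?c 1 = 1"
    then have "?c 0 = Suc n" using sz by simp
    then show ?thesis using eq c by simp
  qed
qed

text \<open>With a, b, c for X^2, XY, Y^2, the substitution sends b to a + b and c to a + c. The
  rows a^(q-1) c and a^(q-2) b^2 of level 2 are chosen because each of them sees exactly one of the
  two columns of level 3.\<close>

lemma upper_entries:
  assumes char: "CHAR('k :: field) = 2" and q: "q = n + 3"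
  defines "S \<equiv> symU (symU (entry (upper :: 'k ^ 2 ^ 2)))"
    and "C \<equiv> replicate_mset n (bm 2 0)"
  shows "S (C + {#bm 2 0, bm 2 0, bm 2 2#}) (C + {#bm 2 1, bm 2 1, bm 2 1#}) = 0"
    and "S (C + {#bm 2 0, bm 2 0, bm 2 2#}) (C + {#bm 2 0, bm 2 1, bm 2 2#}) = 1"
    and "S (C + {#bm 2 0, bm 2 1, bm 2 1#}) (C + {#bm 2 1, bm 2 1, bm 2 1#}) = 1"
    and "S (C + {#bm 2 0, bm 2 1, bm 2 1#}) (C + {#bm 2 0, bm 2 1, bm 2 2#}) = 0"
proof -
  let ?v = "\<lambda>i. indet (bm 2 i) :: 2 multiset multiset \<Rightarrow>\<^sub>0 'k"
  let ?m = "\<lambda>K. Poly_Mapping.single (C + K) 1 :: 2 multiset multiset \<Rightarrow>\<^sub>0 'k"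
  note forms = upper_forms[OF char, of 2]
  have two: "z + z = 0" for z :: "2 multiset multiset \<Rightarrow>\<^sub>0 'k"
    by (rule two_eq_zero) (simp add: CHAR_poly_mapping char)
  have idx: "C + {#bm 2 i, bm 2 j, bm 2 k#} \<in> Idx q 2" if "i \<le> 2" "j \<le> 2" "k \<le> 2" for i j k
    using that bm_in[of _ 2] by (auto simp: multisets_of_size_def C_def q split: if_splits)
  have m: "?v 0 ^ n * (?v i * (?v j * ?v k)) = ?m {#bm 2 i, bm 2 j, bm 2 k#}" for i j k
    by (simp add: indet_power mult_single C_def) (simp add: indet_def mult_single add_mset_commute)
  have P: "S M (C + {#bm 2 1, bm 2 1, bm 2 1#}) =
      Poly_Mapping.lookup (?m {#bm 2 0, bm 2 0, bm 2 0#} + ?m {#bm 2 0, bm 2 0, bm 2 1#}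
        + ?m {#bm 2 0, bm 2 1, bm 2 1#} + ?m {#bm 2 1, bm 2 1, bm 2 1#}) M" if "M \<in> Idx q 2" for M
  proof -
    have "S M (C + {#bm 2 1, bm 2 1, bm 2 1#}) = Poly_Mapping.lookup (?v 0 ^ n * (?v 0 + ?v 1) ^ 3) M"
      using lookup_genfun[OF finite_Idx(1) that, of "C + {#bm 2 1, bm 2 1, bm 2 1#}" "symU (entry (upper :: 'k ^ 2 ^ 2))"] forms
      by (simp add: C_def q S_def power3_eq_cube mult_ac)
    also have "?v 0 ^ n * (?v 0 + ?v 1) ^ 3 = ?v 0 ^ n * (?v 0 * (?v 0 * ?v 0)) + ?v 0 ^ n * (?v 0 * (?v 0 * ?v 1))
        + ?v 0 ^ n * (?v 0 * (?v 1 * ?v 1)) + ?v 0 ^ n * (?v 1 * (?v 1 * ?v 1))"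
      unfolding cube_char_2(2)[OF two] by (simp add: power2_eq_square power3_eq_cube algebra_simps)
    finally show ?thesis unfolding m .
  qed
  have Q: "S M (C + {#bm 2 0, bm 2 1, bm 2 2#}) =
      Poly_Mapping.lookup (?m {#bm 2 0, bm 2 0, bm 2 0#} + ?m {#bm 2 0, bm 2 0, bm 2 2#}
        + ?m {#bm 2 0, bm 2 0, bm 2 1#} + ?m {#bm 2 0, bm 2 1, bm 2 2#}) M" if "M \<in> Idx q 2" for M
  proof -
    have "S M (C + {#bm 2 0, bm 2 1, bm 2 2#}) =
        Poly_Mapping.lookup (?v 0 ^ n * (?v 0 * ((?v 0 + ?v 1) * (?v 0 + ?v 2)))) M"
      using lookup_genfun[OF finite_Idx(1) that, of "C + {#bm 2 0, bm 2 1, bm 2 2#}" "symU (entry (upper :: 'k ^ 2 ^ 2))"] forms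
      by (simp add: C_def q S_def mult_ac)
    also have "?v 0 ^ n * (?v 0 * ((?v 0 + ?v 1) * (?v 0 + ?v 2))) =
        ?v 0 ^ n * (?v 0 * (?v 0 * ?v 0)) + ?v 0 ^ n * (?v 0 * (?v 0 * ?v 2))
        + ?v 0 ^ n * (?v 0 * (?v 0 * ?v 1)) + ?v 0 ^ n * (?v 0 * (?v 1 * ?v 2))"
      by (simp add: algebra_simps)
    finally show ?thesis unfolding m .
  qed
  have neq: "K \<noteq> K'" if "count K (bm 2 1) \<noteq> count K' (bm 2 1) \<or> count K (bm 2 2) \<noteq> count K' (bm 2 2)"
    for K K' :: "2 multiset multiset" using that by auto
  have lk: "Poly_Mapping.lookup (?m K) (C + K') = (if K = K' then 1 else 0)" for K K'
    by (simp add: lookup_single when_def)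
  have R: "C + {#bm 2 0, bm 2 0, bm 2 2#} \<in> Idx q 2" "C + {#bm 2 0, bm 2 1, bm 2 1#} \<in> Idx q 2"
    by (rule idx; simp)+
  show "S (C + {#bm 2 0, bm 2 0, bm 2 2#}) (C + {#bm 2 1, bm 2 1, bm 2 1#}) = 0"
    unfolding P[OF R(1)] lookup_add lk by (simp add: neq bm_inject)
  show "S (C + {#bm 2 0, bm 2 0, bm 2 2#}) (C + {#bm 2 0, bm 2 1, bm 2 2#}) = 1"
    unfolding Q[OF R(1)] lookup_add lk by (simp add: neq bm_inject)
  show "S (C + {#bm 2 0, bm 2 1, bm 2 1#}) (C + {#bm 2 1, bm 2 1, bm 2 1#}) = 1"
    unfolding P[OF R(2)] lookup_add lk by (simp add: neq bm_inject)
  show "S (C + {#bm 2 0, bm 2 1, bm 2 1#}) (C + {#bm 2 0, bm 2 1, bm 2 2#}) = 0"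
    unfolding Q[OF R(2)] lookup_add lk by (simp add: neq bm_inject)
qed

text \<open>The image of the fixed vector would be a vector of the same weight fixed by the upper
  unipotent matrix; writing \<open>A, B, C\<close> for \<open>X\<^sup>2, XY, Y\<^sup>2\<close>, that weight space is spanned by
  \<open>A\<^sup>q\<^sup>-\<^sup>3B\<^sup>3\<close> and \<open>A\<^sup>q\<^sup>-\<^sup>2BC\<close>, and it contains no nonzero fixed vector.\<close>

lemma not_iso_char_2:
  assumes char: "CHAR('k :: field) = 2" and q: "3 \<le> q"
    and big: "infinite (UNIV :: 'k set) \<or> card (UNIV :: 'k set) > 1 + 2 * (2 * q)"
  shows "\<not> rep_iso SL2 (Sym\<^sup>U 2 (Sym\<^sup>U q (natural_rep :: ('k ^ 2 ^ 2, 'k, 'k ^ 2) gmod)))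
    (Sym\<^sup>U q (Sym\<^sup>U 2 natural_rep))"
proof
  assume iso: "rep_iso SL2 (Sym\<^sup>U 2 (Sym\<^sup>U q (natural_rep :: ('k ^ 2 ^ 2, 'k, 'k ^ 2) gmod)))
    (Sym\<^sup>U q (Sym\<^sup>U 2 natural_rep))"
  let ?S = "\<lambda>g :: 'k ^ 2 ^ 2. symU (symU (entry g))"
  let ?I = "Idx 2 q" and ?J = "Idx q 2"
  obtain \<kappa> where M: "rep_coords SL2 (Sym\<^sup>U 2 (Sym\<^sup>U q (natural_rep :: ('k ^ 2 ^ 2, 'k, 'k ^ 2) gmod))) ?I ?S \<kappa>"
    using coords_plethysm(1) by blast
  obtain \<eta> where N: "rep_coords SL2 (Sym\<^sup>U q (Sym\<^sup>U 2 (natural_rep :: ('k ^ 2 ^ 2, 'k, 'k ^ 2) gmod))) ?J ?S \<eta>"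
    using coords_plethysm(1) by blast
  obtain F where inj: "\<And>c. c \<in> vecs ?I \<Longrightarrow> (\<And>j. j \<in> ?J \<Longrightarrow> (\<Sum>i\<in>?I. F j i * c i) = 0) \<Longrightarrow> c = (\<lambda>_. 0)"
    and comm: "\<And>g i j. g \<in> carrier SL2 \<Longrightarrow> i \<in> ?I \<Longrightarrow> j \<in> ?J \<Longrightarrow>
      (\<Sum>j'\<in>?J. ?S g j j' * F j' i) = (\<Sum>i'\<in>?I. F j i' * ?S g i' i)"
    and lev: "\<And>i j. i \<in> ?I \<Longrightarrow> j \<in> ?J \<Longrightarrow> F j i \<noteq> 0 \<Longrightarrow> level j = level i"
  proof (rule level_intertwiner[OF iso M N _ _ mult.commute big])
    show "?S (torus a) i j = diag (weight a) i j" if "i \<in> ?I" "j \<in> ?I" for a i j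
      by (rule torus_plethysm(1)[OF that])
    show "?S (torus a) i j = diag (weight a) i j" if "i \<in> ?J" "j \<in> ?J" for a i j
      by (rule torus_plethysm(1)[OF that])
  next
    fix F
    assume "\<And>c. c \<in> vecs ?I \<Longrightarrow> (\<And>j. j \<in> ?J \<Longrightarrow> (\<Sum>i\<in>?I. F j i * c i) = 0) \<Longrightarrow> c = (\<lambda>_. 0)"
      "\<And>g i j. g \<in> carrier SL2 \<Longrightarrow> i \<in> ?I \<Longrightarrow> j \<in> ?J \<Longrightarrow>
        (\<Sum>j'\<in>?J. ?S g j j' * F j' i) = (\<Sum>i'\<in>?I. F j i' * ?S g i' i)"
      "\<And>i j. i \<in> ?I \<Longrightarrow> j \<in> ?J \<Longrightarrow> F j i \<noteq> 0 \<Longrightarrow> level j = level i"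
    then show thesis by (rule that)
  qed
  let ?a = "{#bm q 0, bm q 3#}" and ?b = "{#bm q 1, bm q 2#}"
  have ab: "?a \<in> ?I" "?b \<in> ?I" "level ?a = 3" "level ?b = 3"
    using bm_in[of _ q] q by (auto simp: multisets_of_size_def level_def)
  have "count ?a (bm q 0) \<noteq> count ?b (bm q 0)" by (simp add: bm_inject)
  then have neq: "?a \<noteq> ?b" by metis
  \<comment> \<open>The vector of \<open>fixed_vector\<close> in coordinates; \<open>y\<close> will
    be its image under \<open>F\<close>.\<close>
  let ?c = "\<lambda>i. (if i = ?a then 1 else 0) + (if i = ?b then 1 else 0 :: 'k)"
  have c: "?c \<in> vecs ?I" using ab by (auto simp: vecs_def)
  define y where "y = (\<lambda>j. F j ?a + F j ?b)"
  have sum_c: "(\<Sum>i\<in>?I. F j i * ?c i) = y j" for j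
  proof -
    have "(\<Sum>i\<in>?I. F j i * ?c i) = (\<Sum>i\<in>?I. (if i = ?a then F j i else 0) + (if i = ?b then F j i else 0))"
      by (intro sum.cong refl) auto
    then show ?thesis using ab finite_Idx(2)[where r = 2 and s = q] by (simp add: sum.distrib y_def)
  qed
  have fixed: "(\<Sum>j'\<in>?J. ?S upper j j' * y j') = y j" if j: "j \<in> ?J" for j
  proof -
    have "(\<Sum>j'\<in>?J. ?S upper j j' * y j') = (\<Sum>i'\<in>?I. F j i' * (?S upper i' ?a + ?S upper i' ?b))"
      using comm[OF upper_SL2 ab(1) j] comm[OF upper_SL2 ab(2) j]
      by (simp add: y_def distrib_left sum.distrib)
    also have "\<dots> = (\<Sum>i'\<in>?I. F j i' * ?c i')"
      by (intro sum.cong refl arg_cong[where f = "\<lambda>x. F j _ * x"] fixed_vector[OF char q])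
    finally show ?thesis by (simp only: sum_c)
  qed
  have lev_y: "y j = 0" if "j \<in> ?J" "level j \<noteq> 3" for j
  proof -
    have "F j ?a = 0" "F j ?b = 0"
      using lev[OF ab(1) that(1)] lev[OF ab(2) that(1)] ab(3,4) that(2) by metis+
    then show ?thesis by (simp add: y_def)
  qed
  obtain n where n: "q = n + 3" using q by (metis add.commute le_Suc_ex)
  let ?C = "replicate_mset n (bm 2 0)"
  let ?P = "?C + {#bm 2 1, bm 2 1, bm 2 1#}" and ?Q = "?C + {#bm 2 0, bm 2 1, bm 2 2#}"
  have idx: "?C + {#bm 2 i, bm 2 j, bm 2 k#} \<in> ?J" if "i \<le> 2" "j \<le> 2" "k \<le> 2" for i j k
    using that bm_in[of _ 2] by (auto simp: multisets_of_size_def n split: if_splits)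
  have level: "level (?C + {#bm 2 i, bm 2 j, bm 2 k#}) = i + j + k" for i j k
    by (simp add: level_def sum_mset_replicate_mset)
  have "count ?P (bm 2 2) \<noteq> count ?Q (bm 2 2)" by (simp add: bm_inject)
  then have PQ: "?P \<noteq> ?Q" by metis
  have supp: "(\<Sum>j'\<in>?J. ?S upper j j' * y j') = ?S upper j ?P * y ?P + ?S upper j ?Q * y ?Q" for j
  proof -
    have "(\<Sum>j'\<in>?J. ?S upper j j' * y j') = (\<Sum>j'\<in>{?P, ?Q}. ?S upper j j' * y j')"
    proof (rule sum.mono_neutral_right)
      show "\<forall>j'\<in>?J - {?P, ?Q}. ?S upper j j' * y j' = 0"
      proof
        fix j' assume j': "j' \<in> ?J - {?P, ?Q}"
        then have "level j' \<noteq> 3" using Idx_2_cases[of j' q n] n by blast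
        then show "?S upper j j' * y j' = 0" using lev_y[of j'] j' by simp
      qed
    qed (use idx[of 1 1 1] idx[of 0 1 2] finite_Idx in auto)
    then show ?thesis using PQ by simp
  qed
  \<comment> \<open>In these rows of level 2 the right-hand side of the fixed point equation
    vanishes, while the left-hand side is a single coordinate of \<open>y\<close>.\<close>
  have "y ?Q = 0"
    using fixed[OF idx[of 0 0 2]] lev_y[OF idx[of 0 0 2]] level[of 0 0 2]
    unfolding supp upper_entries[OF char n] by simp
  moreover have "y ?P = 0"
    using fixed[OF idx[of 0 1 1]] lev_y[OF idx[of 0 1 1]] level[of 0 1 1]
    unfolding supp upper_entries[OF char n] by simp
  ultimately have "y j = 0" if "j \<in> ?J" for j
    using lev_y[OF that] Idx_2_cases[OF that _ n] by (cases "level j = 3") auto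
  then have "?c = (\<lambda>_. 0)" using inj[OF c] sum_c by simp
  then have "?c ?a = 0" by (rule fun_cong)
  then show False using neq by simp
qed

subsection \<open>The classification\<close>

text \<open>Collects what the eight modules have in common, so that each of the 24 non-isomorphisms
  is an instance of \<open>plethystic_levels\<close>. The total degree \<open>N\<close> is shared,
  while \<open>r\<close> and \<open>s\<close> may be exchanged.\<close>

definition plethystic ::
    "nat \<Rightarrow> ('k :: field ^ 2 ^ 2, 'k, 'v) gmod \<Rightarrow> nat \<Rightarrow> nat \<Rightarrow>
      ('k ^ 2 ^ 2 \<Rightarrow> 2 multiset multiset \<Rightarrow> 2 multiset multiset \<Rightarrow> 'k) \<Rightarrow> bool" where
  "plethystic N M r s \<rho> \<longleftrightarrow> r * s = N \<and> (\<exists>\<kappa>. rep_coords SL2 M (Idx r s) \<rho> \<kappa>) \<and>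
     mat_hom SL2 (Idx r s) \<rho> \<and>
     (\<forall>a. \<forall>i\<in>Idx r s. \<forall>j\<in>Idx r s. \<rho> (torus a) i j = diag (weight a) i j)"

lemma plethysticI:
  fixes E :: "('k :: field ^ 2 ^ 2, 'k, 'k ^ 2) gmod"
  assumes "E = natural_rep" "r * s = N"
  shows "plethystic N (Sym\<^sup>U r (Sym\<^sup>U s E)) r s (\<lambda>g. symU (symU (entry g)))"
    and "plethystic N (Sym\<^sup>U r (Sym\<^sub>L s E)) r s (\<lambda>g. symU (symL (entry g)))"
    and "plethystic N (Sym\<^sub>L r (Sym\<^sup>U s E)) r s (\<lambda>g. symL (symU (entry g)))"
    and "plethystic N (Sym\<^sub>L r (Sym\<^sub>L s E)) r s (\<lambda>g. symL (symL (entry g)))"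
  unfolding plethystic_def assms(1)
  by (intro conjI allI ballI assms(2) coords_plethysm mat_hom_plethysm torus_plethysm; assumption)+

text \<open>Isomorphism is symmetric, so a level that occurs on one side only separates the modules,
  whichever side it is.\<close>

lemma plethystic_levels:
  fixes M :: "('k :: field ^ 2 ^ 2, 'k, 'v) gmod" and N :: "('k ^ 2 ^ 2, 'k, 'w) gmod"
  assumes big: "infinite (UNIV :: 'k set) \<or> card (UNIV :: 'k set) > 1 + 2 * d"
    and M: "plethystic d M r s \<rho>" and N: "plethystic d N r' s' \<tau>"
    and k: "k \<in> levels r s \<rho> \<longleftrightarrow> k \<notin> levels r' s' \<tau>"
  shows "\<not> rep_iso SL2 M N"
proof
  assume MN: "rep_iso SL2 M N"
  obtain \<kappa> where \<kappa>: "rep_coords SL2 M (Idx r s) \<rho> \<kappa>" using M by (auto simp: plethystic_def)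
  obtain \<eta> where \<eta>: "rep_coords SL2 N (Idx r' s') \<tau> \<eta>" using N by (auto simp: plethystic_def)
  have NM: "rep_iso SL2 N M" by (rule rep_iso_sym[OF MN \<kappa>])
  have d: "r * s = d" "r' * s' = d" using M N by (auto simp: plethystic_def)
  have "levels r s \<rho> \<subseteq> levels r' s' \<tau>"
    using M N big d by (intro levels_subset[OF MN \<kappa> \<eta>]) (auto simp: plethystic_def)
  moreover have "levels r' s' \<tau> \<subseteq> levels r s \<rho>"
    using M N big d by (intro levels_subset[OF NM \<eta> \<kappa>]) (auto simp: plethystic_def)
  ultimately show False using k by blast
qed

lemma plethystic_class:
  fixes M :: "('k :: field ^ 2 ^ 2, 'k, 'v) gmod" and N :: "('k ^ 2 ^ 2, 'k, 'w) gmod"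
  assumes "plethystic d M r s \<rho>" "plethystic d N r' s' \<tau>"
  shows "iso_class SL2 M = iso_class SL2 N \<longleftrightarrow> rep_iso SL2 M N"
proof -
  obtain \<kappa> where "rep_coords SL2 M (Idx r s) \<rho> \<kappa>" "mat_hom SL2 (Idx r s) \<rho>"
    using assms(1) by (auto simp: plethystic_def)
  moreover obtain \<eta> where "rep_coords SL2 N (Idx r' s') \<tau> \<eta>" using assms(2) by (auto simp: plethystic_def)
  ultimately show ?thesis by (rule iso_class_eq_iff[OF _ _ _ group_SL2])
qed

lemma plethystic_dual:
  fixes M :: "('k :: field ^ 2 ^ 2, 'k, 'v) gmod" and N :: "('k ^ 2 ^ 2, 'k, 'w) gmod"
    and M' :: "('k ^ 2 ^ 2, 'k, 'x) gmod" and N' :: "('k ^ 2 ^ 2, 'k, 'y) gmod"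
  assumes M: "plethystic d M r s \<rho>" and N: "plethystic d N r' s' \<tau>"
    and M': "rep_iso SL2 (dual_rep SL2 M) M'" and N': "rep_iso SL2 (dual_rep SL2 N) N'"
    and iso: "rep_iso SL2 M N"
  shows "rep_iso SL2 M' N'"
proof -
  obtain \<kappa> where \<kappa>: "rep_coords SL2 M (Idx r s) \<rho> \<kappa>" using M by (auto simp: plethystic_def)
  obtain \<eta> where \<eta>: "rep_coords SL2 N (Idx r' s') \<tau> \<eta>" using N by (auto simp: plethystic_def)
  have 1: "rep_iso SL2 M' (dual_rep SL2 M)"
    by (rule rep_iso_sym[OF M' rep_coords_dual[OF \<kappa> group_SL2]])
  have 2: "rep_iso SL2 (dual_rep SL2 M) (dual_rep SL2 N)"
    by (rule rep_iso_dual[OF iso \<kappa> coordsD(1)[OF rep_coordsD(1)[OF \<eta>]] group_SL2])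
  show ?thesis by (rule rep_iso_trans[OF 1 rep_iso_trans[OF 2 N']])
qed

lemma plethystic_sym:
  assumes "plethystic d M r s \<rho>" "rep_iso SL2 M N"
  shows "rep_iso SL2 N M"
proof -
  obtain \<kappa> where "rep_coords SL2 M (Idx r s) \<rho> \<kappa>" using assms(1) by (auto simp: plethystic_def)
  then show ?thesis by (rule rep_iso_sym[OF assms(2)])
qed

theorem proposition6p13:
  fixes p \<epsilon> :: nat and E :: "('k :: field ^ 2 ^ 2, 'k, 'k ^ 2) gmod"
  defines "E \<equiv> natural_rep"
  defines "A_UU \<equiv> Sym\<^sup>U p (Sym\<^sup>U (p ^ \<epsilon>) E)"
    and "A_UL \<equiv> Sym\<^sup>U p (Sym\<^sub>L (p ^ \<epsilon>) E)"
    and "A_LU \<equiv> Sym\<^sub>L p (Sym\<^sup>U (p ^ \<epsilon>) E)"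
    and "A_LL \<equiv> Sym\<^sub>L p (Sym\<^sub>L (p ^ \<epsilon>) E)"
    and "B_UU \<equiv> Sym\<^sup>U (p ^ \<epsilon>) (Sym\<^sup>U p E)"
    and "B_UL \<equiv> Sym\<^sup>U (p ^ \<epsilon>) (Sym\<^sub>L p E)"
    and "B_LU \<equiv> Sym\<^sub>L (p ^ \<epsilon>) (Sym\<^sup>U p E)"
    and "B_LL \<equiv> Sym\<^sub>L (p ^ \<epsilon>) (Sym\<^sub>L p E)"
  defines "iso_classes \<equiv>
      {iso_class SL2 A_UU, iso_class SL2 A_UL, iso_class SL2 A_LU, iso_class SL2 A_LL,
       iso_class SL2 B_UU, iso_class SL2 B_UL, iso_class SL2 B_LU, iso_class SL2 B_LL}"
  assumes "prime p" and "\<epsilon> > 1" and "CHAR('k) = p"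
    and "infinite (UNIV :: 'k set) \<or> card (UNIV :: 'k set) > 1 + 2 * p ^ (\<epsilon> + 1)"
  shows
    "\<comment> \<open>the two isomorphisms that hold, dual to each other\<close>
     (A_LU \<approx> B_UL \<and> A_UL \<approx> B_LU \<and>
       dual_rep SL2 A_LU \<approx> A_UL \<and> dual_rep SL2 B_UL \<approx> B_LU) \<and>
     \<comment> \<open>the two possible isomorphisms, dual to each other\<close>
     ((A_UU \<approx> B_UU \<longleftrightarrow> A_LL \<approx> B_LL) \<and>
       dual_rep SL2 A_UU \<approx> A_LL \<and> dual_rep SL2 B_UU \<approx> B_LL) \<and>
     \<comment> \<open>the other 24 pairs\<close>
     (\<not> A_UU \<approx> A_UL \<and> \<not> A_UU \<approx> A_LU \<and> \<not> A_UU \<approx> A_LL \<and> \<not> A_UU \<approx> B_UL \<and>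
       \<not> A_UU \<approx> B_LU \<and> \<not> A_UU \<approx> B_LL \<and>
       \<not> A_UL \<approx> A_LU \<and> \<not> A_UL \<approx> A_LL \<and> \<not> A_UL \<approx> B_UU \<and> \<not> A_UL \<approx> B_UL \<and>
       \<not> A_UL \<approx> B_LL \<and>
       \<not> A_LU \<approx> A_LL \<and> \<not> A_LU \<approx> B_UU \<and> \<not> A_LU \<approx> B_LU \<and> \<not> A_LU \<approx> B_LL \<and>
       \<not> A_LL \<approx> B_UU \<and> \<not> A_LL \<approx> B_UL \<and> \<not> A_LL \<approx> B_LU \<and>
       \<not> B_UU \<approx> B_UL \<and> \<not> B_UU \<approx> B_LU \<and> \<not> B_UU \<approx> B_LL \<and>
       \<not> B_UL \<approx> B_LU \<and> \<not> B_UL \<approx> B_LL \<and>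
       \<not> B_LU \<approx> B_LL) \<and>
     (card iso_classes = 4 \<or> card iso_classes = 6) \<and>
     (p = 2 \<longrightarrow> \<not> A_UU \<approx> B_UU \<and> \<not> A_LL \<approx> B_LL \<and> card iso_classes = 6)"
proof -
  define q where "q = p ^ \<epsilon>"
  note char = \<open>prime p\<close> \<open>CHAR('k) = p\<close>
  have p1: "1 < p" using \<open>prime p\<close> by (rule prime_gt_1_nat)
  have "p ^ 1 < p ^ \<epsilon>" using p1 \<open>\<epsilon> > 1\<close> by (intro power_strict_increasing) auto
  then have pq: "p < q" by (simp add: q_def)
  have big: "infinite (UNIV :: 'k set) \<or> card (UNIV :: 'k set) > 1 + 2 * (p * q)"
    using assms by (simp add: q_def)
  have "E = natural_rep" by (simp add: E_def)
  note pleth_A = plethysticI[where r = p and s = q, OF this refl]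
    and pleth_B = plethysticI[where r = q and s = p, OF this mult.commute]
  note A = pleth_A[unfolded q_def, folded A_UU_def A_UL_def A_LU_def A_LL_def, folded q_def]
    and B = pleth_B[unfolded q_def, folded B_UU_def B_UL_def B_LU_def B_LL_def, folded q_def]
  note A_levels = levels_plethysm[OF char power_one_right[symmetric] q_def]
    and B_levels = levels_plethysm[OF char q_def power_one_right[symmetric]]
  have "q < p * q" using p1 pq by simp
  then have less: "p < p * q" "q < p * q" "1 < p * q" using p1 pq by linarith+
  \<comment> \<open>That \<open>q\<close> does not divide \<open>p\<close> rests on
    \<open>\<epsilon> > 1\<close>.\<close>
  have nd: "\<not> p dvd 1" "\<not> q dvd 1" "\<not> q dvd p" using p1 pq by (auto dest: dvd_imp_le)
  have inner: "k \<notin> {0, p * q}" "k \<notin> {0, q * p}" if "0 < k" "k < p * q" for k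
    using that by (simp_all add: mult.commute[of q p])
  have pos: "0 < (1 :: nat)" "0 < p" "0 < q" using p1 pq by simp_all
  note ends = inner[OF pos(1) less(3)] inner[OF pos(2) less(1)] inner[OF pos(3) less(2)]
  have mult: "1 \<notin> {k. p dvd k}" "1 \<notin> {k. q dvd k}" "p \<notin> {k. q dvd k}" using nd by blast+
  note not_levels = ends(1,3,5)[THEN contra_subsetD[OF A_levels(1)]]
    mult(1)[THEN contra_subsetD[OF A_levels(2)]] mult(2,3)[THEN contra_subsetD[OF A_levels(4)]]
    ends(2,4,6)[THEN contra_subsetD[OF B_levels(1)]]
    mult(2,3)[THEN contra_subsetD[OF B_levels(2)]] mult(1)[THEN contra_subsetD[OF B_levels(4)]]
  note in_levels = A_levels(3,5,6) B_levels(3,5,6)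
  note distinct = plethystic_levels[OF big]
  \<comment> \<open>The levels 1, p and q decide all pairs. Two upper powers have none of them and
    two lower powers have 1; \<open>A_UL\<close> and \<open>B_LU\<close> have p but not 1;
    \<open>A_LU\<close> and \<open>B_UL\<close> have q but neither 1 nor p.\<close>
  have nAA: "\<not> A_UU \<approx> A_UL" "\<not> A_UU \<approx> A_LU" "\<not> A_UU \<approx> A_LL"
    "\<not> A_UL \<approx> A_LU" "\<not> A_UL \<approx> A_LL" "\<not> A_LU \<approx> A_LL"
    using distinct[OF A(1,2), of p] distinct[OF A(1,3), of q] distinct[OF A(1,4), of 1]
      distinct[OF A(2,3), of p] distinct[OF A(2,4), of 1] distinct[OF A(3,4), of 1]
    by (simp_all add: not_levels in_levels del: One_nat_def)
  have nAB: "\<not> A_UU \<approx> B_UL" "\<not> A_UU \<approx> B_LU" "\<not> A_UU \<approx> B_LL"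
    "\<not> A_UL \<approx> B_UU" "\<not> A_UL \<approx> B_UL" "\<not> A_UL \<approx> B_LL"
    "\<not> A_LU \<approx> B_UU" "\<not> A_LU \<approx> B_LU" "\<not> A_LU \<approx> B_LL"
    "\<not> A_LL \<approx> B_UU" "\<not> A_LL \<approx> B_UL" "\<not> A_LL \<approx> B_LU"
    using distinct[OF A(1) B(2), of q] distinct[OF A(1) B(3), of p] distinct[OF A(1) B(4), of 1]
      distinct[OF A(2) B(1), of p] distinct[OF A(2) B(2), of p] distinct[OF A(2) B(4), of 1]
      distinct[OF A(3) B(1), of q] distinct[OF A(3) B(3), of p] distinct[OF A(3) B(4), of 1]
      distinct[OF A(4) B(1), of 1] distinct[OF A(4) B(2), of 1] distinct[OF A(4) B(3), of 1]
    by (simp_all add: not_levels in_levels del: One_nat_def)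
  have nBB: "\<not> B_UU \<approx> B_UL" "\<not> B_UU \<approx> B_LU" "\<not> B_UU \<approx> B_LL"
    "\<not> B_UL \<approx> B_LU" "\<not> B_UL \<approx> B_LL" "\<not> B_LU \<approx> B_LL"
    using distinct[OF B(1,2), of q] distinct[OF B(1,3), of p] distinct[OF B(1,4), of 1]
      distinct[OF B(2,3), of p] distinct[OF B(2,4), of 1] distinct[OF B(3,4), of 1]
    by (simp_all add: not_levels in_levels del: One_nat_def)
  have dual_A: "dual_rep SL2 A_UU \<approx> A_LL" "dual_rep SL2 A_LU \<approx> A_UL" "dual_rep SL2 A_LL \<approx> A_UU"
    unfolding A_UU_def A_LL_def A_LU_def A_UL_def E_def by (rule dual_plethysm)+
  have dual_B: "dual_rep SL2 B_UU \<approx> B_LL" "dual_rep SL2 B_UL \<approx> B_LU" "dual_rep SL2 B_LL \<approx> B_UU"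
    unfolding B_UU_def B_LL_def B_LU_def B_UL_def E_def by (rule dual_plethysm)+
  have "B_UL \<approx> A_LU" unfolding B_UL_def A_LU_def E_def by (rule hermite_reciprocity)
  then have iso: "A_LU \<approx> B_UL" by (rule plethystic_sym[OF B(2)])
  have iso': "A_UL \<approx> B_LU" by (rule plethystic_dual[OF A(3) B(2) dual_A(2) dual_B(2) iso])
  have iff: "A_UU \<approx> B_UU \<longleftrightarrow> A_LL \<approx> B_LL"
    using plethystic_dual[OF A(1) B(1) dual_A(1) dual_B(1)]
      plethystic_dual[OF A(4) B(4) dual_A(3) dual_B(3)] by blast
  have classes: "iso_classes = {iso_class SL2 A_UU, iso_class SL2 A_UL, iso_class SL2 A_LU,
      iso_class SL2 A_LL, iso_class SL2 B_UU, iso_class SL2 B_LL}"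
    using iso iso' plethystic_class[OF A(3) B(2)] plethystic_class[OF A(2) B(3)]
    unfolding iso_classes_def by auto
  note class_iff = plethystic_class[OF A(1) A(2)] plethystic_class[OF A(1) A(3)] plethystic_class[OF A(1) A(4)]
    plethystic_class[OF A(1) B(1)] plethystic_class[OF A(1) B(4)] plethystic_class[OF A(2) A(3)]
    plethystic_class[OF A(2) A(4)] plethystic_class[OF A(2) B(1)] plethystic_class[OF A(2) B(4)]
    plethystic_class[OF A(3) A(4)] plethystic_class[OF A(3) B(1)] plethystic_class[OF A(3) B(4)]
    plethystic_class[OF A(4) B(1)] plethystic_class[OF A(4) B(4)] plethystic_class[OF B(1) B(4)]
  \<comment> \<open>The two undecided isomorphisms hold or fail together, by duality, so the number
    of classes cannot be five.\<close>
  have card: "card iso_classes = (if A_UU \<approx> B_UU then 4 else 6)"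
    unfolding classes using nAA nAB nBB iff by (simp add: card_insert_if class_iff)
  have two: "\<not> A_UU \<approx> B_UU" if "p = 2"
  proof -
    \<comment> \<open>The vector fixed by \<open>upper\<close> involves Y^3 and therefore needs q to
      be at least 3.\<close>
    have "3 \<le> q" using pq that by simp
    then show ?thesis
      using not_iso_char_2[of q, where ?'k = 'k] big char(2) that
      unfolding A_UU_def B_UU_def E_def q_def by simp
  qed
  show ?thesis
    using iso iso' dual_A dual_B iff nAA nAB nBB card two by auto
qed

end
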